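(* Let $\alpha,\beta\ge-1/2$. Let $\hat a\in C^{3k-1}[0,\infty)$ for some integer $k\ge1$, $\operatorname{supp}\hat a\subset[0,2]$, and $\hat a^{(m)}(0)=0$ for $m=1,2,\dots,3k-1$. Then there exists a constant $c>0$ of the form $c=c(k,\alpha,\beta)\|\hat a^{(3k-1)}\|_\infty$ such that the kernels $$L_n^{\alpha,\beta}(x,y)=\sum_{j=0}^\infty\hat a\Big(\frac jn\Big)\tilde P_j^{(\alpha,\beta)}(x)\tilde P_j^{(\alpha,\beta)}(y),\quad n\ge1,$$ satisfy $$|L_n^{\alpha,\beta}(x,y)|\le c\,\frac{n}{\sqrt{w_{\alpha,\beta}(n;x)}\sqrt{w_{\alpha,\beta}(n;y)}}\big(1+n\rho(x,y)\big)^{-k},\quad x,y\in[-1,1].$$ Consequently, if $\hat a$ is an admissible cutoff function, then for any integer $k\ge1$ the estimate $$|L_n^{\alpha,\beta}(x,y)|\le c\,\frac{n}{\sqrt{w_{\alpha,\beta}(n;x)}\sqrt{w_{\alpha,\beta}(n;y)}}\big(1+n\rho(x,y)\big)^{-k},\quad x,y\in[-1,1],\ n\ge1,$$ holds with a constant $c=c(k,\alpha,\beta)\|\hat a^{(3k-1)}\|_\infty$.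
   Context: $\tilde P_n^{(\alpha,\beta)}$ is the $n$th degree Jacobi polynomial normalized in $L^2([-1,1],(1-t)^\alpha(1+t)^\beta)$. For $n\ge1$, $w_{\alpha,\beta}(n;x)=(1-x+n^{-2})^{\alpha+1/2}(1+x+n^{-2})^{\beta+1/2}$. The distance on $[-1,1]$ is $\rho(x,y)=|\arccos x-\arccos y|$. Cutoff functions $\hat a:[0,\infty)\to\mathbb{C}$ are complex-valued; $\hat a\in C^\infty[0,\infty)$ is admissible if $\operatorname{supp}\hat a\subset[0,2]$ and $\hat a^{(m)}(0)=0$ for all $m\ge1$. *)

theory Defs
  imports "HOL-Analysis.Analysis"
begin

text \<open>Jacobi polynomials in the standard normalization
  $P_n^{(\alpha,\beta)}(1) = {n+\alpha \choose n}$ (Szego, Orthogonal Polynomials, (4.3.2)).\<close>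

definition jacobi :: "real \<Rightarrow> real \<Rightarrow> nat \<Rightarrow> real \<Rightarrow> real" where
  "jacobi \<alpha> \<beta> n x =
     (\<Sum>s\<le>n. ((real n + \<alpha>) gchoose (n - s)) * ((real n + \<beta>) gchoose s)
            * ((x - 1) / 2) ^ s * ((x + 1) / 2) ^ (n - s))"

text \<open>The norm of $L^2([-1,1],(1-t)^\alpha(1+t)^\beta)$. For negative exponents the weight is
  singular at an end point, where \<open>powr\<close> returns 0; this is a null set.\<close>

definition jacobi_L2_norm :: "real \<Rightarrow> real \<Rightarrow> (real \<Rightarrow> real) \<Rightarrow> real" where
  "jacobi_L2_norm \<alpha> \<beta> f =
     sqrt (LBINT t:{-1..1}. (f t)\<^sup>2 * ((1 - t) powr \<alpha> * (1 + t) powr \<beta>))"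

definition jacobi_normalized :: "real \<Rightarrow> real \<Rightarrow> nat \<Rightarrow> real \<Rightarrow> real" where
  "jacobi_normalized \<alpha> \<beta> n x = jacobi \<alpha> \<beta> n x / jacobi_L2_norm \<alpha> \<beta> (jacobi \<alpha> \<beta> n)"

definition jacobi_w :: "real \<Rightarrow> real \<Rightarrow> nat \<Rightarrow> real \<Rightarrow> real" where
  "jacobi_w \<alpha> \<beta> n x =
     (1 - x + 1 / (real n)\<^sup>2) powr (\<alpha> + 1/2) * (1 + x + 1 / (real n)\<^sup>2) powr (\<beta> + 1/2)"

definition arccos_dist :: "real \<Rightarrow> real \<Rightarrow> real" where
  "arccos_dist x y = \<bar>arccos x - arccos y\<bar>"

text \<open>Functions on $[0,\infty)$ are total functions on the reals. Everything below depends only on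
  their values on \<open>{0..}\<close>; derivatives are taken within \<open>{0..}\<close>, so one-sided at 0.\<close>

primrec deriv_halfline :: "nat \<Rightarrow> (real \<Rightarrow> complex) \<Rightarrow> real \<Rightarrow> complex" where
  "deriv_halfline 0 f = f"
| "deriv_halfline (Suc m) f = (\<lambda>t. vector_derivative (deriv_halfline m f) (at t within {0..}))"

definition C_halfline :: "nat \<Rightarrow> (real \<Rightarrow> complex) \<Rightarrow> bool" where
  "C_halfline m f \<longleftrightarrow>
     (\<forall>i<m. deriv_halfline i f differentiable_on {0..}) \<and> continuous_on {0..} (deriv_halfline m f)"

definition supp_halfline :: "(real \<Rightarrow> complex) \<Rightarrow> real set" where
  "supp_halfline f = closure (support_on {0..} f)"

text \<open>Only applied to bounded functions, where the supremum is the actual sup norm.\<close>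

definition sup_norm_halfline :: "(real \<Rightarrow> complex) \<Rightarrow> real" where
  "sup_norm_halfline f = (SUP t\<in>{0..}. cmod (f t))"

definition cutoff_of_order :: "nat \<Rightarrow> (real \<Rightarrow> complex) \<Rightarrow> bool" where
  "cutoff_of_order m a \<longleftrightarrow>
     C_halfline m a \<and> supp_halfline a \<subseteq> {0..2} \<and> (\<forall>i\<in>{1..m}. deriv_halfline i a 0 = 0)"

definition admissible_cutoff :: "(real \<Rightarrow> complex) \<Rightarrow> bool" where
  "admissible_cutoff a \<longleftrightarrow>
     (\<forall>m. C_halfline m a) \<and> supp_halfline a \<subseteq> {0..2} \<and> (\<forall>m\<ge>1. deriv_halfline m a 0 = 0)"

definition jacobi_kernel ::
    "real \<Rightarrow> real \<Rightarrow> (real \<Rightarrow> complex) \<Rightarrow> nat \<Rightarrow> real \<Rightarrow> real \<Rightarrow> complex" where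
  "jacobi_kernel \<alpha> \<beta> a n x y =
     (\<Sum>j. a (real j / real n)
          * complex_of_real (jacobi_normalized \<alpha> \<beta> j x * jacobi_normalized \<alpha> \<beta> j y))"

text \<open>The localization estimate of order \<open>k\<close> with constant \<open>c\<close>, for all \<open>n \<ge> 1\<close> and
  \<open>x, y \<in> [-1,1]\<close>.\<close>

definition kernel_localized ::
    "real \<Rightarrow> real \<Rightarrow> (real \<Rightarrow> complex) \<Rightarrow> nat \<Rightarrow> real \<Rightarrow> bool" where
  "kernel_localized \<alpha> \<beta> a k c \<longleftrightarrow>
     (\<forall>n\<ge>1. \<forall>x\<in>{-1..1}. \<forall>y\<in>{-1..1}.
        cmod (jacobi_kernel \<alpha> \<beta> a n x y)
        \<le> c * (real n / (sqrt (jacobi_w \<alpha> \<beta> n x) * sqrt (jacobi_w \<alpha> \<beta> n y)))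
            * (1 + real n * arccos_dist x y) powi (- int k))"

end

theory Submission
  imports Defs
begin

text \<open>Write \<open>freq j = j + (\<alpha> + \<beta> + 1) / 2\<close>, so that the Jacobi polynomials are eigenfunctions of a
  second order operator with eigenvalues \<open>freq j\<^sup>2\<close> up to a constant. The kernel belongs to
  \<open>f (sqrt L)\<close> with \<open>f (freq j) = a (j / n)\<close>. Since the derivatives of the cutoff vanish at 0, \<open>f\<close> extends
  to a smooth even function, hence it is a superposition of cosines \<open>cos (s * freq j)\<close>, that is, of wave
  propagators. Waves travel with unit speed in the variable \<open>arccos x\<close>, so an energy estimate with
  polynomial weights shows that \<open>f (sqrt L)\<close> is bounded on \<open>L\<^sup>2\<close> weighted by
  \<open>(1 + (n \<rho>(x, \<cdot>))\<^sup>2) ^ k\<close>. It is applied to \<open>T * K\<close>, where \<open>K\<close> is the reproducing kernel at \<open>x\<close> of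
  the polynomials of degree \<open>O(n)\<close> and \<open>T\<close> a polynomial localized around \<open>x\<close> with \<open>T x = 1\<close>:
  this product reproduces lower degrees, is localized, and its norm is controlled by the
  Christoffel function bound \<open>K(x, x) \<le> C n / w(n; x)\<close>. The Christoffel bound in turn follows from
  the Chebyshev case by multiplication with \<open>T\<close>. The same polynomials turn the weighted \<open>L\<^sup>2\<close> bound into
  a pointwise one.\<close>

section \<open>Jacobi weights and Jacobi polynomials\<close>

locale jacobi_weight =
  fixes \<alpha> \<beta> :: real
  assumes alpha_ge: "\<alpha> \<ge> - 1/2" and beta_ge: "\<beta> \<ge> - 1/2"
begin

definition wt :: "real \<Rightarrow> real" where
  "wt t = (1 - t) powr \<alpha> * (1 + t) powr \<beta>"

definition mu :: "real measure" where
  "mu = density (restrict_space lborel {-1..1}) (\<lambda>t. ennreal (wt t))"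

lemma wt_nonneg: "wt t \<ge> 0"
  by (simp add: wt_def)

lemma wt_measurable [measurable]: "wt \<in> borel_measurable borel"
  unfolding wt_def by measurable

lemma wt_has_integral: "\<exists>I>0. (wt has_integral I) {-1..1}"
proof -
  define B where "B = Beta (\<beta> + 1) (\<alpha> + 1)"
  have pos: "\<alpha> + 1 > 0" "\<beta> + 1 > 0" using alpha_ge beta_ge by auto
  have "B > 0" unfolding B_def Beta_def using pos by (simp add: Gamma_real_pos)
  have "((\<lambda>t. t powr \<beta> * (1 - t) powr \<alpha>) has_integral B) (cbox 0 1)"
    using has_integral_Beta_real[of "\<beta> + 1" "\<alpha> + 1"] pos by (simp add: B_def)
  from has_integral_affinity'[OF this, of "1/2" "1/2"]
  have "((\<lambda>x. ((1 + x) / 2) powr \<beta> * ((1 - x) / 2) powr \<alpha>) has_integral (2 * B)) {-1..1}"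
    by (simp add: field_simps)
  then have "((\<lambda>x. ((1 + x) / 2) powr \<beta> * ((1 - x) / 2) powr \<alpha> * 2 powr (\<alpha> + \<beta>)) has_integral (2 * B * 2 powr (\<alpha> + \<beta>))) {-1..1}"
    by (rule has_integral_mult_left)
  moreover have "((1 + x) / 2) powr \<beta> * ((1 - x) / 2) powr \<alpha> * 2 powr (\<alpha> + \<beta>) = wt x" if "x \<in> {-1..1}" for x
    using that by (simp add: wt_def powr_divide powr_add field_simps)
  ultimately have "(wt has_integral (2 * B * 2 powr (\<alpha> + \<beta>))) {-1..1}"
    by (metis (no_types, lifting) has_integral_cong)
  then show ?thesis using \<open>B > 0\<close> by (intro exI[of _ "2 * B * 2 powr (\<alpha> + \<beta>)"]) auto
qed

lemma wt_set_integrable: "set_integrable lborel {-1..1} wt"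
proof -
  have "wt integrable_on {-1..1}" using wt_has_integral by blast
  then have "wt absolutely_integrable_on {-1..1}"
    by (rule nonnegative_absolutely_integrable_1) (simp add: wt_nonneg)
  then show ?thesis
    unfolding set_integrable_def
    by (subst (asm) integrable_completion) (auto intro!: borel_measurable_scaleR)
qed

lemma space_mu [simp]: "space mu = {-1..1}"
  by (simp add: mu_def space_restrict_space)

lemma sets_mu [simp, measurable_cong]: "sets mu = sets (restrict_space borel {-1..1})"
  by (simp add: mu_def sets_restrict_space)

lemma emeasure_mu_space: "emeasure mu {-1..1} = ennreal (integral {-1..1} wt)"
proof -
  have "emeasure mu (space mu) = (\<integral>\<^sup>+t. ennreal (wt t) \<partial>restrict_space lborel {-1..1})"
    unfolding mu_def
    by (subst emeasure_density)
       (auto intro!: nn_integral_cong measurable_restrict_space1 simp: space_restrict_space sets_restrict_space image_iff)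
  also have "\<dots> = (\<integral>\<^sup>+t. ennreal (indicator {-1..1} t *\<^sub>R wt t) \<partial>lborel)"
    by (subst nn_integral_restrict_space) (auto intro!: nn_integral_cong split: split_indicator)
  also have "\<dots> = ennreal (LBINT t:{-1..1}. wt t)"
    unfolding set_lebesgue_integral_def
    by (rule nn_integral_eq_integral) (use wt_set_integrable in \<open>auto simp: set_integrable_def wt_nonneg\<close>)
  also have "(LBINT t:{-1..1}. wt t) = integral {-1..1} wt"
    by (rule set_borel_integral_eq_integral(2)[OF wt_set_integrable])
  finally show ?thesis by simp
qed

sublocale finite_measure mu
  by (rule finite_measureI) (simp add: emeasure_mu_space)

definition mass :: real where "mass = measure mu {-1..1}"

lemma mass_eq: "mass = integral {-1..1} wt"
  using wt_has_integral unfolding mass_def measure_def emeasure_mu_space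
  by (auto simp: integral_unique wt_nonneg intro!: enn2real_ennreal integral_nonneg)

lemma mass_pos: "mass > 0"
  using wt_has_integral by (auto simp: mass_eq integral_unique)

lemma integral_const_mu: "(LINT t|mu. c) = mass * (c::real)"
  by (simp add: mass_def)

lemma measurable_mu: "continuous_on {-1..1} f \<Longrightarrow> (f :: real \<Rightarrow> real) \<in> borel_measurable mu"
  using borel_measurable_continuous_on_restrict[of "{-1..1}" f]
  by (simp cong: measurable_cong_sets)

lemma integrable_mu:
  fixes f :: "real \<Rightarrow> real"
  assumes "continuous_on {-1..1} f"
  shows "integrable mu f"
proof -
  have "bounded (f ` {-1..1})"
    by (intro compact_imp_bounded compact_continuous_image assms) simp
  then obtain B where "\<And>t. t \<in> {-1..1} \<Longrightarrow> norm (f t) \<le> B"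
    unfolding bounded_iff by blast
  then show ?thesis
    by (intro integrable_const_bound[of _ B] AE_I2 measurable_mu assms) auto
qed

lemma integral_mu:
  fixes f :: "real \<Rightarrow> real"
  assumes "f \<in> borel_measurable mu"
  shows "(LINT t|mu. f t) = (LBINT t:{-1..1}. f t * wt t)"
proof -
  have [measurable]: "f \<in> borel_measurable (restrict_space lborel {-1..1})"
    using assms by (simp add: sets_restrict_space cong: measurable_cong_sets)
  have "(LINT t|mu. f t) = (LINT t|restrict_space lborel {-1..1}. wt t *\<^sub>R f t)"
    unfolding mu_def
    by (rule integral_density) (auto simp: wt_nonneg intro!: measurable_restrict_space1)
  also have "\<dots> = (LBINT t:{-1..1}. f t * wt t)"
    by (subst integral_restrict_space) (auto simp: set_lebesgue_integral_def mult.commute)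
  finally show ?thesis .
qed

lemma set_integrable_mu:
  fixes f :: "real \<Rightarrow> real"
  assumes "integrable mu f"
  shows "set_integrable lborel {-1..1} (\<lambda>t. f t * wt t)"
proof -
  have fm: "f \<in> borel_measurable (restrict_space lborel {-1..1})"
    using borel_measurable_integrable[OF assms] by (simp add: sets_restrict_space cong: measurable_cong_sets)
  have "integrable (restrict_space lborel {-1..1}) (\<lambda>t. wt t *\<^sub>R f t)"
    using assms unfolding mu_def
    by (subst (asm) integrable_density) (auto simp: wt_nonneg fm intro!: measurable_restrict_space1)
  then show ?thesis
    by (subst (asm) integrable_restrict_space) (auto simp: set_integrable_def mult.commute)
qed

lemma integral_mu_HK:
  fixes f :: "real \<Rightarrow> real"
  assumes "integrable mu f"
  shows "(LINT t|mu. f t) = integral {-1..1} (\<lambda>t. f t * wt t)"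
  using integral_mu[OF borel_measurable_integrable[OF assms]]
    set_borel_integral_eq_integral(2)[OF set_integrable_mu[OF assms]] by simp

lemma integration_by_parts_mu:
  fixes h h' k :: "real \<Rightarrow> real"
  assumes h: "continuous_on {-1..1} h" and k: "continuous_on {-1..1} k"
    and h': "\<And>t. t \<in> {-1<..<1} \<Longrightarrow> (h has_real_derivative h' t) (at t)"
    and kh: "\<And>t. t \<in> {-1<..<1} \<Longrightarrow> k t = (1 - t\<^sup>2) * h' t"
  shows "(LINT t|mu. k t + (\<beta> - \<alpha> - (\<alpha> + \<beta> + 2) * t) * h t) = 0"
proof -
  define H where "H t = (1 - t) powr (\<alpha> + 1) * (1 + t) powr (\<beta> + 1) * h t" for t
  define F where "F t = (k t + (\<beta> - \<alpha> - (\<alpha> + \<beta> + 2) * t) * h t) * wt t" for t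
  have pos: "\<alpha> + 1 > 0" "\<beta> + 1 > 0" using alpha_ge beta_ge by auto
  have "continuous_on {-1..1} H"
    unfolding H_def by (intro continuous_intros h continuous_on_powr') (use pos in auto)
  moreover have "(H has_vector_derivative F t) (at t)" if t: "t \<in> {-1<..<1}" for t
  proof -
    have e: "(1 - t) powr (\<alpha> + 1) = (1 - t) * (1 - t) powr \<alpha>" "(1 + t) powr (\<beta> + 1) = (1 + t) * (1 + t) powr \<beta>"
      using t by (simp_all add: powr_add)
    have "(H has_real_derivative
       (- (\<alpha> + 1) * (1 - t) powr \<alpha>) * (1 + t) powr (\<beta> + 1) * h t +
       (1 - t) powr (\<alpha> + 1) * ((\<beta> + 1) * (1 + t) powr \<beta>) * h t +
       (1 - t) powr (\<alpha> + 1) * (1 + t) powr (\<beta> + 1) * h' t) (at t)"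
      unfolding H_def using t
      by (auto intro!: derivative_eq_intros h' simp: algebra_simps)
    also have "(- (\<alpha> + 1) * (1 - t) powr \<alpha>) * (1 + t) powr (\<beta> + 1) * h t +
       (1 - t) powr (\<alpha> + 1) * ((\<beta> + 1) * (1 + t) powr \<beta>) * h t +
       (1 - t) powr (\<alpha> + 1) * (1 + t) powr (\<beta> + 1) * h' t = F t"
      unfolding F_def kh[OF t] wt_def e power2_eq_square by (simp add: algebra_simps)
    finally show ?thesis by (simp add: has_real_derivative_iff_has_vector_derivative)
  qed
  ultimately have "(F has_integral (H 1 - H (-1))) {-1..1}"
    by (intro fundamental_theorem_of_calculus_interior) auto
  moreover have "H 1 = 0" "H (-1) = 0" by (auto simp: H_def)
  ultimately have "integral {-1..1} F = 0" by (simp add: integral_unique)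
  moreover have "integrable mu (\<lambda>t. k t + (\<beta> - \<alpha> - (\<alpha> + \<beta> + 2) * t) * h t)"
    by (intro integrable_mu continuous_intros h k)
  ultimately show ?thesis by (simp add: integral_mu_HK F_def[abs_def])
qed

end

context jacobi_weight
begin

definition jpoly :: "nat \<Rightarrow> real poly" where
  "jpoly n = (\<Sum>s\<le>n. smult (((real n + \<alpha>) gchoose (n - s)) * ((real n + \<beta>) gchoose s))
     ([:-1/2, 1/2:] ^ s * [:1/2, 1/2:] ^ (n - s)))"

lemma poly_jpoly: "poly (jpoly n) x = jacobi \<alpha> \<beta> n x"
  unfolding jpoly_def jacobi_def poly_sum
  by (intro sum.cong refl) (simp add: field_simps)

lemma degree_jpoly: "degree (jpoly n) \<le> n"
proof -
  have "degree ([:-1/2, 1/2:] ^ s * [:1/2, 1/2:] ^ (n - s) :: real poly) \<le> n" if "s \<le> n" for s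
    using that by (subst degree_mult_eq) (simp_all add: degree_power_eq)
  then show ?thesis
    unfolding jpoly_def
    by (intro degree_sum_le) (auto intro: order.trans[OF degree_smult_le])
qed

lemma gchoose_pos:
  assumes "a > real k - 1"
  shows "(a gchoose k) > 0"
  unfolding gbinomial_prod_rev using assms
  by (intro divide_pos_pos prod_pos) auto

lemma coeff_jpoly_pos: "coeff (jpoly n) n > 0"
proof -
  have c: "coeff ([:-1/2, 1/2:] ^ s * [:1/2, 1/2:] ^ (n - s) :: real poly) n = (1/2) ^ n" if "s \<le> n" for s
  proof -
    let ?P = "[:-1/2, 1/2:] ^ s * [:1/2, 1/2:] ^ (n - s) :: real poly"
    have "degree ?P = n"
      using that by (subst degree_mult_eq) (simp_all add: degree_power_eq)
    moreover have "lead_coeff ?P = (1/2) ^ s * (1/2) ^ (n - s)"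
      by (simp only: lead_coeff_mult lead_coeff_power) simp
    ultimately show ?thesis using that by (simp flip: power_add)
  qed
  have "coeff (jpoly n) n = (\<Sum>s\<le>n. ((real n + \<alpha>) gchoose (n - s)) * ((real n + \<beta>) gchoose s) * (1/2) ^ n)"
    unfolding jpoly_def coeff_sum coeff_smult by (intro sum.cong refl arg_cong2[where f = "(*)"] c) simp
  also have "\<dots> > 0"
  proof (intro sum_pos)
    fix s assume "s \<in> {..n}"
    then have "s \<le> n" by simp
    then have "real (n - s) \<le> real n" "real s \<le> real n" by auto
    then have "((real n + \<alpha>) gchoose (n - s)) > 0" "((real n + \<beta>) gchoose s) > 0"
      using alpha_ge beta_ge by (auto intro!: gchoose_pos)
    then show "((real n + \<alpha>) gchoose (n - s)) * ((real n + \<beta>) gchoose s) * (1/2) ^ n > 0" by simp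
  qed auto
  finally show ?thesis .
qed

lemma jpoly_nz: "jpoly n \<noteq> 0"
  using coeff_jpoly_pos[of n] by auto

definition Lop :: "real poly \<Rightarrow> real poly" where
  "Lop p = [:1, 0, -1:] * pderiv (pderiv p) + [:\<beta> - \<alpha>, - (\<alpha> + \<beta> + 2):] * pderiv p"

lemma poly_Lop: "poly (Lop p) t =
    (1 - t\<^sup>2) * poly (pderiv (pderiv p)) t + (\<beta> - \<alpha> - (\<alpha> + \<beta> + 2) * t) * poly (pderiv p) t"
  by (simp add: Lop_def algebra_simps power2_eq_square)

lemma pderiv_sum: "pderiv (sum f A) = (\<Sum>x\<in>A. pderiv (f x))"
  by (induction A rule: infinite_finite_induct) (auto simp: pderiv_add)

lemma Lop_sum: "Lop (sum f A) = (\<Sum>x\<in>A. Lop (f x))"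
  by (simp add: Lop_def pderiv_sum sum_distrib_left sum.distrib)

lemma Lop_smult: "Lop (smult c p) = smult c (Lop p)"
  by (simp add: Lop_def pderiv_smult smult_add_right)

lemma Lop_monomial:
  fixes s r :: nat and x :: real
  defines "u \<equiv> (x - 1) / 2" and "v \<equiv> (x + 1) / 2"
  shows "poly (Lop ([:-1/2, 1/2:] ^ s * [:1/2, 1/2:] ^ r)) x =
     - (real s * (real s + \<alpha>)) * (u ^ (s - 1) * v ^ (r + 1))
     - (2 * real s * real r + (\<alpha> + 1) * real r + (\<beta> + 1) * real s) * (u ^ s * v ^ r)
     - (real r * (real r + \<beta>)) * (u ^ (s + 1) * v ^ (r - 1))"
proof -
  let ?U = "[:-1/2, 1/2:] :: real poly" and ?V = "[:1/2, 1/2:] :: real poly"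
  have pd: "pderiv (?U ^ s * ?V ^ r) =
      smult (real s / 2) (?U ^ (s - 1) * ?V ^ r) + smult (real r / 2) (?U ^ s * ?V ^ (r - 1))" for s r
    by (simp add: pderiv_mult pderiv_power pderiv_pCons algebra_simps)
  have U: "poly ?U x = u" and V: "poly ?V x = v" by (simp_all add: u_def v_def field_simps)
  have 1: "poly (pderiv (?U ^ s * ?V ^ r)) x = real s / 2 * (u ^ (s - 1) * v ^ r) + real r / 2 * (u ^ s * v ^ (r - 1))"
    unfolding pd by (simp only: poly_add poly_smult poly_mult poly_power U V)
  have 2: "poly (pderiv (pderiv (?U ^ s * ?V ^ r))) x =
      real s / 2 * (real (s - 1) / 2 * (u ^ (s - 1 - 1) * v ^ r) + real r / 2 * (u ^ (s - 1) * v ^ (r - 1)))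
      + real r / 2 * (real s / 2 * (u ^ (s - 1) * v ^ (r - 1)) + real (r - 1) / 2 * (u ^ s * v ^ (r - 1 - 1)))"
    unfolding pd pderiv_add pderiv_smult by (simp only: poly_add poly_smult poly_mult poly_power U V)
  have e: "1 - x\<^sup>2 = -4 * (u * v)" "\<beta> - \<alpha> - (\<alpha> + \<beta> + 2) * x = -2 * ((\<alpha> + 1) * v + (\<beta> + 1) * u)"
    by (simp_all add: u_def v_def field_simps power2_eq_square)
  have a: "real s * real (s - 1) * (u * u ^ (s - 1 - 1)) = real s * (real s - 1) * u ^ (s - 1)"
    by (cases s; cases "s - 1") auto
  have a': "real r * real (r - 1) * (v * v ^ (r - 1 - 1)) = real r * (real r - 1) * v ^ (r - 1)"
    by (cases r; cases "r - 1") auto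
  have b: "real s * (u * u ^ (s - 1)) = real s * u ^ s" by (cases s) auto
  have b': "real r * (v * v ^ (r - 1)) = real r * v ^ r" by (cases r) auto
  have "poly (Lop (?U ^ s * ?V ^ r)) x =
     - ((real s * real (s - 1) * (u * u ^ (s - 1 - 1))) * (v * v ^ r)
        + 2 * (real s * (u * u ^ (s - 1))) * (real r * (v * v ^ (r - 1)))
        + (u * u ^ s) * (real r * real (r - 1) * (v * v ^ (r - 1 - 1))))
     - ((\<alpha> + 1) * (real s * u ^ (s - 1) * (v * v ^ r) + (real r * (v * v ^ (r - 1))) * u ^ s)
        + (\<beta> + 1) * ((real s * (u * u ^ (s - 1))) * v ^ r + real r * v ^ (r - 1) * (u * u ^ s)))"
    unfolding poly_Lop e 1 2 by (simp add: field_simps)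
  then show ?thesis unfolding a a' b b' by (simp add: algebra_simps)
qed

definition eig :: "nat \<Rightarrow> real" where "eig n = real n * (real n + \<alpha> + \<beta> + 1)"

lemma gchoose_Suc_mult: "((a::real) gchoose Suc k) * real (Suc k) = (a - real k) * (a gchoose k)"
  unfolding gbinomial_prod_rev fact_Suc prod.atLeast0_lessThan_Suc by (simp del: of_nat_Suc)

lemma Lop_jpoly: "Lop (jpoly n) = smult (- eig n) (jpoly n)"
proof -
  define c where "c s = ((real n + \<alpha>) gchoose (n - s)) * ((real n + \<beta>) gchoose s)" for s
  have rec: "real (s + 1) * (real (s + 1) + \<alpha>) * c (s + 1) = (real n - real s) * (real n + \<beta> - real s) * c s"
    if "s < n" for s
  proof -
    obtain r where r: "n - s = Suc r" using \<open>s < n\<close> by (cases "n - s") auto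
    have r': "n - (s + 1) = r" "real r = real n - real s - 1" using r by auto
    have "((real n + \<alpha>) gchoose r) * (real (s + 1) + \<alpha>) = ((real n + \<alpha>) gchoose Suc r) * (real n - real s)"
      using gchoose_Suc_mult[of "real n + \<alpha>" r] r' by (simp add: algebra_simps)
    moreover have "((real n + \<beta>) gchoose Suc s) * real (s + 1) = (real n + \<beta> - real s) * ((real n + \<beta>) gchoose s)"
      using gchoose_Suc_mult[of "real n + \<beta>" s] by simp
    moreover have "real (s + 1) * (real (s + 1) + \<alpha>) * c (s + 1) =
        (((real n + \<alpha>) gchoose r) * (real (s + 1) + \<alpha>)) * (((real n + \<beta>) gchoose Suc s) * real (s + 1))"
      unfolding c_def r' by simp
    ultimately show ?thesis unfolding c_def r by simp
  qed
  have "poly (Lop (jpoly n)) x = - eig n * poly (jpoly n) x" for x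
  proof -
    define u where "u = (x - 1) / 2"
    define v where "v = (x + 1) / 2"
    define B where "B s = 2 * real s * (real n - real s) + (\<alpha> + 1) * (real n - real s) + (\<beta> + 1) * real s" for s
    have "poly (Lop (jpoly n)) x = (\<Sum>s\<le>n. c s * poly (Lop ([:-1/2, 1/2:] ^ s * [:1/2, 1/2:] ^ (n - s))) x)"
      unfolding jpoly_def Lop_sum Lop_smult poly_sum c_def by simp
    also have "\<dots> = (\<Sum>s\<le>n. - (c s * (real s * (real s + \<alpha>))) * (u ^ (s - 1) * v ^ (n - s + 1)))
       - (\<Sum>s\<le>n. c s * B s * (u ^ s * v ^ (n - s)))
       - (\<Sum>s\<le>n. c s * ((real n - real s) * (real n - real s + \<beta>)) * (u ^ (s + 1) * v ^ (n - s - 1)))"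
      unfolding Lop_monomial sum_subtractf[symmetric] u_def[symmetric] v_def[symmetric] B_def
      by (intro sum.cong refl) (simp add: algebra_simps of_nat_diff)
    also have "(\<Sum>s\<le>n. - (c s * (real s * (real s + \<alpha>))) * (u ^ (s - 1) * v ^ (n - s + 1))) =
       (\<Sum>s<n. - (c (s+1) * (real (s+1) * (real (s+1) + \<alpha>))) * (u ^ s * v ^ (n - (s+1) + 1)))"
      using sum.atMost_shift[of "\<lambda>s. - (c s * (real s * (real s + \<alpha>))) * (u ^ (s - 1) * v ^ (n - s + 1))" n] by simp
    also have "\<dots> = (\<Sum>s<n. - ((real n - real s) * (real n + \<beta> - real s) * c s) * (u ^ s * v ^ (n - s)))"
    proof (intro sum.cong refl)
      fix s assume "s \<in> {..<n}"
      then have "s < n" "n - (s + 1) + 1 = n - s" by auto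
      then show "- (c (s+1) * (real (s+1) * (real (s+1) + \<alpha>))) * (u ^ s * v ^ (n - (s+1) + 1)) =
          - ((real n - real s) * (real n + \<beta> - real s) * c s) * (u ^ s * v ^ (n - s))"
        using rec[of s] by (simp add: mult_ac)
    qed
    also have "\<dots> = (\<Sum>s\<le>n. - ((real n - real s) * (real n + \<beta> - real s) * c s) * (u ^ s * v ^ (n - s)))"
      by (simp add: lessThan_Suc_atMost[symmetric])
    also have "(\<Sum>s\<le>n. c s * ((real n - real s) * (real n - real s + \<beta>)) * (u ^ (s + 1) * v ^ (n - s - 1))) =
        (\<Sum>s<n. c s * ((real n - real s) * (real n - real s + \<beta>)) * (u ^ (s + 1) * v ^ (n - s - 1)))"
      by (simp add: lessThan_Suc_atMost[symmetric])
    also have "\<dots> = (\<Sum>s<n. c (s+1) * (real (s+1) * (real (s+1) + \<alpha>)) * (u ^ (s + 1) * v ^ (n - (s + 1))))"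
    proof (intro sum.cong refl)
      fix s assume "s \<in> {..<n}"
      then have "s < n" by auto
      then show "c s * ((real n - real s) * (real n - real s + \<beta>)) * (u ^ (s + 1) * v ^ (n - s - 1)) =
          c (s+1) * (real (s+1) * (real (s+1) + \<alpha>)) * (u ^ (s + 1) * v ^ (n - (s + 1)))"
        using arg_cong[OF rec[of s], of "\<lambda>y. y * (u ^ (s + 1) * v ^ (n - (s + 1)))"] by (simp add: algebra_simps)
    qed
    also have "\<dots> = (\<Sum>s\<le>n. c s * (real s * (real s + \<alpha>)) * (u ^ s * v ^ (n - s)))"
      using sum.atMost_shift[of "\<lambda>s. c s * (real s * (real s + \<alpha>)) * (u ^ s * v ^ (n - s))" n] by simp
    also have "(\<Sum>s\<le>n. - ((real n - real s) * (real n + \<beta> - real s) * c s) * (u ^ s * v ^ (n - s)))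
        - (\<Sum>s\<le>n. c s * B s * (u ^ s * v ^ (n - s)))
        - (\<Sum>s\<le>n. c s * (real s * (real s + \<alpha>)) * (u ^ s * v ^ (n - s)))
       = (\<Sum>s\<le>n. - eig n * (c s * (u ^ s * v ^ (n - s))))"
      unfolding sum_subtractf[symmetric] B_def eig_def
      by (intro sum.cong refl) algebra
    also have "\<dots> = - eig n * poly (jpoly n) x"
      unfolding jpoly_def poly_sum sum_distrib_left c_def u_def v_def
      by (intro sum.cong refl) (simp add: field_simps)
    finally show ?thesis .
  qed
  then have "poly (Lop (jpoly n)) = poly (smult (- eig n) (jpoly n))" by (auto simp: fun_eq_iff)
  then show ?thesis by (simp only: poly_eq_poly_eq_iff)
qed

lemma integral_Lop:
  fixes \<Psi> \<Psi>' k :: "real \<Rightarrow> real"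
  assumes "continuous_on {-1..1} \<Psi>" "continuous_on {-1..1} k"
    and "\<And>t. t \<in> {-1<..<1} \<Longrightarrow> (\<Psi> has_real_derivative \<Psi>' t) (at t)"
    and "\<And>t. t \<in> {-1<..<1} \<Longrightarrow> k t = (1 - t\<^sup>2) * \<Psi>' t"
  shows "(LINT t|mu. \<Psi> t * poly z t * poly (Lop u) t) =
     - (LINT t|mu. k t * poly z t * poly (pderiv u) t + \<Psi> t * ((1 - t\<^sup>2) * poly (pderiv z) t * poly (pderiv u) t))"
proof -
  define h where "h t = \<Psi> t * poly z t * poly (pderiv u) t" for t
  define h' where "h' t = \<Psi>' t * poly z t * poly (pderiv u) t + \<Psi> t * poly (pderiv z) t * poly (pderiv u) t
     + \<Psi> t * poly z t * poly (pderiv (pderiv u)) t" for t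
  define K where "K t = k t * poly z t * poly (pderiv u) t + \<Psi> t * ((1 - t\<^sup>2) * poly (pderiv z) t * poly (pderiv u) t)" for t
  define K2 where "K2 t = K t + \<Psi> t * poly z t * ((1 - t\<^sup>2) * poly (pderiv (pderiv u)) t)" for t
  note [continuous_intros] = continuous_on_poly
  have contK: "continuous_on {-1..1} K" unfolding K_def by (intro continuous_intros assms)
  have "(LINT t|mu. K2 t + (\<beta> - \<alpha> - (\<alpha> + \<beta> + 2) * t) * h t) = 0"
  proof (rule integration_by_parts_mu)
    show "continuous_on {-1..1} h" unfolding h_def by (intro continuous_intros assms)
    show "continuous_on {-1..1} K2" unfolding K2_def by (intro continuous_intros assms contK)
    show "(h has_real_derivative h' t) (at t)" if "t \<in> {-1<..<1}" for t
      unfolding h_def h'_def using assms(3)[OF that]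
      by (auto intro!: derivative_eq_intros simp: algebra_simps)
    show "K2 t = (1 - t\<^sup>2) * h' t" if "t \<in> {-1<..<1}" for t
      unfolding K2_def K_def h'_def assms(4)[OF that] by (simp add: algebra_simps)
  qed
  also have "(\<lambda>t. K2 t + (\<beta> - \<alpha> - (\<alpha> + \<beta> + 2) * t) * h t) = (\<lambda>t. K t + \<Psi> t * poly z t * poly (Lop u) t)"
    by (auto simp: K2_def h_def poly_Lop algebra_simps)
  also have "(LINT t|mu. K t + \<Psi> t * poly z t * poly (Lop u) t) =
      (LINT t|mu. K t) + (LINT t|mu. \<Psi> t * poly z t * poly (Lop u) t)"
    by (intro Bochner_Integration.integral_add integrable_mu contK continuous_intros assms)
  finally show ?thesis unfolding K_def by simp
qed

definition ip :: "real poly \<Rightarrow> real poly \<Rightarrow> real" where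
  "ip p q = (LINT t|mu. poly p t * poly q t)"

lemma integrable_poly2: "integrable mu (\<lambda>t. poly p t * poly q t)"
  by (intro integrable_mu continuous_intros)

lemma ip_commute: "ip p q = ip q p"
  by (simp add: ip_def mult.commute)

lemma ip_smult_left: "ip (smult c p) q = c * ip p q"
  by (simp add: ip_def mult.assoc)

lemma ip_smult_right: "ip p (smult c q) = c * ip p q"
  by (simp add: ip_smult_left ip_commute[of p])

lemma ip_sum_left: "ip (sum f A) q = (\<Sum>i\<in>A. ip (f i) q)"
  unfolding ip_def poly_sum sum_distrib_right
  by (rule Bochner_Integration.integral_sum) (rule integrable_poly2)

lemma ip_sum_right: "ip p (sum f A) = (\<Sum>i\<in>A. ip p (f i))"
  by (simp add: ip_commute[of p] ip_sum_left)

lemma ip_Lop: "ip p (Lop q) = - (LINT t|mu. (1 - t\<^sup>2) * poly (pderiv p) t * poly (pderiv q) t)"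
  using integral_Lop[of "\<lambda>_. 1" "\<lambda>_. 0" "\<lambda>_. 0" p q] by (simp add: ip_def)

lemma ip_Lop_commute: "ip p (Lop q) = ip (Lop p) q"
  by (simp add: ip_Lop ip_commute[of "Lop p"] mult_ac)

lemma eig_inj: "eig i = eig j \<longleftrightarrow> i = j"
proof -
  have "eig i - eig j = (real i - real j) * (real i + real j + (\<alpha> + \<beta> + 1))"
    by (simp add: eig_def algebra_simps)
  moreover have "real i + real j + (\<alpha> + \<beta> + 1) \<noteq> 0" if "i \<noteq> j"
  proof -
    have "i + j \<ge> 1" using that by linarith
    then have "real i + real j \<ge> 1" by linarith
    then show ?thesis using alpha_ge beta_ge by linarith
  qed
  ultimately show ?thesis by (metis diff_self eq_iff_diff_eq_0 mult_eq_0_iff of_nat_eq_iff)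
qed

lemma ip_jpoly_orthogonal: "i \<noteq> j \<Longrightarrow> ip (jpoly i) (jpoly j) = 0"
  using ip_Lop_commute[of "jpoly i" "jpoly j"] eig_inj[of i j]
  by (simp add: Lop_jpoly ip_smult_left ip_smult_right del: smult_minus_left)

lemma ip_self_pos:
  assumes "p \<noteq> 0"
  shows "ip p p > 0"
proof -
  have "ip p p \<ge> 0" unfolding ip_def by (intro integral_nonneg_AE AE_I2) auto
  moreover have "ip p p \<noteq> 0"
  proof
    assume "ip p p = 0"
    then have "AE t in mu. poly p t * poly p t = 0"
      unfolding ip_def by (subst (asm) integral_nonneg_eq_0_iff_AE) (auto intro: integrable_poly2)
    moreover have "AE t in mu. poly p t \<noteq> 0"
    proof -
      have "AE t in restrict_space lborel {-1..1}. poly p t \<noteq> 0"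
      proof (subst AE_restrict_space_iff)
        have "AE t in lborel. t \<notin> {t. poly p t = 0}"
          using poly_roots_finite[OF assms] by (intro AE_not_in finite_imp_null_set_lborel)
        then show "AE t in lborel. t \<in> {-1..1} \<longrightarrow> poly p t \<noteq> 0" by auto
      qed auto
      then show ?thesis
        unfolding mu_def by (subst AE_density) (auto intro!: measurable_restrict_space1)
    qed
    ultimately have "AE t in mu. False" by eventually_elim auto
    then have "emeasure mu (space mu) = 0" by (auto simp: eventually_ae_filter null_sets_def dest: emeasure_mono[of "space mu" _ mu] simp del: space_mu)
    then show False using mass_pos by (simp add: mass_def measure_def)
  qed
  ultimately show ?thesis by linarith
qed

definition pn :: "nat \<Rightarrow> real poly" where
  "pn j = smult (1 / sqrt (ip (jpoly j) (jpoly j))) (jpoly j)"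

lemma poly_pn: "poly (pn j) x = jacobi_normalized \<alpha> \<beta> j x"
proof -
  have "ip (jpoly j) (jpoly j) = (LBINT t:{-1..1}. (jacobi \<alpha> \<beta> j t)\<^sup>2 * ((1 - t) powr \<alpha> * (1 + t) powr \<beta>))"
    unfolding ip_def
    by (subst integral_mu)
       (auto intro!: measurable_mu continuous_on_mult continuous_on_poly continuous_on_id simp: wt_def power2_eq_square simp flip: poly_jpoly)
  then show ?thesis
    by (simp add: pn_def jacobi_normalized_def jacobi_L2_norm_def poly_jpoly)
qed

lemma ip_pn: "ip (pn i) (pn j) = (if i = j then 1 else 0)"
  using ip_self_pos[OF jpoly_nz, of i] ip_jpoly_orthogonal[of i j]
  by (cases "i = j") (simp_all add: pn_def ip_smult_left ip_smult_right)

lemma degree_pn: "degree (pn j) \<le> j"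
  unfolding pn_def by (rule order.trans[OF degree_smult_le degree_jpoly])

lemma Lop_pn: "Lop (pn j) = smult (- eig j) (pn j)"
  by (simp add: pn_def Lop_smult Lop_jpoly)

lemma coeff_pn_pos: "coeff (pn j) j > 0"
  using coeff_jpoly_pos[of j] ip_self_pos[OF jpoly_nz, of j] by (simp add: pn_def)

lemma pn_span: "degree q \<le> N \<Longrightarrow> \<exists>c. q = (\<Sum>j\<le>N. smult (c j) (pn j))"
proof (induction N arbitrary: q)
  case 0
  obtain a b where "q = [:a:]" "pn 0 = [:b:]"
    using 0 degree_pn[of 0] by (metis degree_eq_zeroE le_zero_eq)
  then have "q = smult (coeff q 0 / coeff (pn 0) 0) (pn 0)"
    using coeff_pn_pos[of 0] by simp
  then show ?case by (intro exI[of _ "\<lambda>_. coeff q 0 / coeff (pn 0) 0"]) simp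
next
  case (Suc N)
  define a where "a = coeff q (Suc N) / coeff (pn (Suc N)) (Suc N)"
  have "degree (q - smult a (pn (Suc N))) \<le> N"
  proof (rule degree_le, intro allI impI)
    fix i assume "N < i"
    then consider "i = Suc N" | "i > Suc N" by linarith
    then show "coeff (q - smult a (pn (Suc N))) i = 0"
    proof cases
      case 1
      then show ?thesis using coeff_pn_pos[of "Suc N"] by (simp add: a_def)
    next
      case 2
      then show ?thesis using Suc.prems degree_pn[of "Suc N"] by (simp add: coeff_eq_0)
    qed
  qed
  from Suc.IH[OF this] obtain c where c: "q - smult a (pn (Suc N)) = (\<Sum>j\<le>N. smult (c j) (pn j))" by blast
  have "q = (\<Sum>j\<le>Suc N. smult ((c(Suc N := a)) j) (pn j))"
    using c by (simp add: algebra_simps)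
  then show ?case by blast
qed

lemma pn_expansion:
  assumes "degree q \<le> N"
  shows "q = (\<Sum>j\<le>N. smult (ip q (pn j)) (pn j))"
proof -
  obtain c where c: "q = (\<Sum>j\<le>N. smult (c j) (pn j))" using pn_span[OF assms] by blast
  have "ip q (pn j) = c j" if "j \<le> N" for j
    using that by (subst c) (simp add: ip_sum_left ip_smult_left ip_pn if_distrib sum.delta cong: if_cong)
  then show ?thesis by (subst c) (intro sum.cong; simp)
qed

definition ker :: "nat \<Rightarrow> real \<Rightarrow> real poly" where
  "ker N x = (\<Sum>j\<le>N. smult (poly (pn j) x) (pn j))"

lemma degree_ker: "degree (ker N x) \<le> N"
  unfolding ker_def
  by (intro degree_sum_le) (auto intro: order.trans[OF degree_smult_le] order.trans[OF degree_pn])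

lemma poly_ker: "poly (ker N x) y = (\<Sum>j\<le>N. poly (pn j) x * poly (pn j) y)"
  by (simp add: ker_def poly_sum)

lemma ip_ker: "degree q \<le> N \<Longrightarrow> ip (ker N x) q = poly q x"
proof -
  assume "degree q \<le> N"
  from pn_expansion[OF this] have "poly q x = (\<Sum>j\<le>N. ip q (pn j) * poly (pn j) x)"
    by (metis (no_types, lifting) poly_smult poly_sum sum.cong)
  then show ?thesis
    by (simp add: ker_def ip_sum_right ip_smult_right ip_commute[of _ q] mult.commute)
qed

lemma ker_diag_nonneg: "poly (ker N x) x \<ge> 0"
  unfolding poly_ker by (intro sum_nonneg) auto

lemma poly_square_le_ker:
  assumes "degree q \<le> N"
  shows "(poly q x)\<^sup>2 \<le> poly (ker N x) x * ip q q"
proof -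
  define c where "c j = ip q (pn j)" for j
  have q: "q = (\<Sum>j\<le>N. smult (c j) (pn j))" unfolding c_def by (rule pn_expansion[OF assms])
  have "ip q q = (\<Sum>j\<le>N. c j * ip q (pn j))"
    by (subst (2) q) (simp add: ip_sum_right ip_smult_right)
  then have "ip q q = (\<Sum>j\<le>N. (c j)\<^sup>2)" by (simp add: c_def power2_eq_square)
  moreover have "(poly q x)\<^sup>2 = (\<Sum>j\<le>N. poly (pn j) x * c j)\<^sup>2"
    by (subst q) (simp add: poly_sum mult.commute)
  moreover have "(\<Sum>j\<le>N. poly (pn j) x * c j)\<^sup>2 \<le> (\<Sum>j\<le>N. (poly (pn j) x)\<^sup>2) * (\<Sum>j\<le>N. (c j)\<^sup>2)"
    by (rule Cauchy_Schwarz_ineq_sum)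
  ultimately show ?thesis by (simp add: poly_ker power2_eq_square)
qed

end

interpretation cheb: jacobi_weight "- (1/2)" "- (1/2)"
  by unfold_locales auto

text \<open>The Sonin function \<open>(1 - x\<^sup>2) p'\<^sup>2 + j\<^sup>2 p\<^sup>2\<close> of a Chebyshev polynomial is constant;
  integrating it identifies the constant.\<close>

lemma cheb_pn_bound:
  assumes "x \<in> {-1..1}"
  shows "(poly (cheb.pn j) x)\<^sup>2 \<le> 2 / cheb.mass"
proof (cases "j = 0")
  case True
  have "degree (cheb.pn 0) = 0" using cheb.degree_pn[of 0] by simp
  then obtain c where c: "cheb.pn 0 = [:c:]" by (rule degree_eq_zeroE)
  have "cheb.ip (cheb.pn 0) (cheb.pn 0) = 1" by (simp add: cheb.ip_pn)
  then have "cheb.mass * (c * c) = 1" by (simp add: cheb.ip_def c cheb.mass_def mult_ac)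
  then show ?thesis using cheb.mass_pos True c by (simp add: field_simps power2_eq_square)
next
  case False
  define p where "p = cheb.pn j"
  define S where "S = [:1, 0, -1:] * (pderiv p)\<^sup>2 + smult ((real j)\<^sup>2) (p\<^sup>2)"
  have ode: "[:1, 0, -1:] * pderiv (pderiv p) + [:0, -1:] * pderiv p = smult (- ((real j)\<^sup>2)) p"
    using cheb.Lop_pn[of j] by (simp add: cheb.Lop_def cheb.eig_def p_def power2_eq_square)
  have "pderiv S = smult 2 (pderiv p * ([:1, 0, -1:] * pderiv (pderiv p) + [:0, -1:] * pderiv p + smult ((real j)\<^sup>2) p))"
    unfolding S_def
    by (rule poly_ext) (simp add: pderiv_add pderiv_minus pderiv_mult pderiv_smult power2_eq_square pderiv_pCons algebra_simps)
  also have "\<dots> = 0" unfolding ode by simp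
  finally have "degree S = 0" by (simp add: pderiv_eq_0_iff)
  then obtain c where c: "S = [:c:]" by (rule degree_eq_zeroE)
  have pS: "(1 - t\<^sup>2) * (poly (pderiv p) t)\<^sup>2 + (real j)\<^sup>2 * (poly p t)\<^sup>2 = c" for t
  proof -
    have "poly S t = c" by (simp add: c)
    then show ?thesis by (simp add: S_def algebra_simps power2_eq_square)
  qed
  have n1: "cheb.ip p p = 1" by (simp add: p_def cheb.ip_pn)
  have "cheb.ip p (cheb.Lop p) = - (real j)\<^sup>2"
    by (simp add: p_def cheb.Lop_pn cheb.ip_smult_right cheb.ip_pn cheb.eig_def power2_eq_square del: smult_minus_left)
  then have "(LINT t|cheb.mu. (1 - t\<^sup>2) * (poly (pderiv p) t)\<^sup>2) = (real j)\<^sup>2"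
    by (simp add: cheb.ip_Lop power2_eq_square mult.assoc)
  moreover have "(LINT t|cheb.mu. (real j)\<^sup>2 * (poly p t)\<^sup>2) = (real j)\<^sup>2"
    using n1 by (simp add: cheb.ip_def power2_eq_square)
  moreover have "(LINT t|cheb.mu. (1 - t\<^sup>2) * (poly (pderiv p) t)\<^sup>2 + (real j)\<^sup>2 * (poly p t)\<^sup>2) =
      (LINT t|cheb.mu. (1 - t\<^sup>2) * (poly (pderiv p) t)\<^sup>2) + (LINT t|cheb.mu. (real j)\<^sup>2 * (poly p t)\<^sup>2)"
    by (intro Bochner_Integration.integral_add cheb.integrable_mu continuous_intros)
  ultimately have "c * cheb.mass = 2 * (real j)\<^sup>2"
    using False by (simp add: pS cheb.mass_def mult.commute)
  then have c2: "c = 2 * (real j)\<^sup>2 / cheb.mass" using cheb.mass_pos by (simp add: field_simps)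
  have "1 - x\<^sup>2 \<ge> 0" using assms by (simp add: abs_square_le_1 abs_le_iff)
  then have "0 \<le> (1 - x\<^sup>2) * (poly (pderiv p) x)\<^sup>2" by simp
  then have "(real j)\<^sup>2 * (poly p x)\<^sup>2 \<le> c" using pS[of x] by linarith
  then have "(real j)\<^sup>2 * (poly p x)\<^sup>2 \<le> (real j)\<^sup>2 * (2 / cheb.mass)" by (simp add: c2 mult.commute)
  then have "(poly p x)\<^sup>2 \<le> 2 / cheb.mass"
    by (rule mult_left_le_imp_le) (use False in simp)
  then show ?thesis by (simp only: p_def)
qed

lemma cheb_poly_square_le:
  assumes "degree q \<le> N" "x \<in> {-1..1}"
  shows "(poly q x)\<^sup>2 \<le> 2 * (real N + 1) / cheb.mass * cheb.ip q q"
proof -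
  have "poly (cheb.ker N x) x = (\<Sum>j\<le>N. (poly (cheb.pn j) x)\<^sup>2)"
    by (simp add: cheb.poly_ker power2_eq_square)
  also have "\<dots> \<le> (\<Sum>j\<le>N. 2 / cheb.mass)" by (intro sum_mono cheb_pn_bound assms)
  also have "\<dots> = 2 * (real N + 1) / cheb.mass" by (simp add: algebra_simps)
  finally have "poly (cheb.ker N x) x \<le> 2 * (real N + 1) / cheb.mass" .
  moreover have "cheb.ip q q \<ge> 0" unfolding cheb.ip_def by (intro integral_nonneg_AE AE_I2) auto
  ultimately show ?thesis using cheb.poly_square_le_ker[OF assms(1), of x]
    by (meson mult_right_mono order.trans)
qed

section \<open>Localized polynomials and Christoffel functions\<close>

fun chebT :: "nat \<Rightarrow> real poly" where
  "chebT 0 = 1"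
| "chebT (Suc 0) = [:0, 1:]"
| "chebT (Suc (Suc n)) = [:0, 2:] * chebT (Suc n) - chebT n"

lemma poly_chebT: "poly (chebT n) (cos t) = cos (real n * t)"
proof (induction n rule: chebT.induct)
  case (3 n)
  have "cos (real (Suc (Suc n)) * t) + cos (real n * t) = 2 * cos t * cos (real (Suc n) * t)"
    using cos_times_cos[of t "real (Suc n) * t"] by (simp add: algebra_simps cos_add cos_diff)
  then show ?case using 3 by simp
qed auto

lemma degree_chebT: "degree (chebT n) \<le> n"
proof (induction n rule: chebT.induct)
  case (3 n)
  have "degree ([:0, 2:] * chebT (Suc n)) \<le> Suc (Suc n)"
    using 3 by (intro order.trans[OF degree_mult_le]) simp
  then show ?case using 3 by (auto intro: degree_diff_le)
qed auto

lemma sin_ge_two_div_pi: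
  assumes "0 \<le> y" "y \<le> pi / 2"
  shows "sin y \<ge> 2 * y / pi"
proof -
  have "convex_on {0..pi/2} (\<lambda>t. - sin t)"
    by (rule f''_ge0_imp_convex[where f' = "\<lambda>t. - cos t" and f'' = "\<lambda>t. sin t"])
       (auto intro!: derivative_eq_intros sin_ge_zero)
  from convex_onD_Icc'[OF this, of y] assms show ?thesis
    by (simp add: mult.commute)
qed

lemma dirichlet_kernel:
  "2 * sin (t / 2) * (1/2 + (\<Sum>j=1..N. cos (real j * t))) = sin ((real N + 1/2) * t)"
proof (induction N)
  case (Suc N)
  have "2 * sin (t / 2) * cos (real (Suc N) * t) = sin ((real (Suc N) + 1/2) * t) - sin ((real N + 1/2) * t)"
    using sin_times_cos[of "t / 2" "real (Suc N) * t"] sin_minus[of "(real N + 1/2) * t"]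
    by (simp add: algebra_simps add_divide_distrib)
  then show ?case using Suc by (simp add: algebra_simps)
qed simp

lemma sin_half_sum_ge:
  assumes "\<theta> \<in> {0..pi}" "\<phi> \<in> {0..pi}"
  shows "\<bar>sin ((\<theta> + \<phi>) / 2)\<bar> \<ge> \<bar>sin ((\<theta> - \<phi>) / 2)\<bar>"
proof -
  have "(sin ((\<theta> + \<phi>) / 2))\<^sup>2 - (sin ((\<theta> - \<phi>) / 2))\<^sup>2 = sin \<theta> * sin \<phi>"
  proof -
    have "cos (\<theta> + \<phi>) = 1 - 2 * (sin ((\<theta> + \<phi>) / 2))\<^sup>2" "cos (\<theta> - \<phi>) = 1 - 2 * (sin ((\<theta> - \<phi>) / 2))\<^sup>2"
      using cos_double_sin[of "(\<theta> + \<phi>) / 2"] cos_double_sin[of "(\<theta> - \<phi>) / 2"] by (simp_all only: mult_2 field_sum_of_halves)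
    then show ?thesis by (simp add: sin_times_sin)
  qed
  moreover have "sin \<theta> * sin \<phi> \<ge> 0" using assms by (auto intro!: mult_nonneg_nonneg sin_ge_zero)
  ultimately show ?thesis by (simp add: abs_le_square_iff)
qed

lemma cos_sum_bound:
  assumes "\<theta> \<in> {0..pi}" "\<phi> \<in> {0..pi}"
  shows "\<bar>1/2 + (\<Sum>j=1..N. cos (real j * \<theta>) * cos (real j * \<phi>))\<bar> * \<bar>\<theta> - \<phi>\<bar> \<le> pi / 2"
proof (cases "\<theta> = \<phi>")
  case False
  define D where "D t = 1/2 + (\<Sum>j=1..N. cos (real j * t))" for t
  define s where "s = \<bar>sin ((\<theta> - \<phi>) / 2)\<bar>"
  have r: "\<bar>\<theta> - \<phi>\<bar> \<le> pi" using assms by auto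
  have "s = sin (\<bar>\<theta> - \<phi>\<bar> / 2)"
  proof (cases "\<theta> \<ge> \<phi>")
    case True
    then show ?thesis using sin_ge_zero[of "(\<theta> - \<phi>) / 2"] r by (simp add: s_def)
  next
    case F: False
    have "sin ((\<theta> - \<phi>) / 2) = - sin ((\<phi> - \<theta>) / 2)"
      by (simp flip: sin_minus add: minus_divide_left)
    then show ?thesis using sin_ge_zero[of "(\<phi> - \<theta>) / 2"] r F by (simp add: s_def)
  qed
  then have s: "s \<ge> \<bar>\<theta> - \<phi>\<bar> / pi"
    using sin_ge_two_div_pi[of "\<bar>\<theta> - \<phi>\<bar> / 2"] r by simp
  moreover have "\<bar>\<theta> - \<phi>\<bar> / pi > 0" using False by simp
  ultimately have spos: "s > 0" by linarith
  have D: "\<bar>D t\<bar> * s \<le> 1/2" if "\<bar>sin (t / 2)\<bar> \<ge> s" for t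
  proof -
    have "2 * (\<bar>sin (t / 2)\<bar> * \<bar>D t\<bar>) \<le> 1"
      using abs_sin_le_one[of "(real N + 1/2) * t"] unfolding dirichlet_kernel[symmetric] D_def[symmetric]
      by (simp add: abs_mult)
    moreover have "s * \<bar>D t\<bar> \<le> \<bar>sin (t / 2)\<bar> * \<bar>D t\<bar>" by (intro mult_right_mono that) simp
    ultimately show ?thesis by (simp add: mult.commute)
  qed
  have eq: "1/2 + (\<Sum>j=1..N. cos (real j * \<theta>) * cos (real j * \<phi>)) = (D (\<theta> - \<phi>) + D (\<theta> + \<phi>)) / 2"
  proof -
    have "cos (real j * \<theta>) * cos (real j * \<phi>) = (cos (real j * (\<theta> - \<phi>)) + cos (real j * (\<theta> + \<phi>))) / 2" for j
      by (simp add: cos_times_cos right_diff_distrib distrib_left)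
    then show ?thesis by (simp add: D_def sum.distrib sum_divide_distrib[symmetric] add_divide_distrib)
  qed
  have "\<bar>1/2 + (\<Sum>j=1..N. cos (real j * \<theta>) * cos (real j * \<phi>))\<bar> * s \<le> (\<bar>D (\<theta> - \<phi>)\<bar> * s + \<bar>D (\<theta> + \<phi>)\<bar> * s) / 2"
    unfolding eq using mult_right_mono[OF abs_triangle_ineq[of "D (\<theta> - \<phi>)" "D (\<theta> + \<phi>)"], of s] spos by (simp add: algebra_simps)
  also have "\<dots> \<le> (1/2 + 1/2) / 2"
    using D[of "\<theta> - \<phi>"] D[of "\<theta> + \<phi>"] sin_half_sum_ge[OF assms] by (intro divide_right_mono add_mono) (auto simp: s_def)
  finally have 1: "\<bar>1/2 + (\<Sum>j=1..N. cos (real j * \<theta>) * cos (real j * \<phi>))\<bar> * s \<le> 1/2" by simp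
  have "\<bar>1/2 + (\<Sum>j=1..N. cos (real j * \<theta>) * cos (real j * \<phi>))\<bar> * \<bar>\<theta> - \<phi>\<bar> \<le>
      \<bar>1/2 + (\<Sum>j=1..N. cos (real j * \<theta>) * cos (real j * \<phi>))\<bar> * (pi * s)"
    using s by (intro mult_left_mono) (auto simp: field_simps)
  also have "\<dots> = pi * (\<bar>1/2 + (\<Sum>j=1..N. cos (real j * \<theta>) * cos (real j * \<phi>))\<bar> * s)"
    by (simp only: mult_ac)
  also have "\<dots> \<le> pi * (1/2)" by (intro mult_left_mono 1) simp
  finally show ?thesis by simp
qed simp

lemma cos_square_sum_ge: "(\<Sum>j=1..2*n. (cos (real j * t))\<^sup>2) \<ge> 7/32 * real n"
proof -
  have 7: "7/16 \<le> (cos y)\<^sup>2 + (cos (2 * y))\<^sup>2" for y :: real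
  proof -
    have "(cos y)\<^sup>2 + (cos (2 * y))\<^sup>2 - 7/16 = (2 * (cos y)\<^sup>2 - 3/4)\<^sup>2"
      unfolding cos_double_cos by (simp add: power2_eq_square algebra_simps)
    then show ?thesis using zero_le_power2[of "2 * (cos y)\<^sup>2 - 3/4"] by linarith
  qed
  let ?S = "\<Sum>j=1..2*n. (cos (real j * t))\<^sup>2"
  have "7/16 * real n = (\<Sum>j=1..n. 7/16)" by simp
  also have "\<dots> \<le> (\<Sum>j=1..n. (cos (real j * t))\<^sup>2 + (cos (2 * (real j * t)))\<^sup>2)"
    by (intro sum_mono 7)
  also have "\<dots> = (\<Sum>j=1..n. (cos (real j * t))\<^sup>2) + (\<Sum>j\<in>(\<lambda>j. 2 * j) ` {1..n}. (cos (real j * t))\<^sup>2)"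
    by (subst sum.reindex) (auto simp: inj_on_def sum.distrib mult.assoc)
  also have "\<dots> \<le> ?S + ?S" by (intro add_mono sum_mono2) auto
  finally show ?thesis by simp
qed

lemma arccos_dist_nonneg: "arccos_dist x y \<ge> 0"
  by (simp add: arccos_dist_def)

lemma arccos_dist_minus:
  "x \<in> {-1..1} \<Longrightarrow> y \<in> {-1..1} \<Longrightarrow> arccos_dist (- x) (- y) = arccos_dist x y"
  by (simp add: arccos_dist_def arccos_minus)

lemma localized_polynomial:
  assumes n: "n \<ge> 1" and x: "x \<in> {-1..1}"
  obtains T where "degree T \<le> 2 * n * m" "poly T x = 1"
    "\<And>v. v \<in> {-1..1} \<Longrightarrow> \<bar>poly T v\<bar> * (1 + real n * arccos_dist x v) ^ m \<le> 24 ^ m"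
proof -
  define \<theta> where "\<theta> = arccos x"
  define \<kappa> where "\<kappa> = [:1/2:] + (\<Sum>j=1..2*n. smult (cos (real j * \<theta>)) (chebT j))"
  define q where "q = smult (1 / poly \<kappa> x) \<kappa>"
  have poly_\<kappa>: "poly \<kappa> v = 1/2 + (\<Sum>j=1..2*n. cos (real j * \<theta>) * cos (real j * arccos v))" if "v \<in> {-1..1}" for v
    using poly_chebT[of _ "arccos v"] that by (simp add: \<kappa>_def poly_sum cos_arccos)
  have "degree (\<Sum>j=1..2*n. smult (cos (real j * \<theta>)) (chebT j)) \<le> 2 * n"
    by (intro degree_sum_le) (auto intro: order.trans[OF degree_smult_le] order.trans[OF degree_chebT])
  then have "degree \<kappa> \<le> 2 * n" unfolding \<kappa>_def by (intro degree_add_le) auto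
  then have degq: "degree q \<le> 2 * n" unfolding q_def by (rule order.trans[OF degree_smult_le])
  have lower: "poly \<kappa> x \<ge> 7/32 * real n"
    using cos_square_sum_ge[of n \<theta>] poly_\<kappa>[OF x] by (simp add: \<theta>_def power2_eq_square)
  moreover have "7/32 * real n > 0" using n by simp
  ultimately have \<kappa>pos: "poly \<kappa> x > 0" by linarith
  show thesis
  proof (rule that[of "q ^ m"])
    show "degree (q ^ m) \<le> 2 * n * m"
      using degq degree_power_le[of q m] by (meson mult_le_mono1 order.trans)
    show "poly (q ^ m) x = 1" using \<kappa>pos by (simp add: q_def poly_power)
    fix v :: real assume v: "v \<in> {-1..1}"
    have "\<bar>poly \<kappa> v\<bar> \<le> 1/2 + (\<Sum>j=1..2*n. 1)"
      unfolding poly_\<kappa>[OF v]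
      by (intro order.trans[OF abs_triangle_ineq] add_mono order.trans[OF sum_abs] sum_mono)
         (auto simp: abs_mult intro: mult_le_one)
    then have 1: "\<bar>poly \<kappa> v\<bar> \<le> 5/2 * real n" using n by simp
    have 2: "\<bar>poly \<kappa> v\<bar> * arccos_dist x v \<le> 2"
      using cos_sum_bound[of \<theta> "arccos v" "2*n"] v x pi_less_4 arccos_bounded[of x] arccos_bounded[of v]
      by (simp add: poly_\<kappa>[OF v] arccos_dist_def \<theta>_def)
    have "\<bar>poly \<kappa> v\<bar> * (1 + real n * arccos_dist x v) \<le> 5/2 * real n + real n * 2"
      using 1 mult_left_mono[OF 2, of "real n"] by (simp add: algebra_simps)
    also have "\<dots> \<le> 24 * poly \<kappa> x" using lower n by (simp add: field_simps)
    finally have "\<bar>poly q v\<bar> * (1 + real n * arccos_dist x v) \<le> 24"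
      using \<kappa>pos by (simp add: q_def abs_mult field_simps)
    then have "(\<bar>poly q v\<bar> * (1 + real n * arccos_dist x v)) ^ m \<le> 24 ^ m"
      by (intro power_mono) (auto simp: arccos_dist_nonneg)
    then show "\<bar>poly (q ^ m) v\<bar> * (1 + real n * arccos_dist x v) ^ m \<le> 24 ^ m"
      by (simp add: power_mult_distrib poly_power power_abs)
  qed
qed

lemma one_minus_le:
  assumes "x \<in> {-1..1}" "v \<in> {-1..1}" "n \<ge> 1"
  shows "1 - x + 1 / (real n)\<^sup>2 \<le> 2 * (1 + real n * arccos_dist x v)\<^sup>2 * (1 - v + 1 / (real n)\<^sup>2)"
proof -
  define r where "r = arccos_dist x v"
  define a where "a = sin (arccos x / 2)"
  define b where "b = sin (arccos v / 2)"
  have xa: "1 - x = 2 * a\<^sup>2" and vb: "1 - v = 2 * b\<^sup>2"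
    using cos_double_sin[of "arccos x / 2"] cos_double_sin[of "arccos v / 2"] assms
    by (simp_all add: a_def b_def cos_arccos)
  have "a - b = 2 * sin ((arccos x - arccos v) / 4) * cos ((arccos x / 2 + arccos v / 2) / 2)"
    unfolding a_def b_def sin_diff_sin by (simp add: diff_divide_distrib)
  then have "\<bar>a - b\<bar> \<le> 2 * \<bar>sin ((arccos x - arccos v) / 4)\<bar> * 1"
    by (simp add: abs_mult mult_left_le)
  also have "\<dots> \<le> 2 * \<bar>(arccos x - arccos v) / 4\<bar>" unfolding mult_1_right by (intro mult_left_mono abs_sin_x_le_abs_x) simp
  finally have "\<bar>a - b\<bar> \<le> r / 2" by (simp add: r_def arccos_dist_def)
  then have "(a - b)\<^sup>2 \<le> (r / 2)\<^sup>2" by (metis abs_ge_zero power2_abs power_mono)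
  moreover have "a\<^sup>2 \<le> 2 * b\<^sup>2 + 2 * (a - b)\<^sup>2"
  proof -
    have "2 * b\<^sup>2 + 2 * (a - b)\<^sup>2 - a\<^sup>2 = (a - 2 * b)\<^sup>2" by (simp add: power2_eq_square algebra_simps)
    then show ?thesis using zero_le_power2[of "a - 2 * b"] by linarith
  qed
  ultimately have 1: "1 - x \<le> 2 * (1 - v) + r\<^sup>2" unfolding xa vb by (simp add: power_divide)
  have r: "r \<ge> 0" by (simp add: r_def arccos_dist_nonneg)
  have n: "real n > 0" using assms by simp
  have "1 - x + 1 / (real n)\<^sup>2 \<le> 2 * (1 - v) + r\<^sup>2 + 1 / (real n)\<^sup>2" using 1 by simp
  also have "\<dots> \<le> 2 * (1 - v) + 2 * (1 + real n * r)\<^sup>2 * (1 / (real n)\<^sup>2)"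
    using n r by (simp add: field_simps power2_eq_square)
  also have "\<dots> \<le> 2 * (1 + real n * r)\<^sup>2 * (1 - v) + 2 * (1 + real n * r)\<^sup>2 * (1 / (real n)\<^sup>2)"
  proof -
    have "1 \<le> (1 + real n * r)\<^sup>2" using n r by (intro one_le_power) simp
    then show ?thesis using assms(2) mult_right_mono[of 1 "(1 + real n * r)\<^sup>2" "2 * (1 - v)"]
      by (simp add: algebra_simps)
  qed
  finally show ?thesis unfolding r_def by (simp add: algebra_simps)
qed

context jacobi_weight
begin

lemma jacobi_w_pos:
  assumes "n \<ge> 1" "x \<in> {-1..1}"
  shows "jacobi_w \<alpha> \<beta> n x > 0"
proof -
  have "1 / (real n)\<^sup>2 > 0" using assms(1) by simp
  then have "1 - x + 1 / (real n)\<^sup>2 > 0" "1 + x + 1 / (real n)\<^sup>2 > 0"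
    using assms(2) by (auto intro: add_nonneg_pos)
  then show ?thesis unfolding jacobi_w_def by simp
qed

lemma jacobi_w_le:
  assumes "x \<in> {-1..1}" "v \<in> {-1..1}" "n \<ge> 1"
  shows "jacobi_w \<alpha> \<beta> n x \<le> (2 * (1 + real n * arccos_dist x v)\<^sup>2) powr (\<alpha> + \<beta> + 1) * jacobi_w \<alpha> \<beta> n v"
proof -
  define Q where "Q = 2 * (1 + real n * arccos_dist x v)\<^sup>2"
  have ab: "\<alpha> + 1/2 \<ge> 0" "\<beta> + 1/2 \<ge> 0" using alpha_ge beta_ge by auto
  have Q: "Q \<ge> 0" by (simp add: Q_def)
  have nn: "1 - t + 1 / (real n)\<^sup>2 \<ge> 0" "1 + t + 1 / (real n)\<^sup>2 \<ge> 0" if "t \<in> {-1..1}" for t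
    using that by (auto intro!: add_nonneg_nonneg)
  have 1: "1 - x + 1 / (real n)\<^sup>2 \<le> Q * (1 - v + 1 / (real n)\<^sup>2)"
    using one_minus_le[OF assms] by (simp add: Q_def)
  have 2: "1 + x + 1 / (real n)\<^sup>2 \<le> Q * (1 + v + 1 / (real n)\<^sup>2)"
    using one_minus_le[of "-x" "-v" n] assms by (simp add: Q_def arccos_dist_minus)
  have "jacobi_w \<alpha> \<beta> n x \<le> (Q * (1 - v + 1 / (real n)\<^sup>2)) powr (\<alpha> + 1/2) * (Q * (1 + v + 1 / (real n)\<^sup>2)) powr (\<beta> + 1/2)"
    unfolding jacobi_w_def by (intro mult_mono powr_mono2 1 2 nn assms ab) auto
  also have "\<dots> = (Q powr (\<alpha> + 1/2) * Q powr (\<beta> + 1/2)) * jacobi_w \<alpha> \<beta> n v"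
    unfolding jacobi_w_def using Q nn[OF assms(2)] by (simp add: powr_mult)
  also have "Q powr (\<alpha> + 1/2) * Q powr (\<beta> + 1/2) = Q powr (\<alpha> + \<beta> + 1)"
    by (simp add: powr_add[symmetric] algebra_simps)
  finally show ?thesis unfolding Q_def .
qed

end

lemma cheb_measure_interval:
  assumes "0 \<le> a" "a \<le> 1"
  shows "measure cheb.mu {-a..a} = pi - 2 * arccos a"
proof -
  have sub: "{-a..a} \<subseteq> {-1..1}" using assms by auto
  have w: "cheb.wt t = inverse (sqrt (1 - t\<^sup>2))" if "t \<in> {-a<..<a}" for t
  proof -
    have t: "1 - t > 0" "1 + t > 0" using that assms by auto
    then have "cheb.wt t = inverse (sqrt (1 - t)) * inverse (sqrt (1 + t))"
      by (simp add: cheb.wt_def powr_minus powr_half_sqrt)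
    also have "\<dots> = inverse (sqrt (1 - t\<^sup>2))"
      by (simp add: real_sqrt_mult[symmetric] power2_eq_square algebra_simps flip: inverse_mult_distrib)
    finally show ?thesis .
  qed
  have meas: "indicator {-a..a} \<in> borel_measurable cheb.mu"
    by (intro borel_measurable_indicator) (use sub in \<open>auto simp: sets_restrict_space intro!: image_eqI[of _ _ "{-a..a}"]\<close>)
  have "measure cheb.mu {-a..a} = (LINT t|cheb.mu. indicator {-a..a} t)"
    using sub by (simp add: Int_absorb2 del: Int_atLeastAtMost)
  also have "\<dots> = (LBINT t:{-1..1}. indicator {-a..a} t * cheb.wt t)"
    by (rule cheb.integral_mu[OF meas])
  also have "\<dots> = (LBINT t:{-a..a}. cheb.wt t)"
    unfolding set_lebesgue_integral_def using sub
    by (intro Bochner_Integration.integral_cong) (auto split: split_indicator)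
  also have "\<dots> = integral {-a..a} cheb.wt"
    by (rule set_borel_integral_eq_integral(2)) (rule set_integrable_subset[OF cheb.wt_set_integrable _ sub], simp)
  also have "\<dots> = (- arccos a) - (- arccos (-a))"
  proof (intro integral_unique fundamental_theorem_of_calculus_interior)
    show "continuous_on {-a..a} (\<lambda>t. - arccos t)"
      using assms by (intro continuous_intros) auto
    fix t assume t: "t \<in> {-a<..<a}"
    then have "-1 < t" "t < 1" using assms by auto
    from DERIV_minus[OF DERIV_arccos[OF this]] show "((\<lambda>t. - arccos t) has_vector_derivative cheb.wt t) (at t)"
      using w[of t] t by (simp add: has_real_derivative_iff_has_vector_derivative)
  qed (use assms in auto)
  also have "\<dots> = pi - 2 * arccos a" using assms by (simp add: arccos_minus)
  finally show ?thesis .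
qed

lemma cheb_mass: "cheb.mass = pi"
  using cheb_measure_interval[of 1] by (simp add: cheb.mass_def)

context jacobi_weight
begin

lemma sets_mu_Icc:
  assumes "{a..b} \<subseteq> {-1..1}"
  shows "{a..b} \<in> sets mu"
  unfolding sets_mu sets_restrict_space
  by (rule image_eqI[of _ _ "{a..b}"]) (simp_all only: Int_absorb1[OF assms] atLeastAtMost_borel)

lemma integral_mu_cheb:
  fixes f :: "real \<Rightarrow> real"
  assumes f: "continuous_on {-1..1} f"
  shows "(LINT t|mu. f t) = (LINT t|cheb.mu. f t * ((1 - t) powr (\<alpha> + 1/2) * (1 + t) powr (\<beta> + 1/2)))"
proof -
  have m: "(\<lambda>t. (1 - t) powr (\<alpha> + 1/2) * (1 + t) powr (\<beta> + 1/2)) \<in> borel_measurable cheb.mu"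
    by (subst measurable_cong_sets[OF cheb.sets_mu refl]) (intro measurable_restrict_space1; measurable)
  have "(LINT t|mu. f t) = (LBINT t:{-1..1}. f t * wt t)"
    by (rule integral_mu[OF measurable_mu[OF f]])
  also have "\<dots> = (LBINT t:{-1..1}. f t * ((1 - t) powr (\<alpha> + 1/2) * (1 + t) powr (\<beta> + 1/2)) * cheb.wt t)"
  proof -
    have p: "u powr c = u powr (c + 1/2) * u powr (- (1/2))" for u c :: real
      by (simp flip: powr_add)
    have "wt t = ((1 - t) powr (\<alpha> + 1/2) * (1 + t) powr (\<beta> + 1/2)) * cheb.wt t" for t
      unfolding wt_def cheb.wt_def p[of _ \<alpha>] p[of _ \<beta>] by (simp only: mult_ac)
    then show ?thesis by (simp add: mult.assoc)
  qed
  also have "\<dots> = (LINT t|cheb.mu. f t * ((1 - t) powr (\<alpha> + 1/2) * (1 + t) powr (\<beta> + 1/2)))"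
    by (intro cheb.integral_mu[symmetric] borel_measurable_times m cheb.measurable_mu f)
  finally show ?thesis .
qed

lemma jacobi_w_interior_le:
  assumes "0 < \<delta>" "\<delta> \<le> pi" "n \<ge> 1" and t: "t \<in> {- cos (\<delta> / real n)..cos (\<delta> / real n)}"
  shows "jacobi_w \<alpha> \<beta> n t \<le> (1 + pi\<^sup>2 / (2 * \<delta>\<^sup>2)) powr (\<alpha> + \<beta> + 1)
     * ((1 - t) powr (\<alpha> + 1/2) * (1 + t) powr (\<beta> + 1/2))"
proof -
  define Q where "Q = 1 + pi\<^sup>2 / (2 * \<delta>\<^sup>2)"
  have Q: "Q > 0" unfolding Q_def by (intro add_pos_nonneg) auto
  have ab: "\<alpha> + 1/2 \<ge> 0" "\<beta> + 1/2 \<ge> 0" using alpha_ge beta_ge by auto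
  have n: "real n \<ge> 1" using assms by simp
  have d: "0 < \<delta> / real n" "\<delta> / real n \<le> pi"
    using assms n divide_left_mono[of 1 "real n" \<delta>] by auto
  have "sin (\<delta> / real n / 2) \<ge> 2 * (\<delta> / real n / 2) / pi" using d by (intro sin_ge_two_div_pi) auto
  then have "(sin (\<delta> / real n / 2))\<^sup>2 \<ge> (\<delta> / real n / pi)\<^sup>2" using d assms by (intro power_mono) auto
  moreover have "cos (\<delta> / real n) = 1 - 2 * (sin (\<delta> / real n / 2))\<^sup>2"
    using cos_double_sin[of "\<delta> / real n / 2"] by simp
  ultimately have c: "1 - cos (\<delta> / real n) \<ge> 2 * (\<delta> / real n / pi)\<^sup>2" by linarith
  have key: "1 / (real n)\<^sup>2 \<le> pi\<^sup>2 / (2 * \<delta>\<^sup>2) * u" if "u \<ge> 1 - cos (\<delta> / real n)" for u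
  proof -
    have "1 / (real n)\<^sup>2 = pi\<^sup>2 / (2 * \<delta>\<^sup>2) * (2 * (\<delta> / real n / pi)\<^sup>2)"
      using assms(1) n by (simp add: power_divide power_mult_distrib)
    also have "\<dots> \<le> pi\<^sup>2 / (2 * \<delta>\<^sup>2) * u" using c that by (intro mult_left_mono) auto
    finally show ?thesis .
  qed
  have 1: "1 - t + 1 / (real n)\<^sup>2 \<le> Q * (1 - t)" "1 + t + 1 / (real n)\<^sup>2 \<le> Q * (1 + t)"
    using key[of "1 - t"] key[of "1 + t"] t by (auto simp: Q_def algebra_simps)
  have nn: "1 - t \<ge> 0" "1 + t \<ge> 0"
    using t cos_le_one[of "\<delta> / real n"] unfolding atLeastAtMost_iff by linarith+
  have "jacobi_w \<alpha> \<beta> n t \<le> (Q * (1 - t)) powr (\<alpha> + 1/2) * (Q * (1 + t)) powr (\<beta> + 1/2)"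
    unfolding jacobi_w_def using nn by (intro mult_mono powr_mono2 1 ab) auto
  also have "\<dots> = (Q powr (\<alpha> + 1/2) * Q powr (\<beta> + 1/2)) * ((1 - t) powr (\<alpha> + 1/2) * (1 + t) powr (\<beta> + 1/2))"
    using Q nn by (simp add: powr_mult)
  also have "Q powr (\<alpha> + 1/2) * Q powr (\<beta> + 1/2) = Q powr (\<alpha> + \<beta> + 1)"
    by (simp add: powr_add[symmetric] algebra_simps)
  finally show ?thesis unfolding Q_def .
qed

end

text \<open>The end points have to be cut off because a general Jacobi weight may vanish there.\<close>

lemma cheb_ip_le_interior:
  assumes deg: "degree q + 1 \<le> b" "0 < \<delta>" "8 * real b * \<delta> \<le> pi"
  shows "cheb.ip q q \<le> 2 * (LINT t|cheb.mu. indicator {- cos \<delta>..cos \<delta>} t * (poly q t)\<^sup>2)"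
proof -
  define a where "a = cos \<delta>"
  define I where "I = cheb.ip q q"
  have b1: "real b \<ge> 1" using deg by simp
  have "8 * 1 * \<delta> \<le> 8 * real b * \<delta>" using b1 assms by (intro mult_right_mono mult_left_mono) auto
  then have d: "\<delta> \<le> pi / 2" using assms pi_gt_zero by linarith
  have a: "0 \<le> a" "a \<le> 1" unfolding a_def using d assms by (auto intro: cos_ge_zero)
  have sub: "{-a..a} \<subseteq> {-1..1}" using a by auto
  have sets: "{-a..a} \<in> sets cheb.mu"
    by (rule cheb.sets_mu_Icc[OF sub])
  have int: "integrable cheb.mu (\<lambda>t. (poly q t)\<^sup>2)" by (intro cheb.integrable_mu continuous_intros)
  have intR: "integrable cheb.mu (\<lambda>t. indicator {-a..a} t * (poly q t)\<^sup>2)"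
    using integrable_mult_indicator[OF sets int] by simp
  have intZ: "integrable cheb.mu (\<lambda>t. (1 - indicator {-a..a} t) * (poly q t)\<^sup>2)"
    using Bochner_Integration.integrable_diff[OF int intR] by (simp add: algebra_simps)
  have ind: "integrable cheb.mu (indicator {-a..a} :: real \<Rightarrow> real)" by (rule integrable_real_indicator[OF sets]) (simp add: less_top[symmetric] cheb.emeasure_finite)
  have I: "I = (LINT t|cheb.mu. (poly q t)\<^sup>2)" by (simp add: I_def cheb.ip_def power2_eq_square)
  have I0: "I \<ge> 0" unfolding I by simp
  have sup: "(poly q t)\<^sup>2 \<le> 2 * real b / pi * I" if "t \<in> {-1..1}" for t
  proof -
    have "(poly q t)\<^sup>2 \<le> 2 * (real (degree q) + 1) / pi * I"
      using cheb_poly_square_le[OF order.refl that, of q] by (simp add: cheb_mass I_def)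
    also have "\<dots> \<le> 2 * real b / pi * I"
      using deg by (intro mult_right_mono divide_right_mono I0) auto
    finally show ?thesis .
  qed
  have "I = (LINT t|cheb.mu. indicator {-a..a} t * (poly q t)\<^sup>2) + (LINT t|cheb.mu. (1 - indicator {-a..a} t) * (poly q t)\<^sup>2)"
    unfolding I by (subst Bochner_Integration.integral_add[symmetric, OF intR intZ]) (simp add: algebra_simps)
  also have "(LINT t|cheb.mu. (1 - indicator {-a..a} t) * (poly q t)\<^sup>2) \<le>
      (LINT t|cheb.mu. (1 - indicator {-a..a} t) * (2 * real b / pi * I))"
    by (intro integral_mono intZ integrable_mult_left Bochner_Integration.integrable_diff cheb.integrable_const ind mult_left_mono sup)
       (auto split: split_indicator)
  also have "\<dots> = (LINT t|cheb.mu. 1 - indicator {-a..a} t) * (2 * real b / pi * I)" by simp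
  also have "(LINT t|cheb.mu. 1 - indicator {-a..a} t) = (LINT t|cheb.mu. 1) - (LINT t|cheb.mu. (indicator {-a..a} t :: real))"
    by (rule Bochner_Integration.integral_diff[OF cheb.integrable_const ind])
  also have "\<dots> = pi - measure cheb.mu {-a..a}"
    using cheb.integral_const_mu[of 1] sub by (simp add: cheb_mass Int_absorb2 del: Int_atLeastAtMost)
  also have "\<dots> = 2 * \<delta>"
    using cheb_measure_interval[OF a] d assms by (simp add: a_def arccos_cos)
  also have "2 * \<delta> * (2 * real b / pi * I) \<le> 1/2 * I"
  proof -
    have "4 * real b * \<delta> / pi \<le> (pi / 2) / pi" using assms by (intro divide_right_mono) auto
    then have "2 * \<delta> * (2 * real b / pi) \<le> 1/2" by (simp add: mult_ac)
    from mult_right_mono[OF this I0] show ?thesis by (simp add: mult.assoc)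
  qed
  finally show ?thesis unfolding a_def I_def by simp
qed

context jacobi_weight
begin

lemma poly_square_le_christoffel:
  "\<exists>C>0. \<forall>n\<ge>1. \<forall>x\<in>{-1..1}. \<forall>g. degree g \<le> c * n \<longrightarrow>
     (poly g x)\<^sup>2 \<le> C * real n / jacobi_w \<alpha> \<beta> n x * ip g g"
proof -
  define \<gamma> where "\<gamma> = \<alpha> + \<beta> + 1"
  define m where "m = nat \<lceil>\<gamma>\<rceil>"
  define d where "d = c + 2 * m + 1"
  define \<delta> where "\<delta> = pi / (8 * real d)"
  define Q where "Q = (1 + pi\<^sup>2 / (2 * \<delta>\<^sup>2)) powr \<gamma>"
  define C where "C = 4 * real d / pi * (2 powr \<gamma> * (24 ^ m)\<^sup>2 * Q)"
  have \<gamma>0: "\<gamma> \<ge> 0" using alpha_ge beta_ge by (simp add: \<gamma>_def)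
  have \<gamma>m: "\<gamma> \<le> real m" unfolding m_def by linarith
  have d1: "real d \<ge> 1" by (simp add: d_def)
  have \<delta>: "0 < \<delta>" "\<delta> \<le> pi" using d1 by (simp_all add: \<delta>_def field_simps)
  have "1 + pi\<^sup>2 / (2 * \<delta>\<^sup>2) > 0" by (intro add_pos_nonneg) auto
  then have Q0: "Q > 0" unfolding Q_def by simp
  have C0: "C > 0" unfolding C_def using d1 Q0 by simp
  have "(poly g x)\<^sup>2 \<le> C * real n / jacobi_w \<alpha> \<beta> n x * ip g g"
    if n: "n \<ge> 1" and x: "x \<in> {-1..1}" and g: "degree g \<le> c * n" for n x g
  proof -
    obtain T where T: "degree T \<le> 2 * n * m" "poly T x = 1"
      "\<And>v. v \<in> {-1..1} \<Longrightarrow> \<bar>poly T v\<bar> * (1 + real n * arccos_dist x v) ^ m \<le> 24 ^ m"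
      using localized_polynomial[OF n x, of m] by blast
    define h where "h = g * T"
    define W where "W = jacobi_w \<alpha> \<beta> n x"
    define v where "v t = (1 - t) powr (\<alpha> + 1/2) * (1 + t) powr (\<beta> + 1/2)" for t
    have n1: "real n \<ge> 1" using n by simp
    have W: "W > 0" unfolding W_def by (rule jacobi_w_pos[OF n x])
    have vnn: "v t \<ge> 0" for t by (simp add: v_def)
    have "degree h \<le> c * n + 2 * n * m" unfolding h_def
      using degree_mult_le[of g T] g T(1) by linarith
    then have degh: "degree h + 1 \<le> d * n" using n by (simp add: d_def algebra_simps)
    define R where "R = {- cos (\<delta> / real n)..cos (\<delta> / real n)}"
    have subR: "R \<subseteq> {-1..1}"
      using cos_le_one[of "\<delta> / real n"] unfolding R_def atLeastatMost_subset_iff by linarith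
    have setsR: "R \<in> sets cheb.mu"
      using subR unfolding R_def by (rule cheb.sets_mu_Icc)
    have "(poly g x)\<^sup>2 = (poly h x)\<^sup>2" by (simp add: h_def T)
    also have "\<dots> \<le> 2 * (real (degree h) + 1) / pi * cheb.ip h h"
      using cheb_poly_square_le[OF order.refl x, of h] by (simp add: cheb_mass)
    also have "\<dots> \<le> 2 * (real d * real n) / pi * cheb.ip h h"
    proof -
      have "real (degree h + 1) \<le> real (d * n)" using degh by (rule of_nat_mono)
      moreover have "cheb.ip h h \<ge> 0" unfolding cheb.ip_def by (intro integral_nonneg_AE AE_I2) auto
      ultimately show ?thesis by (intro mult_right_mono divide_right_mono) auto
    qed
    also have "\<dots> \<le> 2 * (real d * real n) / pi * (2 * (LINT t|cheb.mu. indicator R t * (poly h t)\<^sup>2))"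
      unfolding R_def
    proof (intro mult_left_mono cheb_ip_le_interior[OF degh])
      show "8 * real (d * n) * (\<delta> / real n) \<le> pi" using n1 d1 by (simp add: \<delta>_def)
    qed (use \<delta> n1 in auto)
    also have "(LINT t|cheb.mu. indicator R t * (poly h t)\<^sup>2) \<le>
       (LINT t|cheb.mu. (2 powr \<gamma> * (24 ^ m)\<^sup>2 * Q / W) * ((poly g t)\<^sup>2 * v t))"
    proof (rule integral_mono)
      show "integrable cheb.mu (\<lambda>t. indicator R t * (poly h t)\<^sup>2)"
        using integrable_mult_indicator[OF setsR, of "\<lambda>t. (poly h t)\<^sup>2"]
        by (simp add: cheb.integrable_mu continuous_intros)
      have vm: "v \<in> borel_measurable cheb.mu"
        unfolding v_def by (subst measurable_cong_sets[OF cheb.sets_mu refl]) (intro measurable_restrict_space1; measurable)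
      have meas: "(\<lambda>t. (poly g t)\<^sup>2 * v t) \<in> borel_measurable cheb.mu"
        by (intro borel_measurable_times[OF cheb.measurable_mu vm] continuous_intros)
      have vle: "\<bar>v t\<bar> \<le> 2 powr (\<alpha> + 1/2) * 2 powr (\<beta> + 1/2)" if "t \<in> {-1..1}" for t
        unfolding v_def abs_mult using that alpha_ge beta_ge by (intro mult_mono) (auto intro!: powr_mono2)
      have "bounded ((\<lambda>t. (poly g t)\<^sup>2) ` {-1..1})"
        by (intro compact_imp_bounded compact_continuous_image continuous_intros) simp
      then obtain b where b: "\<forall>y\<in>(\<lambda>t. (poly g t)\<^sup>2) ` {-1..1}. norm y \<le> b" unfolding bounded_iff by blast
      have "norm ((poly g t)\<^sup>2 * v t) \<le> b * (2 powr (\<alpha> + 1/2) * 2 powr (\<beta> + 1/2))" if t: "t \<in> space cheb.mu" for t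
      proof -
        have t': "t \<in> {-1..1}" using t by simp
        have "\<bar>(poly g t)\<^sup>2\<bar> \<le> b" using b t' by force
        then show ?thesis unfolding real_norm_def abs_mult[of "(poly g t)\<^sup>2"]
          by (intro mult_mono vle[OF t']) linarith+
      qed
      with meas have "integrable cheb.mu (\<lambda>t. (poly g t)\<^sup>2 * v t)"
        by (intro cheb.integrable_const_bound AE_I2)
      then show "integrable cheb.mu (\<lambda>t. (2 powr \<gamma> * (24 ^ m)\<^sup>2 * Q / W) * ((poly g t)\<^sup>2 * v t))"
        by (rule integrable_mult_right)
      fix t assume "t \<in> space cheb.mu"
      then have t: "t \<in> {-1..1}" by simp
      show "indicator R t * (poly h t)\<^sup>2 \<le> (2 powr \<gamma> * (24 ^ m)\<^sup>2 * Q / W) * ((poly g t)\<^sup>2 * v t)"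
      proof (cases "t \<in> R")
        case True
        define r where "r = 1 + real n * arccos_dist x t"
        have r1: "r \<ge> 1" by (simp add: r_def arccos_dist_nonneg)
        have "W \<le> (2 * r\<^sup>2) powr \<gamma> * jacobi_w \<alpha> \<beta> n t"
          using jacobi_w_le[OF x t n] by (simp add: W_def r_def \<gamma>_def)
        also have "(2 * r\<^sup>2) powr \<gamma> = 2 powr \<gamma> * (r\<^sup>2) powr \<gamma>" by (simp add: powr_mult)
        also have "(r\<^sup>2) powr \<gamma> \<le> (r\<^sup>2) powr real m" using r1 \<gamma>m by (intro powr_mono) auto
        also have "(r\<^sup>2) powr real m = (r ^ m)\<^sup>2" using r1 by (simp add: powr_realpow power_mult[symmetric] mult.commute)
        also have "jacobi_w \<alpha> \<beta> n t \<le> Q * v t"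
          using jacobi_w_interior_le[OF \<delta> n, of t] True by (simp add: R_def Q_def v_def \<gamma>_def)
        finally have "W \<le> 2 powr \<gamma> * (r ^ m)\<^sup>2 * (Q * v t)"
          using jacobi_w_pos[OF n t] by (simp add: mult_left_mono mult_right_mono order_less_imp_le)
        then have "W * (poly T t)\<^sup>2 \<le> 2 powr \<gamma> * (r ^ m)\<^sup>2 * (Q * v t) * (poly T t)\<^sup>2" by (intro mult_right_mono) auto
        also have "\<dots> = 2 powr \<gamma> * (Q * v t) * (\<bar>poly T t\<bar> * r ^ m)\<^sup>2" by (simp add: power_mult_distrib)
        also have "\<dots> \<le> 2 powr \<gamma> * (Q * v t) * (24 ^ m)\<^sup>2"
          using T(3)[OF t] r1 Q0 vnn by (intro mult_left_mono power_mono) (auto simp: r_def)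
        finally have "W * (poly T t)\<^sup>2 * (poly g t)\<^sup>2 \<le> 2 powr \<gamma> * (Q * v t) * (24 ^ m)\<^sup>2 * (poly g t)\<^sup>2"
          by (intro mult_right_mono) auto
        then show ?thesis using True W by (simp add: h_def field_simps power_mult_distrib)
      qed (use vnn Q0 W in simp)
    qed
    also have "\<dots> = (2 powr \<gamma> * (24 ^ m)\<^sup>2 * Q / W) * ip g g"
      unfolding ip_def v_def
      by (subst integral_mu_cheb) (auto simp: power2_eq_square intro!: continuous_intros)
    finally show ?thesis using d1 n1 by (simp add: C_def W_def field_simps)
  qed
  then show ?thesis using C0 by blast
qed

lemma ker_diag_le:
  "\<exists>C>0. \<forall>n\<ge>1. \<forall>x\<in>{-1..1}. \<forall>N\<le>c * n. poly (ker N x) x \<le> C * real n / jacobi_w \<alpha> \<beta> n x"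
proof -
  obtain C where C: "C > 0" "\<And>n x g. n \<ge> 1 \<Longrightarrow> x \<in> {-1..1} \<Longrightarrow> degree g \<le> c * n \<Longrightarrow>
     (poly g x)\<^sup>2 \<le> C * real n / jacobi_w \<alpha> \<beta> n x * ip g g"
    using poly_square_le_christoffel[of c] by blast
  have "poly (ker N x) x \<le> C * real n / jacobi_w \<alpha> \<beta> n x"
    if "n \<ge> 1" "x \<in> {-1..1}" "N \<le> c * n" for n x N
  proof -
    define B where "B = C * real n / jacobi_w \<alpha> \<beta> n x"
    define k where "k = poly (ker N x) x"
    have "k\<^sup>2 \<le> B * k"
      using C(2)[OF that(1,2), of "ker N x"] degree_ker[of N x] that(3) ip_ker[OF degree_ker, of N x x]
      by (simp add: B_def k_def)
    moreover have "B \<ge> 0" unfolding B_def using C(1) jacobi_w_pos[OF that(1,2)] by simp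
    moreover have "k \<ge> 0" unfolding k_def by (rule ker_diag_nonneg)
    ultimately have "k \<le> B" by (cases "k = 0") (auto simp: power2_eq_square)
    then show ?thesis by (simp add: B_def k_def)
  qed
  then show ?thesis using C(1) by blast
qed

end

section \<open>The wave equation\<close>

context jacobi_weight
begin

lemma has_real_derivative_integral_mu:
  fixes h h' :: "real \<Rightarrow> real \<Rightarrow> real"
  assumes h: "\<And>s. continuous_on {-1..1} (h s)"
    and der: "\<And>s t. t \<in> {-1..1} \<Longrightarrow> ((\<lambda>s. h s t) has_real_derivative h' s t) (at s)"
    and h': "continuous_on (UNIV \<times> {-1..1}) (\<lambda>(s, t). h' s t)"
  shows "((\<lambda>s. LINT t|mu. h s t) has_real_derivative (LINT t|mu. h' s t)) (at s)"
proof -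
  have h's: "continuous_on {-1..1} (h' s)" for s
  proof -
    have "continuous_on {-1..1} ((\<lambda>(s, t). h' s t) \<circ> (\<lambda>t. (s, t)))"
      by (intro continuous_on_compose continuous_intros continuous_on_subset[OF h']) auto
    then show ?thesis by (simp add: o_def)
  qed
  have "bounded ((\<lambda>(s, t). h' s t) ` ({s-1..s+1} \<times> {-1..1}))"
    by (intro compact_imp_bounded compact_continuous_image compact_Times continuous_on_subset[OF h']) auto
  then obtain B where B: "\<And>r t. r \<in> {s-1..s+1} \<Longrightarrow> t \<in> {-1..1} \<Longrightarrow> \<bar>h' r t\<bar> \<le> B"
    unfolding bounded_iff by fastforce
  show ?thesis
    unfolding has_field_derivative_iff tendsto_at_iff_sequentially
  proof (intro allI impI)
    fix X :: "nat \<Rightarrow> real"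
    assume X: "\<forall>i. X i \<in> UNIV - {s}" "X \<longlonglongrightarrow> s"
    obtain N where N: "\<And>i. i \<ge> N \<Longrightarrow> \<bar>X i - s\<bar> < 1"
      using X(2)[THEN LIMSEQ_D, of 1] by auto
    define q where "q i t = (h (X (i + N)) t - h s t) / (X (i + N) - s)" for i t
    have XN: "(\<lambda>i. X (i + N)) \<longlonglongrightarrow> s" by (rule LIMSEQ_ignore_initial_segment[OF X(2)])
    have Xne: "X i - s \<noteq> 0" for i using X(1) by auto
    have contq: "continuous_on {-1..1} (q i)" for i
      unfolding q_def using Xne[of "i + N"] by (intro continuous_intros h) simp
    have lim: "(\<lambda>i. LINT t|mu. q i t) \<longlonglongrightarrow> (LINT t|mu. h' s t)"
    proof (rule integral_dominated_convergence[where w = "\<lambda>_. B"])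
      show "AE t in mu. (\<lambda>i. q i t) \<longlonglongrightarrow> h' s t"
      proof (rule AE_I2)
        fix t assume "t \<in> space mu"
        then have t: "t \<in> {-1..1}" by simp
        have "((\<lambda>y. (h y t - h s t) / (y - s)) \<longlongrightarrow> h' s t) (at s)"
          using der[OF t, of s] by (simp add: has_field_derivative_iff)
        then have "((\<lambda>y. (h y t - h s t) / (y - s)) \<circ> (\<lambda>i. X (i + N))) \<longlonglongrightarrow> h' s t"
          using X(1) XN by (subst (asm) tendsto_at_iff_sequentially) (drule spec[of _ "\<lambda>i. X (i + N)"], auto)
        then show "(\<lambda>i. q i t) \<longlonglongrightarrow> h' s t" by (simp add: o_def q_def)
      qed
      show "AE t in mu. norm (q i t) \<le> B" for i
      proof (rule AE_I2)
        fix t assume "t \<in> space mu"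
        then have t: "t \<in> {-1..1}" by simp
        have "\<exists>z\<in>{s-1..s+1}. h (X (i + N)) t - h s t = (X (i + N) - s) * h' z t"
        proof (cases "X (i + N) < s")
          case True
          from MVT2[OF this, of "\<lambda>s. h s t" "\<lambda>s. h' s t"] der[OF t] obtain z
            where z: "X (i + N) < z" "z < s" "h s t - h (X (i + N)) t = (s - X (i + N)) * h' z t" by blast
          then show ?thesis using N[of "i + N"] by (intro bexI[of _ z]) (auto simp: algebra_simps)
        next
          case False
          then have "s < X (i + N)" using Xne[of "i + N"] by simp
          from MVT2[OF this, of "\<lambda>s. h s t" "\<lambda>s. h' s t"] der[OF t] obtain z
            where z: "s < z" "z < X (i + N)" "h (X (i + N)) t - h s t = (X (i + N) - s) * h' z t" by blast
          then show ?thesis using N[of "i + N"] by (intro bexI[of _ z]) auto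
        qed
        then show "norm (q i t) \<le> B" using B[OF _ t] Xne[of "i + N"] by (auto simp: q_def abs_mult)
      qed
    qed (auto intro!: measurable_mu h's contq)
    have "(\<lambda>i. (LINT t|mu. q i t)) = (\<lambda>i. ((LINT t|mu. h (X (i + N)) t) - (LINT t|mu. h s t)) / (X (i + N) - s))"
      unfolding q_def by (simp add: Bochner_Integration.integral_diff integrable_mu h)
    with lim have "(\<lambda>i. ((\<lambda>y. ((LINT t|mu. h y t) - (LINT t|mu. h s t)) / (y - s)) \<circ> X) (i + N)) \<longlonglongrightarrow> (LINT t|mu. h' s t)"
      by (simp add: o_def)
    then show "((\<lambda>y. ((LINT t|mu. h y t) - (LINT t|mu. h s t)) / (y - s)) \<circ> X) \<longlonglongrightarrow> (LINT t|mu. h' s t)"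
      by (rule LIMSEQ_offset)
  qed
qed

definition lam :: real where "lam = (\<alpha> + \<beta> + 1) / 2"

lemma lam_nonneg: "lam \<ge> 0" using alpha_ge beta_ge by (simp add: lam_def)

definition freq :: "nat \<Rightarrow> real" where "freq j = real j + lam"

lemma freq_square: "(freq j)\<^sup>2 = eig j + lam\<^sup>2"
  by (simp add: freq_def eig_def lam_def power2_eq_square field_simps)

definition sinc_freq :: "nat \<Rightarrow> real \<Rightarrow> real" where
  "sinc_freq j s = (if freq j = 0 then s else sin (freq j * s) / freq j)"

lemma sinc_freq_0 [simp]: "sinc_freq j 0 = 0"
  by (simp add: sinc_freq_def)

lemma sinc_freq_deriv: "(sinc_freq j has_real_derivative cos (freq j * s)) (at s)"
  unfolding sinc_freq_def by (cases "freq j = 0") (auto intro!: derivative_eq_intros)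

lemma sinc_freq_deriv': "((\<lambda>s. cos (freq j * s)) has_real_derivative - (freq j)\<^sup>2 * sinc_freq j s) (at s)"
  unfolding sinc_freq_def by (cases "freq j = 0") (auto intro!: derivative_eq_intros simp: power2_eq_square)

lemma continuous_on_sinc_freq [continuous_intros]:
  fixes f :: "'a :: t2_space \<Rightarrow> real"
  shows "continuous_on A f \<Longrightarrow> continuous_on A (\<lambda>z. sinc_freq j (f z))"
  unfolding sinc_freq_def
  by (cases "freq j = 0") (auto intro!: continuous_on_divide continuous_on_sin continuous_on_mult_left)

text \<open>\<open>wave_cos\<close> solves the wave equation \<open>u\<^sub>s\<^sub>s = Lop u - lam\<^sup>2 u\<close>; its primitive \<open>wave_sin\<close> vanishes at
  time 0, so that the initial energy of \<open>wave_sin\<close> is the square of the \<open>L\<^sup>2\<close> norm of the data.\<close>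

definition wave_cos :: "nat \<Rightarrow> (nat \<Rightarrow> real) \<Rightarrow> real \<Rightarrow> real poly" where
  "wave_cos D c s = (\<Sum>j\<le>D. smult (c j * cos (freq j * s)) (pn j))"

definition wave_sin :: "nat \<Rightarrow> (nat \<Rightarrow> real) \<Rightarrow> real \<Rightarrow> real poly" where
  "wave_sin D c s = (\<Sum>j\<le>D. smult (c j * sinc_freq j s) (pn j))"

lemma poly_wave_sin: "poly (wave_sin D c s) t = (\<Sum>j\<le>D. c j * sinc_freq j s * poly (pn j) t)"
  by (simp add: wave_sin_def poly_sum)

lemma poly_wave_cos: "poly (wave_cos D c s) t = (\<Sum>j\<le>D. c j * cos (freq j * s) * poly (pn j) t)"
  by (simp add: wave_cos_def poly_sum)

lemma poly_pderiv_wave_sin: "poly (pderiv (wave_sin D c s)) t = (\<Sum>j\<le>D. c j * sinc_freq j s * poly (pderiv (pn j)) t)"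
  by (simp add: wave_sin_def poly_sum pderiv_sum pderiv_smult)

lemma poly_pderiv_wave_cos: "poly (pderiv (wave_cos D c s)) t = (\<Sum>j\<le>D. c j * cos (freq j * s) * poly (pderiv (pn j)) t)"
  by (simp add: wave_cos_def poly_sum pderiv_sum pderiv_smult)

lemma poly_Lop_wave_sin: "poly (Lop (wave_sin D c s)) t = (\<Sum>j\<le>D. c j * (- eig j * sinc_freq j s) * poly (pn j) t)"
  unfolding wave_sin_def Lop_sum Lop_smult Lop_pn by (simp add: poly_sum mult_ac sum_negf)

lemmas poly_wave = poly_wave_sin poly_wave_cos poly_pderiv_wave_sin poly_pderiv_wave_cos poly_Lop_wave_sin

lemma wave_sin_deriv: "((\<lambda>s. poly (wave_sin D c s) t) has_real_derivative poly (wave_cos D c s) t) (at s)"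
  unfolding poly_wave by (intro DERIV_sum) (auto intro!: derivative_eq_intros sinc_freq_deriv)

lemma pderiv_wave_sin_deriv:
  "((\<lambda>s. poly (pderiv (wave_sin D c s)) t) has_real_derivative poly (pderiv (wave_cos D c s)) t) (at s)"
  unfolding poly_wave by (intro DERIV_sum) (auto intro!: derivative_eq_intros sinc_freq_deriv)

lemma wave_cos_deriv:
  "((\<lambda>s. poly (wave_cos D c s) t) has_real_derivative
     poly (Lop (wave_sin D c s)) t - lam\<^sup>2 * poly (wave_sin D c s) t) (at s)"
proof -
  have "((\<lambda>s. poly (wave_cos D c s) t) has_real_derivative
     (\<Sum>j\<le>D. c j * (- (freq j)\<^sup>2 * sinc_freq j s) * poly (pn j) t)) (at s)"
    unfolding poly_wave by (intro DERIV_sum DERIV_cmult_right DERIV_cmult sinc_freq_deriv')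
  also have "(\<Sum>j\<le>D. c j * (- (freq j)\<^sup>2 * sinc_freq j s) * poly (pn j) t) =
     poly (Lop (wave_sin D c s)) t - lam\<^sup>2 * poly (wave_sin D c s) t"
    unfolding poly_wave freq_square sum_distrib_left sum_subtractf[symmetric]
    by (intro sum.cong refl) (simp add: algebra_simps)
  finally show ?thesis .
qed

lemma wave_sin_0: "wave_sin D c 0 = 0"
  by (simp add: wave_sin_def)

text \<open>The weighted energy estimate: since waves travel with unit speed in the variable \<open>arccos t\<close>,
  the weight \<open>(A\<^sup>2 + R\<^sup>2) ^ m\<close> with \<open>A = 1 + n s\<close> makes the energy grow at most polynomially.
  The factor \<open>5/4\<close> comes from \<open>A (A + R) \<le> 5/4 (A\<^sup>2 + R\<^sup>2)\<close>; the cruder \<open>3/2\<close> would not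
  suffice for cutoffs of order 2.\<close>

lemma wave_energy_estimate:
  fixes n \<theta> :: real
  assumes n: "n > 0" and s: "s \<ge> 0"
  defines "R \<equiv> \<lambda>t. n * (arccos t - \<theta>)"
  shows "(LINT t|mu. (1 + (R t)\<^sup>2) ^ m * (poly (wave_cos D c s) t)\<^sup>2) \<le>
     (1 + n * s) powr (5/2 * real m) * (LINT t|mu. (1 + (R t)\<^sup>2) ^ m * (poly (wave_cos D c 0) t)\<^sup>2)"
proof -
  define Y where "Y s t = (1 + n * s)\<^sup>2 + (R t)\<^sup>2" for s t
  define U where "U = wave_sin D c"
  define Z where "Z = wave_cos D c"
  define e where "e s t = (poly (Z s) t)\<^sup>2 + (1 - t\<^sup>2) * (poly (pderiv (U s)) t)\<^sup>2 + lam\<^sup>2 * (poly (U s) t)\<^sup>2" for s t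
  define E where "E s = (LINT t|mu. Y s t ^ m * e s t)" for s
  define Ys where "Ys s t = real m * Y s t ^ (m - 1) * (2 * n * (1 + n * s))" for s t
  define h' where "h' s t = Ys s t * e s t + Y s t ^ m * (2 * poly (Z s) t * (poly (Lop (U s)) t - lam\<^sup>2 * poly (U s) t)
     + (1 - t\<^sup>2) * (2 * poly (pderiv (U s)) t * poly (pderiv (Z s)) t) + lam\<^sup>2 * (2 * poly (U s) t * poly (Z s) t))" for s t
  note UZ = U_def Z_def
  have contR: "continuous_on {-1..1} R" unfolding R_def by (intro continuous_intros) auto
  have contR2: "continuous_on (UNIV \<times> {-1..1}) (\<lambda>z. R (snd z))"
    unfolding R_def by (intro continuous_intros) auto
  have contY: "continuous_on {-1..1} (Y s)" for s unfolding Y_def by (intro continuous_intros contR)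
  have conte: "continuous_on {-1..1} (e s)" for s unfolding e_def by (intro continuous_intros)
  have E_deriv: "(E has_real_derivative (LINT t|mu. h' s t)) (at s)" for s
    unfolding E_def
  proof (rule has_real_derivative_integral_mu)
    show "continuous_on {-1..1} (\<lambda>t. Y s t ^ m * e s t)" for s
      by (intro continuous_intros contY conte)
    show "((\<lambda>s. Y s t ^ m * e s t) has_real_derivative h' s t) (at s)" for s t
    proof -
      have 1: "((\<lambda>s. Y s t ^ m) has_real_derivative Ys s t) (at s)"
        unfolding Y_def Ys_def by (auto intro!: derivative_eq_intros simp: mult_ac)
      note [derivative_intros] = wave_sin_deriv pderiv_wave_sin_deriv wave_cos_deriv
      have 2: "((\<lambda>s. e s t) has_real_derivative (2 * poly (Z s) t * (poly (Lop (U s)) t - lam\<^sup>2 * poly (U s) t)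
          + (1 - t\<^sup>2) * (2 * poly (pderiv (U s)) t * poly (pderiv (Z s)) t) + lam\<^sup>2 * (2 * poly (U s) t * poly (Z s) t))) (at s)"
        unfolding e_def UZ by (auto intro!: derivative_eq_intros simp: algebra_simps)
      from DERIV_mult[OF 1 2] show ?thesis by (simp add: h'_def mult.commute)
    qed
    show "continuous_on (UNIV \<times> {-1..1}) (\<lambda>(s, t). h' s t)"
      unfolding h'_def Ys_def Y_def e_def UZ poly_wave split_beta
      by (intro continuous_intros contR2)
  qed
  define k where "k s t = - (2 * n * real m) * Y s t ^ (m - 1) * R t * sqrt (1 - t\<^sup>2)" for s t
  have contk: "continuous_on {-1..1} (k s)" for s unfolding k_def by (intro continuous_intros contY contR)
  have contYs: "continuous_on {-1..1} (Ys s)" for s unfolding Ys_def by (intro continuous_intros contY)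
  have E'_eq: "(LINT t|mu. h' s t) = (LINT t|mu. Ys s t * e s t - 2 * (k s t * poly (Z s) t * poly (pderiv (U s)) t))" for s
  proof -
    define G where "G t = Y s t ^ m * ((1 - t\<^sup>2) * poly (pderiv (Z s)) t * poly (pderiv (U s)) t)" for t
    have contG: "continuous_on {-1..1} G" unfolding G_def by (intro continuous_intros contY)
    have I: "(LINT t|mu. Y s t ^ m * poly (Z s) t * poly (Lop (U s)) t) =
       - (LINT t|mu. k s t * poly (Z s) t * poly (pderiv (U s)) t + G t)"
      unfolding G_def
    proof (rule integral_Lop)
      show "continuous_on {-1..1} (\<lambda>t. Y s t ^ m)" by (intro continuous_intros contY)
      show "((\<lambda>t. Y s t ^ m) has_real_derivative real m * Y s t ^ (m - 1) * (2 * R t * (n * (- inverse (sqrt (1 - t\<^sup>2)))))) (at t)"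
        if "t \<in> {-1<..<1}" for t
        using that unfolding Y_def R_def by (auto intro!: derivative_eq_intros)
      show "k s t = (1 - t\<^sup>2) * (real m * Y s t ^ (m - 1) * (2 * R t * (n * (- inverse (sqrt (1 - t\<^sup>2))))))"
        if "t \<in> {-1<..<1}" for t
      proof -
        have "1 - t\<^sup>2 > 0" using that by (simp add: abs_square_less_1 abs_less_iff)
        then have "sqrt (1 - t\<^sup>2) = (1 - t\<^sup>2) * inverse (sqrt (1 - t\<^sup>2))"
          by (simp add: real_div_sqrt flip: divide_inverse)
        then show ?thesis unfolding k_def by (simp add: mult_ac)
      qed
    qed (rule contk)
    have "(LINT t|mu. h' s t) = (LINT t|mu. Ys s t * e s t + 2 * (Y s t ^ m * poly (Z s) t * poly (Lop (U s)) t) + 2 * G t)"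
      unfolding h'_def G_def by (intro Bochner_Integration.integral_cong refl) (simp add: algebra_simps)
    also have "\<dots> = (LINT t|mu. Ys s t * e s t) + 2 * (LINT t|mu. Y s t ^ m * poly (Z s) t * poly (Lop (U s)) t) + 2 * (LINT t|mu. G t)"
      by (subst Bochner_Integration.integral_add Bochner_Integration.integral_add;
          (intro integrable_mu continuous_intros contYs conte contY contG)?)+ simp
    also have "\<dots> = (LINT t|mu. Ys s t * e s t) - 2 * (LINT t|mu. k s t * poly (Z s) t * poly (pderiv (U s)) t)"
      unfolding I by (subst Bochner_Integration.integral_add; (intro integrable_mu continuous_intros contk contG)?) simp
    also have "\<dots> = (LINT t|mu. Ys s t * e s t - 2 * (k s t * poly (Z s) t * poly (pderiv (U s)) t))"
      by (subst Bochner_Integration.integral_diff; (intro integrable_mu continuous_intros contYs conte contk)?) simp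
    finally show ?thesis .
  qed
  have enn: "e s t \<ge> 0" "(poly (Z s) t)\<^sup>2 \<le> e s t"
    "\<bar>2 * sqrt (1 - t\<^sup>2) * poly (Z s) t * poly (pderiv (U s)) t\<bar> \<le> e s t" if "t \<in> {-1..1}" for s t
  proof -
    have t: "1 - t\<^sup>2 \<ge> 0" using that by (simp add: abs_square_le_1 abs_le_iff)
    have e: "e s t = (poly (Z s) t)\<^sup>2 + (sqrt (1 - t\<^sup>2) * poly (pderiv (U s)) t)\<^sup>2 + (lam * poly (U s) t)\<^sup>2"
      unfolding e_def using t by (simp add: power_mult_distrib)
    show "e s t \<ge> 0" "(poly (Z s) t)\<^sup>2 \<le> e s t" unfolding e by simp_all
    have "2 * \<bar>poly (Z s) t\<bar> * \<bar>sqrt (1 - t\<^sup>2) * poly (pderiv (U s)) t\<bar> \<le> (poly (Z s) t)\<^sup>2 + (sqrt (1 - t\<^sup>2) * poly (pderiv (U s)) t)\<^sup>2"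
      using sum_squares_bound[of "\<bar>poly (Z s) t\<bar>" "\<bar>sqrt (1 - t\<^sup>2) * poly (pderiv (U s)) t\<bar>"] by simp
    also have "\<dots> \<le> e s t" unfolding e by simp
    finally show "\<bar>2 * sqrt (1 - t\<^sup>2) * poly (Z s) t * poly (pderiv (U s)) t\<bar> \<le> e s t"
      by (simp add: abs_mult mult_ac)
  qed
  have E'_le: "(LINT t|mu. h' s t) \<le> 5/2 * real m * n / (1 + n * s) * E s" if s: "s \<ge> 0" for s
  proof -
    define A where "A = 1 + n * s"
    have A: "A \<ge> 1" using n s by (simp add: A_def)
    have "(LINT t|mu. h' s t) \<le> (LINT t|mu. 5/2 * real m * n / A * (Y s t ^ m * e s t))"
      unfolding E'_eq
    proof (intro integral_mono integrable_mu continuous_intros contYs conte contk contY)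
      fix t assume "t \<in> space mu"
      then have t: "t \<in> {-1..1}" by simp
      define X where "X = real m * Y s t ^ (m - 1)"
      have Y0: "Y s t \<ge> 0" by (simp add: Y_def)
      then have X0: "X \<ge> 0" by (simp add: X_def)
      have XY: "X * Y s t = real m * Y s t ^ m" unfolding X_def by (cases m) auto
      have "- 2 * (k s t * poly (Z s) t * poly (pderiv (U s)) t) =
        2 * n * X * R t * (2 * sqrt (1 - t\<^sup>2) * poly (Z s) t * poly (pderiv (U s)) t)"
        unfolding k_def X_def by (simp add: mult_ac)
      also have "\<dots> \<le> 2 * n * X * \<bar>R t\<bar> * e s t"
      proof -
        have "R t * (2 * sqrt (1 - t\<^sup>2) * poly (Z s) t * poly (pderiv (U s)) t) \<le> \<bar>R t\<bar> * e s t"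
          by (rule order.trans[OF abs_ge_self]) (subst abs_mult, intro mult_left_mono enn t, simp)
        from mult_left_mono[OF this, of "2 * n * X"] show ?thesis using n X0 by (simp add: mult_ac)
      qed
      finally have 1: "- 2 * (k s t * poly (Z s) t * poly (pderiv (U s)) t) \<le> 2 * n * X * \<bar>R t\<bar> * e s t" .
      have "A * (A + \<bar>R t\<bar>) \<le> 5/4 * Y s t"
      proof -
        have "5/4 * (A\<^sup>2 + \<bar>R t\<bar>\<^sup>2) - A * (A + \<bar>R t\<bar>) = (A / 2 - \<bar>R t\<bar>)\<^sup>2 + \<bar>R t\<bar>\<^sup>2 / 4"
          by (simp add: power2_eq_square algebra_simps)
        then show ?thesis using zero_le_power2[of "A / 2 - \<bar>R t\<bar>"] zero_le_power2[of "\<bar>R t\<bar>"]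
          unfolding Y_def A_def[symmetric] power2_abs by linarith
      qed
      then have 2: "A + \<bar>R t\<bar> \<le> 5/4 * Y s t / A" using A by (simp add: field_simps)
      have "Ys s t * e s t - 2 * (k s t * poly (Z s) t * poly (pderiv (U s)) t) \<le> 2 * n * X * e s t * (A + \<bar>R t\<bar>)"
        using 1 unfolding Ys_def X_def[symmetric] A_def[symmetric] by (simp add: algebra_simps)
      also have "\<dots> \<le> 2 * n * X * e s t * (5/4 * Y s t / A)"
        using n X0 enn(1)[OF t] by (intro mult_left_mono 2) simp
      also have "\<dots> = 5/2 * n / A * e s t * (X * Y s t)" by simp
      also have "\<dots> = 5/2 * real m * n / A * (Y s t ^ m * e s t)" unfolding XY by simp
      finally show "Ys s t * e s t - 2 * (k s t * poly (Z s) t * poly (pderiv (U s)) t) \<le> 5/2 * real m * n / A * (Y s t ^ m * e s t)" .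
    qed
    then show ?thesis by (simp add: A_def E_def)
  qed
  define p where "p = 5/2 * real m"
  have "E s * (1 + n * s) powr (- p) \<le> E 0 * (1 + n * 0) powr (- p)"
  proof (rule DERIV_nonpos_imp_nonincreasing[OF s])
    fix r assume r: "0 \<le> r" "r \<le> s"
    have A: "1 + n * r > 0" using n r by (simp add: add_pos_nonneg)
    have "((\<lambda>r. (1 + n * r) powr (- p)) has_real_derivative (- p * (1 + n * r) powr (- p - 1) * n)) (at r)"
      using A by (auto intro!: derivative_eq_intros)
    from DERIV_mult[OF E_deriv this]
    have d: "((\<lambda>r. E r * (1 + n * r) powr (- p)) has_real_derivative
      ((LINT t|mu. h' r t) * (1 + n * r) powr (- p) + (- p * (1 + n * r) powr (- p - 1) * n) * E r)) (at r)" .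
    have pw: "(1 + n * r) powr (- p - 1) = (1 + n * r) powr (- p) / (1 + n * r)"
      using A by (simp add: powr_diff)
    have "(LINT t|mu. h' r t) * (1 + n * r) powr (- p) \<le> (p * n / (1 + n * r) * E r) * (1 + n * r) powr (- p)"
      using E'_le[OF r(1)] by (intro mult_right_mono) (auto simp: p_def)
    then have "(LINT t|mu. h' r t) * (1 + n * r) powr (- p) + (- p * (1 + n * r) powr (- p - 1) * n) * E r \<le> 0"
      unfolding pw by (simp add: mult_ac)
    with d show "\<exists>y. ((\<lambda>r. E r * (1 + n * r) powr (- p)) has_real_derivative y) (at r) \<and> y \<le> 0" by blast
  qed
  moreover have A: "1 + n * s > 0" using n s by (simp add: add_pos_nonneg)
  ultimately have "E s \<le> (1 + n * s) powr p * E 0" by (simp add: powr_minus field_simps)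
  also have "E 0 = (LINT t|mu. (1 + (R t)\<^sup>2) ^ m * (poly (wave_cos D c 0) t)\<^sup>2)"
    unfolding E_def e_def Y_def UZ by (simp add: wave_sin_0)
  finally have "E s \<le> (1 + n * s) powr p * (LINT t|mu. (1 + (R t)\<^sup>2) ^ m * (poly (wave_cos D c 0) t)\<^sup>2)" .
  moreover have "(LINT t|mu. (1 + (R t)\<^sup>2) ^ m * (poly (wave_cos D c s) t)\<^sup>2) \<le> E s"
    unfolding E_def
  proof (intro integral_mono integrable_mu continuous_intros contY conte contR)
    fix t assume "t \<in> space mu"
    then have t: "t \<in> {-1..1}" by simp
    have "1 \<le> (1 + n * s)\<^sup>2" using n s by (intro one_le_power) simp
    then have "1 + (R t)\<^sup>2 \<le> Y s t" unfolding Y_def by simp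
    then show "(1 + (R t)\<^sup>2) ^ m * (poly (wave_cos D c s) t)\<^sup>2 \<le> Y s t ^ m * e s t"
      using enn[OF t, of s] unfolding Z_def by (intro mult_mono power_mono) (auto simp: Y_def)
  qed
  ultimately show ?thesis unfolding p_def by linarith
qed

lemma cos_multiplier_bound:
  fixes n \<theta> :: real
  assumes n: "n > 0" and s: "\<And>l. s l \<ge> 0"
    and bnd: "\<And>P. (\<Sum>l\<le>P. \<bar>b l\<bar> * (1 + n * s l) powr (5/4 * real m)) \<le> B"
    and lim: "\<And>j. j \<le> D \<Longrightarrow> (\<lambda>P. \<Sum>l\<le>P. b l * cos (s l * freq j)) \<longlonglongrightarrow> f j"
  defines "\<Psi> \<equiv> \<lambda>t. (1 + (n * (arccos t - \<theta>))\<^sup>2) ^ m"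
  shows "(LINT t|mu. \<Psi> t * (\<Sum>j\<le>D. f j * c j * poly (pn j) t)\<^sup>2) \<le>
     B\<^sup>2 * (LINT t|mu. \<Psi> t * (\<Sum>j\<le>D. c j * poly (pn j) t)\<^sup>2)"
proof -
  define N where "N = (LINT t|mu. \<Psi> t * (\<Sum>j\<le>D. c j * poly (pn j) t)\<^sup>2)"
  have cont: "continuous_on {-1..1} \<Psi>" unfolding \<Psi>_def by (intro continuous_intros) auto
  have \<Psi>0: "\<Psi> t \<ge> 0" for t by (simp add: \<Psi>_def)
  have N0: "N \<ge> 0" unfolding N_def using \<Psi>0 by (intro integral_nonneg_AE AE_I2) auto
  define A where "A l = (1 + n * s l) powr (5/4 * real m)" for l
  have A: "A l > 0" for l
  proof -
    have "1 + n * s l > 0" using n s[of l] by (intro add_pos_nonneg) auto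
    then show ?thesis by (simp add: A_def)
  qed
  have A': "A l \<noteq> 0" for l using A[of l] by simp
  have wave: "(LINT t|mu. \<Psi> t * (poly (wave_cos D c (s l)) t)\<^sup>2) \<le> (A l)\<^sup>2 * N" for l
  proof -
    have "(A l)\<^sup>2 = (1 + n * s l) powr (5/2 * real m)"
      unfolding A_def power2_eq_square by (simp flip: powr_add)
    moreover have "N = (LINT t|mu. \<Psi> t * (poly (wave_cos D c 0) t)\<^sup>2)" by (simp add: N_def poly_wave_cos)
    ultimately show ?thesis using wave_energy_estimate[OF n s[of l], of \<theta> m D c] by (simp add: \<Psi>_def)
  qed
  define fP where "fP P j = (\<Sum>l\<le>P. b l * cos (s l * freq j))" for P j
  have part: "(LINT t|mu. \<Psi> t * (\<Sum>j\<le>D. fP P j * c j * poly (pn j) t)\<^sup>2) \<le> B\<^sup>2 * N" for P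
  proof -
    define S where "S = (\<Sum>l\<le>P. \<bar>b l\<bar> * A l)"
    have S0: "S \<ge> 0" unfolding S_def using A by (intro sum_nonneg) (simp add: order_less_imp_le)
    have SB: "S \<le> B" using bnd[of P] by (simp add: S_def A_def)
    have "(LINT t|mu. \<Psi> t * (\<Sum>j\<le>D. fP P j * c j * poly (pn j) t)\<^sup>2) \<le>
       (LINT t|mu. S * (\<Sum>l\<le>P. \<bar>b l\<bar> / A l * (\<Psi> t * (poly (wave_cos D c (s l)) t)\<^sup>2)))"
    proof (intro integral_mono integrable_mu continuous_intros cont)
      fix t
      define y where "y l = poly (wave_cos D c (s l)) t" for l
      have "(\<Sum>j\<le>D. fP P j * c j * poly (pn j) t) = (\<Sum>l\<le>P. b l * y l)"
        unfolding fP_def y_def poly_wave_cos sum_distrib_left sum_distrib_right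
        by (subst sum.swap) (simp add: mult_ac)
      also have "\<dots>\<^sup>2 \<le> (\<Sum>l\<le>P. \<bar>b l\<bar> * \<bar>y l\<bar>)\<^sup>2"
        unfolding abs_le_square_iff[symmetric]
        by (rule order.trans[OF sum_abs]) (simp add: abs_mult sum_nonneg)
      also have "(\<Sum>l\<le>P. \<bar>b l\<bar> * \<bar>y l\<bar>) = (\<Sum>l\<le>P. sqrt (\<bar>b l\<bar> * A l) * (sqrt (\<bar>b l\<bar> / A l) * \<bar>y l\<bar>))"
      proof (intro sum.cong refl)
        fix l
        have "sqrt (\<bar>b l\<bar> * A l) * sqrt (\<bar>b l\<bar> / A l) = \<bar>b l\<bar>"
          using A[of l] by (simp add: real_sqrt_mult[symmetric])
        then show "\<bar>b l\<bar> * \<bar>y l\<bar> = sqrt (\<bar>b l\<bar> * A l) * (sqrt (\<bar>b l\<bar> / A l) * \<bar>y l\<bar>)"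
          by (metis mult.assoc)
      qed
      also have "\<dots>\<^sup>2 \<le> (\<Sum>l\<le>P. (sqrt (\<bar>b l\<bar> * A l))\<^sup>2) * (\<Sum>l\<le>P. (sqrt (\<bar>b l\<bar> / A l) * \<bar>y l\<bar>)\<^sup>2)"
        by (rule Cauchy_Schwarz_ineq_sum)
      also have "\<dots> = S * (\<Sum>l\<le>P. \<bar>b l\<bar> / A l * (y l)\<^sup>2)"
        using A by (simp add: S_def power_mult_distrib order_less_imp_le)
      finally have "(\<Sum>j\<le>D. fP P j * c j * poly (pn j) t)\<^sup>2 \<le> S * (\<Sum>l\<le>P. \<bar>b l\<bar> / A l * (y l)\<^sup>2)" .
      from mult_left_mono[OF this \<Psi>0[of t]]
      show "\<Psi> t * (\<Sum>j\<le>D. fP P j * c j * poly (pn j) t)\<^sup>2 \<le> S * (\<Sum>l\<le>P. \<bar>b l\<bar> / A l * (\<Psi> t * (poly (wave_cos D c (s l)) t)\<^sup>2))"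
        unfolding y_def by (simp add: sum_distrib_left mult_ac)
    qed
    also have "\<dots> = S * (\<Sum>l\<le>P. \<bar>b l\<bar> / A l * (LINT t|mu. \<Psi> t * (poly (wave_cos D c (s l)) t)\<^sup>2))"
      by (subst integral_mult_right_zero, subst Bochner_Integration.integral_sum)
         (auto intro!: integrable_mu continuous_intros cont simp: A')
    also have "\<dots> \<le> S * (\<Sum>l\<le>P. \<bar>b l\<bar> / A l * ((A l)\<^sup>2 * N))"
      using A by (intro mult_left_mono S0 sum_mono wave) (simp add: order_less_imp_le)
    also have "(\<Sum>l\<le>P. \<bar>b l\<bar> / A l * ((A l)\<^sup>2 * N)) = S * N"
      unfolding S_def sum_distrib_right using A
      by (intro sum.cong refl) (simp add: power2_eq_square less_imp_neq[THEN not_sym])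
    also have "S * (S * N) \<le> B\<^sup>2 * N"
      using mult_right_mono[OF power_mono[OF SB S0, of 2] N0] by (simp add: power2_eq_square mult.assoc)
    finally show ?thesis .
  qed
  have expand: "(LINT t|mu. \<Psi> t * (\<Sum>j\<le>D. g j * c j * poly (pn j) t)\<^sup>2) =
     (\<Sum>i\<le>D. \<Sum>j\<le>D. g i * g j * (c i * c j * (LINT t|mu. \<Psi> t * (poly (pn i) t * poly (pn j) t))))" for g
  proof -
    have "\<Psi> t * (\<Sum>j\<le>D. g j * c j * poly (pn j) t)\<^sup>2 =
       (\<Sum>i\<le>D. \<Sum>j\<le>D. (g i * g j * (c i * c j)) * (\<Psi> t * (poly (pn i) t * poly (pn j) t)))" for t
      unfolding power2_eq_square sum_product sum_distrib_left by (intro sum.cong refl) (simp add: sum_distrib_left mult_ac)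
    then show ?thesis
      by (simp add: Bochner_Integration.integral_sum integrable_mu continuous_intros cont mult.assoc)
  qed
  have "(\<lambda>P. LINT t|mu. \<Psi> t * (\<Sum>j\<le>D. fP P j * c j * poly (pn j) t)\<^sup>2) \<longlonglongrightarrow>
     (LINT t|mu. \<Psi> t * (\<Sum>j\<le>D. f j * c j * poly (pn j) t)\<^sup>2)"
    unfolding expand using lim by (intro tendsto_intros) (auto simp: fP_def)
  then show ?thesis unfolding N_def[symmetric]
    by (rule LIMSEQ_le_const2) (use part in auto)
qed

end

section \<open>Cosine series of cutoff functions\<close>

lemma integral_cos_int:
  fixes \<kappa> :: real and p :: int
  assumes "\<kappa> > 0"
  shows "integral {0..\<kappa>} (\<lambda>t. cos (pi * of_int p / \<kappa> * t)) = (if p = 0 then \<kappa> else 0)"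
proof (cases "p = 0")
  case False
  define w where "w = pi * of_int p / \<kappa>"
  have w: "w \<noteq> 0" using False assms by (simp add: w_def)
  have "((\<lambda>t. cos (w * t)) has_integral (sin (w * \<kappa>) / w - sin (w * 0) / w)) {0..\<kappa>}"
    using assms w
    by (intro fundamental_theorem_of_calculus)
       (auto intro!: derivative_eq_intros simp: has_real_derivative_iff_has_vector_derivative[symmetric])
  moreover have "sin (w * \<kappa>) = 0" using assms by (simp add: w_def sin_zero_iff_int2 mult.commute)
  ultimately show ?thesis using False by (simp add: integral_unique w_def)
qed (use assms in simp)

text \<open>With a common phase \<open>M * pi / 2\<close> this covers the cosine and the sine system.\<close>

lemma integral_cos_phase:
  fixes \<kappa> :: real
  assumes \<kappa>: "\<kappa> > 0" and l: "l \<ge> (1::nat) \<or> M = 0"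
  defines "e \<equiv> \<lambda>l t. cos (pi * real l / \<kappa> * t + real M * (pi / 2))"
  shows "integral {0..\<kappa>} (\<lambda>t. e l t * e m t) = (if l = m then (if l = 0 then \<kappa> else \<kappa> / 2) else 0)"
proof -
  have sp: "sin (real M * pi) = 0" by simp
  have "e l t * e m t = 1/2 * cos (pi * of_int (int l - int m) / \<kappa> * t) + cos (real M * pi) / 2 * cos (pi * of_int (int l + int m) / \<kappa> * t)" for t
  proof -
    have a: "(pi * real l / \<kappa> * t + real M * (pi / 2)) - (pi * real m / \<kappa> * t + real M * (pi / 2)) = pi * of_int (int l - int m) / \<kappa> * t"
      using \<kappa> by (simp add: field_simps)
    have b: "(pi * real l / \<kappa> * t + real M * (pi / 2)) + (pi * real m / \<kappa> * t + real M * (pi / 2)) = pi * of_int (int l + int m) / \<kappa> * t + real M * pi"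
      using \<kappa> by (simp add: field_simps)
    have "e l t * e m t = (cos (pi * of_int (int l - int m) / \<kappa> * t) + cos (pi * of_int (int l + int m) / \<kappa> * t + real M * pi)) / 2"
      unfolding e_def cos_times_cos a b ..
    also have "cos (pi * of_int (int l + int m) / \<kappa> * t + real M * pi) = cos (pi * of_int (int l + int m) / \<kappa> * t) * cos (real M * pi)"
      by (subst cos_add) (simp only: sp mult_zero_right diff_zero)
    finally show ?thesis by (simp only: add_divide_distrib times_divide_eq_left mult_1_left mult.commute)
  qed
  then have "integral {0..\<kappa>} (\<lambda>t. e l t * e m t) =
     integral {0..\<kappa>} (\<lambda>t. 1/2 * cos (pi * of_int (int l - int m) / \<kappa> * t)) +
     integral {0..\<kappa>} (\<lambda>t. cos (real M * pi) / 2 * cos (pi * of_int (int l + int m) / \<kappa> * t))"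
    by (simp only:) (intro integral_add integrable_continuous_interval continuous_intros)
  also have "\<dots> = 1/2 * (if int l - int m = 0 then \<kappa> else 0) + cos (real M * pi) / 2 * (if int l + int m = 0 then \<kappa> else 0)"
    by (simp only: integral_mult_right integral_cos_int[OF \<kappa>])
  also have "\<dots> = (if l = m then (if l = 0 then \<kappa> else \<kappa> / 2) else 0)" using l by auto
  finally show ?thesis .
qed

lemma bessel_cos_phase:
  fixes \<kappa> :: real and F :: "real \<Rightarrow> real" and M :: nat
  assumes \<kappa>: "\<kappa> > 0" and F: "continuous_on {0..\<kappa>} F"
  defines "e \<equiv> \<lambda>l t. cos (pi * real l / \<kappa> * t + real M * (pi / 2))"
  shows "(\<Sum>l=1..P. (integral {0..\<kappa>} (\<lambda>t. F t * e l t))\<^sup>2) \<le> \<kappa> / 2 * integral {0..\<kappa>} (\<lambda>t. (F t)\<^sup>2)"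
proof -
  define B where "B l = integral {0..\<kappa>} (\<lambda>t. F t * e l t)" for l
  define a where "a l = 2 / \<kappa> * B l" for l
  define S where "S t = (\<Sum>l=1..P. a l * e l t)" for t
  have conte: "continuous_on {0..\<kappa>} (e l)" for l unfolding e_def by (intro continuous_intros)
  have contS: "continuous_on {0..\<kappa>} S" unfolding S_def by (intro continuous_intros conte)
  have FS: "integral {0..\<kappa>} (\<lambda>t. F t * S t) = (\<Sum>l=1..P. a l * B l)"
  proof -
    have "(\<lambda>t. F t * S t) = (\<lambda>t. \<Sum>l=1..P. a l * (F t * e l t))"
      by (auto simp: S_def sum_distrib_left mult_ac)
    then show ?thesis unfolding B_def
      by (simp only:, subst integral_sum) (auto intro!: integrable_continuous_interval continuous_intros F conte)
  qed
  have Se: "integral {0..\<kappa>} (\<lambda>t. S t * e m t) = a m * (\<kappa> / 2)" if "m \<in> {1..P}" for m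
  proof -
    have "(\<lambda>t. S t * e m t) = (\<lambda>t. \<Sum>l=1..P. a l * (e l t * e m t))"
      by (auto simp: S_def sum_distrib_left sum_distrib_right mult_ac)
    then have "integral {0..\<kappa>} (\<lambda>t. S t * e m t) = (\<Sum>l=1..P. a l * integral {0..\<kappa>} (\<lambda>t. e l t * e m t))"
      by (simp only:, subst integral_sum) (auto intro!: integrable_continuous_interval continuous_intros conte)
    also have "\<dots> = (\<Sum>l=1..P. if l = m then a l * (\<kappa> / 2) else 0)"
      using integral_cos_phase[OF \<kappa>] unfolding e_def by (intro sum.cong refl) auto
    also have "\<dots> = a m * (\<kappa> / 2)" using that by simp
    finally show ?thesis .
  qed
  have SS: "integral {0..\<kappa>} (\<lambda>t. S t * S t) = (\<Sum>l=1..P. a l * (a l * (\<kappa> / 2)))"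
  proof -
    have "(\<lambda>t. S t * S t) = (\<lambda>t. \<Sum>l=1..P. a l * (S t * e l t))"
      by (subst (2) S_def) (auto simp: sum_distrib_left mult_ac)
    then have "integral {0..\<kappa>} (\<lambda>t. S t * S t) = (\<Sum>l=1..P. a l * integral {0..\<kappa>} (\<lambda>t. S t * e l t))"
      by (simp only:, subst integral_sum) (auto intro!: integrable_continuous_interval continuous_intros conte contS)
    then show ?thesis by (simp only: Se cong: sum.cong)
  qed
  have "0 \<le> integral {0..\<kappa>} (\<lambda>t. (F t - S t)\<^sup>2)"
    by (intro integral_nonneg integrable_continuous_interval continuous_intros F contS) auto
  also have "(\<lambda>t. (F t - S t)\<^sup>2) = (\<lambda>t. ((F t)\<^sup>2 - 2 * (F t * S t)) + S t * S t)"
    by (auto simp: power2_eq_square algebra_simps)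
  also have "integral {0..\<kappa>} (\<lambda>t. ((F t)\<^sup>2 - 2 * (F t * S t)) + S t * S t) =
     integral {0..\<kappa>} (\<lambda>t. (F t)\<^sup>2) - 2 * integral {0..\<kappa>} (\<lambda>t. F t * S t) + integral {0..\<kappa>} (\<lambda>t. S t * S t)"
    by (subst integral_add integral_diff; (intro integrable_continuous_interval continuous_intros F contS)?)+ simp
  also have "\<dots> = integral {0..\<kappa>} (\<lambda>t. (F t)\<^sup>2) - 2 / \<kappa> * (\<Sum>l=1..P. (B l)\<^sup>2)"
    unfolding FS SS sum_distrib_left using \<kappa> by (simp add: a_def power2_eq_square field_simps sum_subtractf[symmetric] flip: sum.distrib)
  finally show ?thesis using \<kappa> by (simp add: B_def field_simps)
qed

lemma cosine_series_sums:
  fixes \<kappa> :: real and F :: "real \<Rightarrow> real"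
  assumes \<kappa>: "\<kappa> > 0" and F: "continuous_on {0..\<kappa>} F"
  defines "e \<equiv> \<lambda>l t. cos (pi * real l / \<kappa> * t)"
  defines "c \<equiv> \<lambda>l. (if l = 0 then 1 else 2) / \<kappa> * integral {0..\<kappa>} (\<lambda>t. F t * e l t)"
  assumes summ: "summable (\<lambda>l. \<bar>c l\<bar>)" and \<tau>: "\<tau> \<in> {0..\<kappa>}"
  shows "(\<lambda>l. c l * e l \<tau>) sums F \<tau>"
proof -
  define S where "S P t = (\<Sum>l<P. c l * e l t)" for P t
  define H where "H t = (\<Sum>l. c l * e l t)" for t
  define r where "r t = F t - H t" for t
  have conte: "continuous_on {0..\<kappa>} (e l)" for l unfolding e_def by (intro continuous_intros)
  have contS: "continuous_on {0..\<kappa>} (S P)" for P unfolding S_def by (intro continuous_intros conte)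
  have el: "\<bar>e l t\<bar> \<le> 1" for l t by (simp add: e_def)
  have le: "norm (c l * e l t) \<le> \<bar>c l\<bar>" for l t using el[of l t] by (simp add: abs_mult mult_left_le)
  have unif: "uniform_limit {0..\<kappa>} S H sequentially"
    unfolding S_def H_def by (rule Weierstrass_m_test[OF le summ])
  have contH: "continuous_on {0..\<kappa>} H"
    by (rule uniform_limit_theorem[OF always_eventually unif]) (auto intro: contS)
  have contr: "continuous_on {0..\<kappa>} r" unfolding r_def by (intro continuous_intros F contH)
  have ortho: "integral {0..\<kappa>} (\<lambda>t. e l t * e m t) = (if l = m then (if l = 0 then \<kappa> else \<kappa> / 2) else 0)" for l m
    using integral_cos_phase[OF \<kappa>, of l 0 m] by (simp add: e_def)
  have Sm: "integral {0..\<kappa>} (\<lambda>t. S P t * e m t) = integral {0..\<kappa>} (\<lambda>t. F t * e m t)" if "m < P" for P m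
  proof -
    have "(\<lambda>t. S P t * e m t) = (\<lambda>t. \<Sum>l<P. c l * (e l t * e m t))"
      by (auto simp: S_def sum_distrib_left sum_distrib_right mult_ac)
    then have "integral {0..\<kappa>} (\<lambda>t. S P t * e m t) = (\<Sum>l<P. c l * integral {0..\<kappa>} (\<lambda>t. e l t * e m t))"
      by (simp only:, subst integral_sum) (auto intro!: integrable_continuous_interval continuous_intros conte)
    also have "\<dots> = (\<Sum>l<P. if l = m then c m * (if m = 0 then \<kappa> else \<kappa> / 2) else 0)"
      unfolding ortho by (intro sum.cong refl) auto
    also have "\<dots> = c m * (if m = 0 then \<kappa> else \<kappa> / 2)" using that by simp
    also have "\<dots> = integral {0..\<kappa>} (\<lambda>t. F t * e m t)" using \<kappa> by (simp add: c_def)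
    finally show ?thesis .
  qed
  have Hm: "integral {0..\<kappa>} (\<lambda>t. H t * e m t) = integral {0..\<kappa>} (\<lambda>t. F t * e m t)" for m
  proof (rule LIMSEQ_unique)
    have "uniform_limit {0..\<kappa>} (\<lambda>P t. S P t * e m t) (\<lambda>t. H t * e m t) sequentially"
    proof (rule uniform_lim_mult[OF unif uniform_limit_const])
      show "bounded (H ` {0..\<kappa>})" by (intro compact_imp_bounded compact_continuous_image contH) simp
      show "bounded (e m ` {0..\<kappa>})" by (intro compact_imp_bounded compact_continuous_image conte) simp
    qed
    then obtain I J where I: "\<And>P. ((\<lambda>t. S P t * e m t) has_integral I P) {0..\<kappa>}"
       "((\<lambda>t. H t * e m t) has_integral J) {0..\<kappa>}" "I \<longlonglongrightarrow> J"
      by (rule uniform_limit_integral) (auto intro!: continuous_intros contS conte)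
    show "(\<lambda>P. integral {0..\<kappa>} (\<lambda>t. S P t * e m t)) \<longlonglongrightarrow> integral {0..\<kappa>} (\<lambda>t. H t * e m t)"
      using I(3) by (simp add: integral_unique[OF I(1)] integral_unique[OF I(2)])
    show "(\<lambda>P. integral {0..\<kappa>} (\<lambda>t. S P t * e m t)) \<longlonglongrightarrow> integral {0..\<kappa>} (\<lambda>t. F t * e m t)"
      by (rule tendsto_eventually) (use Sm in \<open>auto intro: eventually_mono[OF eventually_gt_at_top[of m]]\<close>)
  qed
  have rm: "integral {0..\<kappa>} (\<lambda>t. r t * e m t) = 0" for m
  proof -
    have "integral {0..\<kappa>} (\<lambda>t. r t * e m t) = integral {0..\<kappa>} (\<lambda>t. F t * e m t - H t * e m t)"
      by (simp add: r_def algebra_simps)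
    also have "\<dots> = integral {0..\<kappa>} (\<lambda>t. F t * e m t) - integral {0..\<kappa>} (\<lambda>t. H t * e m t)"
      by (intro integral_diff integrable_continuous_interval continuous_intros F contH conte)
    finally show ?thesis by (simp add: Hm)
  qed
  have e1: "e 1 t * e m t = (e (m + 1) t + e (if m = 0 then 1 else m - 1) t) / 2" for m t
  proof (cases m)
    case 0
    then show ?thesis by (simp add: e_def)
  next
    case (Suc k)
    have "pi * real m / \<kappa> * t + pi * real 1 / \<kappa> * t = pi * real (m + 1) / \<kappa> * t"
      "pi * real m / \<kappa> * t - pi * real 1 / \<kappa> * t = pi * real (m - 1) / \<kappa> * t"
      using \<kappa> Suc by (simp_all add: field_simps)
    then show ?thesis using Suc cos_times_cos[of "pi * real m / \<kappa> * t" "pi * real 1 / \<kappa> * t"]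
      by (simp only: e_def mult.commute[of "cos (pi * real 1 / \<kappa> * t)"]) simp
  qed
  have pw: "integral {0..\<kappa>} (\<lambda>t. r t * (e 1 t) ^ i * e m t) = 0" for i m
  proof (induction i arbitrary: m)
    case (Suc i)
    let ?m' = "if m = 0 then 1 else m - 1"
    have "r t * (e 1 t) ^ Suc i * e m t = 1/2 * (r t * (e 1 t) ^ i * e (m + 1) t) + 1/2 * (r t * (e 1 t) ^ i * e ?m' t)" for t
    proof -
      have "r t * (e 1 t) ^ Suc i * e m t = r t * (e 1 t) ^ i * (e 1 t * e m t)" by simp
      then show ?thesis unfolding e1 by (simp add: algebra_simps)
    qed
    then have "integral {0..\<kappa>} (\<lambda>t. r t * (e 1 t) ^ Suc i * e m t) =
       integral {0..\<kappa>} (\<lambda>t. 1/2 * (r t * (e 1 t) ^ i * e (m + 1) t)) + integral {0..\<kappa>} (\<lambda>t. 1/2 * (r t * (e 1 t) ^ i * e ?m' t))"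
      by (simp only:) (intro integral_add integrable_continuous_interval continuous_intros contr conte)
    also have "\<dots> = 0" by (simp only: integral_mult_right Suc.IH)
    finally show ?case .
  qed (simp add: rm)
  have rp: "integral {0..\<kappa>} (\<lambda>t. r t * poly p (e 1 t)) = 0" for p
  proof -
    have "(\<lambda>t. r t * poly p (e 1 t)) = (\<lambda>t. \<Sum>i\<le>degree p. coeff p i * (r t * (e 1 t) ^ i * e 0 t))"
      by (auto simp: poly_altdef sum_distrib_left mult_ac e_def)
    then show ?thesis
      by (simp only:, subst integral_sum)
         (auto intro!: integrable_continuous_interval continuous_intros contr conte simp: pw[unfolded One_nat_def])
  qed
  have "integral {0..\<kappa>} (\<lambda>t. (r t)\<^sup>2) \<le> 0"
  proof (rule field_le_epsilon)
    fix \<epsilon> :: real assume \<epsilon>: "\<epsilon> > 0"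
    define N where "N = integral {0..\<kappa>} (\<lambda>t. \<bar>r t\<bar>)"
    have N0: "N \<ge> 0" unfolding N_def by (intro integral_nonneg integrable_continuous_interval continuous_intros contr) auto
    define \<delta> where "\<delta> = \<epsilon> / (N + 1)"
    have \<delta>: "\<delta> > 0" using \<epsilon> N0 by (simp add: \<delta>_def)
    have "\<exists>g. (\<exists>p. g = (\<lambda>t. poly p (e 1 t))) \<and> (\<forall>t\<in>{0..\<kappa>}. \<bar>r t - g t\<bar> < \<delta>)"
    proof (rule Stone_Weierstrass_HOL)
      show "\<exists>p. (\<lambda>t. a) = (\<lambda>t. poly p (e 1 t))" for a by (intro exI[of _ "[:a:]"]) simp
      show "continuous_on {0..\<kappa>} f" if "\<exists>p. f = (\<lambda>t. poly p (e 1 t))" for f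
        using that by (auto intro!: continuous_intros conte)
      show "\<exists>p. (\<lambda>t. f t + g t) = (\<lambda>t. poly p (e 1 t))"
        if "(\<exists>p. f = (\<lambda>t. poly p (e 1 t))) \<and> (\<exists>p. g = (\<lambda>t. poly p (e 1 t)))" for f g
        using that by (metis poly_add)
      show "\<exists>p. (\<lambda>t. f t * g t) = (\<lambda>t. poly p (e 1 t))"
        if "(\<exists>p. f = (\<lambda>t. poly p (e 1 t))) \<and> (\<exists>p. g = (\<lambda>t. poly p (e 1 t)))" for f g
        using that by (metis poly_mult)
      show "\<exists>f. (\<exists>p. f = (\<lambda>t. poly p (e 1 t))) \<and> f x \<noteq> f y"
        if "x \<in> {0..\<kappa>} \<and> y \<in> {0..\<kappa>} \<and> x \<noteq> y" for x y
      proof (intro exI[of _ "e 1"] conjI exI[of _ "[:0, 1:]"])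
        have "0 \<le> pi / \<kappa> * z \<and> pi / \<kappa> * z \<le> pi" if "z \<in> {0..\<kappa>}" for z
          using that \<kappa> by (simp add: field_simps)
        then have "cos (pi / \<kappa> * x) = cos (pi / \<kappa> * y) \<longleftrightarrow> pi / \<kappa> * x = pi / \<kappa> * y"
          using that cos_inj_pi[of "pi / \<kappa> * x" "pi / \<kappa> * y"] by auto
        then show "e 1 x \<noteq> e 1 y" using that \<kappa> by (simp add: e_def)
      qed simp
    qed (use contr \<delta> in auto)
    then obtain p where p: "\<And>t. t \<in> {0..\<kappa>} \<Longrightarrow> \<bar>r t - poly p (e 1 t)\<bar> < \<delta>" by blast
    have "integral {0..\<kappa>} (\<lambda>t. (r t)\<^sup>2) = integral {0..\<kappa>} (\<lambda>t. r t * (r t - poly p (e 1 t)) + r t * poly p (e 1 t))"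
      by (simp add: power2_eq_square algebra_simps)
    also have "\<dots> = integral {0..\<kappa>} (\<lambda>t. r t * (r t - poly p (e 1 t))) + integral {0..\<kappa>} (\<lambda>t. r t * poly p (e 1 t))"
      by (intro integral_add integrable_continuous_interval continuous_intros contr conte)
    also have "\<dots> = integral {0..\<kappa>} (\<lambda>t. r t * (r t - poly p (e 1 t)))" by (simp add: rp[unfolded One_nat_def])
    also have "\<dots> \<le> integral {0..\<kappa>} (\<lambda>t. \<bar>r t\<bar> * \<delta>)"
    proof (intro integral_le integrable_continuous_interval continuous_intros contr conte)
      fix t assume "t \<in> {0..\<kappa>}"
      then have "\<bar>r t * (r t - poly p (e 1 t))\<bar> \<le> \<bar>r t\<bar> * \<delta>"
        unfolding abs_mult using p[of t] by (intro mult_left_mono) auto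
      then show "r t * (r t - poly p (e 1 t)) \<le> \<bar>r t\<bar> * \<delta>" by linarith
    qed
    also have "\<dots> = N * \<delta>" by (simp add: N_def)
    also have "\<dots> \<le> 0 + \<epsilon>" using N0 \<epsilon> by (simp add: \<delta>_def field_simps)
    finally show "integral {0..\<kappa>} (\<lambda>t. (r t)\<^sup>2) \<le> 0 + \<epsilon>" .
  qed
  moreover have "integral {0..\<kappa>} (\<lambda>t. (r t)\<^sup>2) \<ge> 0"
    by (intro integral_nonneg integrable_continuous_interval continuous_intros contr) auto
  ultimately have "integral (cbox 0 \<kappa>) (\<lambda>t. (r t)\<^sup>2) = 0" by simp
  then have "(r \<tau>)\<^sup>2 = 0"
    using \<kappa> \<tau> by (subst (asm) integral_cbox_eq_0_iff) (auto intro!: continuous_intros contr)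
  then have "F \<tau> = H \<tau>" by (simp add: r_def)
  moreover have "summable (\<lambda>l. c l * e l \<tau>)"
    by (rule summable_comparison_test'[OF summ]) (use le in auto)
  ultimately show ?thesis by (simp add: H_def summable_sums)
qed

lemma integral_by_parts_cos:
  fixes F G :: "real \<Rightarrow> real"
  assumes \<kappa>: "\<kappa> \<ge> 0" and S: "finite S"
    and F: "continuous_on {0..\<kappa>} F" and G: "continuous_on {0..\<kappa>} G"
    and der: "\<And>t. t \<in> {0<..<\<kappa>} - S \<Longrightarrow> (F has_real_derivative G t) (at t)"
    and bd: "F \<kappa> = 0" "F 0 * sin \<phi> = 0"
  shows "\<omega> * integral {0..\<kappa>} (\<lambda>t. F t * cos (\<omega> * t + \<phi>)) = integral {0..\<kappa>} (\<lambda>t. G t * cos (\<omega> * t + (\<phi> + pi / 2)))"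
proof -
  define H where "H t = F t * sin (\<omega> * t + \<phi>)" for t
  have "((\<lambda>t. G t * sin (\<omega> * t + \<phi>) + \<omega> * (F t * cos (\<omega> * t + \<phi>))) has_integral (H \<kappa> - H 0)) {0..\<kappa>}"
  proof (rule fundamental_theorem_of_calculus_interior_strong[OF S \<kappa>])
    show "(H has_vector_derivative G t * sin (\<omega> * t + \<phi>) + \<omega> * (F t * cos (\<omega> * t + \<phi>))) (at t)"
      if "t \<in> {0<..<\<kappa>} - S" for t
      unfolding H_def has_real_derivative_iff_has_vector_derivative[symmetric]
      using der[OF that] by (auto intro!: derivative_eq_intros)
    show "continuous_on {0..\<kappa>} H" unfolding H_def by (intro continuous_intros F)
  qed
  then have "integral {0..\<kappa>} (\<lambda>t. G t * sin (\<omega> * t + \<phi>) + \<omega> * (F t * cos (\<omega> * t + \<phi>))) = 0"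
    using bd by (simp add: H_def integral_unique)
  also have "integral {0..\<kappa>} (\<lambda>t. G t * sin (\<omega> * t + \<phi>) + \<omega> * (F t * cos (\<omega> * t + \<phi>))) =
     integral {0..\<kappa>} (\<lambda>t. G t * sin (\<omega> * t + \<phi>)) + integral {0..\<kappa>} (\<lambda>t. \<omega> * (F t * cos (\<omega> * t + \<phi>)))"
    by (intro integral_add integrable_continuous_interval continuous_intros F G)
  also have "integral {0..\<kappa>} (\<lambda>t. G t * sin (\<omega> * t + \<phi>)) = - integral {0..\<kappa>} (\<lambda>t. G t * cos (\<omega> * t + (\<phi> + pi / 2)))"
    unfolding integral_neg[symmetric]
    by (intro integral_cong) (simp add: cos_add[of _ "pi/2"] flip: add.assoc)
  finally show ?thesis by simp
qed

definition shifted_cutoff :: "(real \<Rightarrow> real) \<Rightarrow> real \<Rightarrow> real \<Rightarrow> real \<Rightarrow> real" where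
  "shifted_cutoff b v \<mu> t = (if t \<le> \<mu> then v else if t \<le> \<mu> + 2 then b (t - \<mu>) else 0)"

lemma continuous_on_shifted_cutoff:
  assumes b: "continuous_on {0..2} b" and ends: "b 0 = v" "b 2 = 0"
  shows "continuous_on A (shifted_cutoff b v \<mu>)"
proof -
  have 1: "continuous_on ({\<mu>..\<mu> + 2} \<union> {\<mu> + 2..}) (\<lambda>t. if t \<le> \<mu> + 2 then b (t - \<mu>) else 0)"
    by (rule continuous_on_If)
       (auto intro!: continuous_on_compose2[OF b] continuous_intros simp: ends)
  have "continuous_on ({..\<mu>} \<union> ({\<mu>..\<mu> + 2} \<union> {\<mu> + 2..}))
     (\<lambda>t. if t \<le> \<mu> then v else if t \<le> \<mu> + 2 then b (t - \<mu>) else 0)"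
    by (rule continuous_on_If[OF _ _ _ 1]) (auto simp: ends intro!: closed_Un)
  moreover have "A \<subseteq> {..\<mu>} \<union> ({\<mu>..\<mu> + 2} \<union> {\<mu> + 2..})" by auto
  ultimately show ?thesis unfolding shifted_cutoff_def by (rule continuous_on_subset)
qed

text \<open>\<open>b i\<close> stands for the \<open>i\<close>-th derivative of a cutoff function. Extended by its value at 0 to
  the left and shifted by \<open>\<mu>\<close>, the cutoff function becomes (the restriction to \<open>{0..}\<close> of)
  an even function with \<open>M\<close> continuous derivatives.\<close>

lemma cutoff_cosine_expansion:
  fixes \<kappa> g :: real and M :: nat
  assumes \<kappa>: "\<kappa> > 0" and M: "M \<ge> 1" and g: "g \<ge> 0" "g \<le> real M - 3/4"
  obtains K where "K > 0" and
    "\<And>(b :: nat \<Rightarrow> real \<Rightarrow> real) \<mu> B. \<lbrakk>\<mu> \<ge> 0; \<mu> + 2 \<le> \<kappa>;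
      \<And>i t. i < M \<Longrightarrow> t \<in> {0..2} \<Longrightarrow> (b i has_real_derivative b (Suc i) t) (at t within {0..2});
      continuous_on {0..2} (b M); \<And>i. 1 \<le> i \<Longrightarrow> i \<le> M \<Longrightarrow> b i 0 = 0; \<And>i. i \<le> M \<Longrightarrow> b i 2 = 0;
      \<And>t. t \<in> {0..2} \<Longrightarrow> \<bar>b M t\<bar> \<le> B\<rbrakk> \<Longrightarrow>
      \<exists>c. (\<forall>t\<in>{0..\<kappa>}. (\<lambda>l. c l * cos (pi * real l / \<kappa> * t)) sums shifted_cutoff (b 0) (b 0 0) \<mu> t) \<and>
          (\<forall>P. (\<Sum>l\<le>P. \<bar>c l\<bar> * (1 + pi * real l / \<kappa>) powr g) \<le> K * B)"
proof -
  define Z where "Z = (\<Sum>l. real l powr (-3/2))"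
  have Zsum: "summable (\<lambda>l. real l powr (-3/2))" by (simp add: summable_real_powr_iff)
  have Z0: "Z \<ge> 0" unfolding Z_def by (intro suminf_nonneg Zsum) simp
  define w where "w = pi / \<kappa>"
  have w: "w > 0" using \<kappa> by (simp add: w_def)
  define K where "K = 2 ^ M + 2 / \<kappa> * ((1 + 1 / w) powr g * w powr (g - real M)) * (sqrt Z * \<kappa>)"
  have K0: "K > 0" unfolding K_def using \<kappa> Z0 by (intro add_pos_nonneg mult_nonneg_nonneg) auto
  show thesis
  proof (rule that[OF K0])
    fix b :: "nat \<Rightarrow> real \<Rightarrow> real" and \<mu> B :: real
    assume \<mu>: "\<mu> \<ge> 0" "\<mu> + 2 \<le> \<kappa>"
      and der: "\<And>i t. i < M \<Longrightarrow> t \<in> {0..2} \<Longrightarrow> (b i has_real_derivative b (Suc i) t) (at t within {0..2})"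
      and contM: "continuous_on {0..2} (b M)"
      and b0: "\<And>i. 1 \<le> i \<Longrightarrow> i \<le> M \<Longrightarrow> b i 0 = 0" and b2: "\<And>i. i \<le> M \<Longrightarrow> b i 2 = 0"
      and B: "\<And>t. t \<in> {0..2} \<Longrightarrow> \<bar>b M t\<bar> \<le> B"
    have B0: "B \<ge> 0" using B[of 0] by simp
    have contb: "continuous_on {0..2} (b i)" if "i \<le> M" for i
    proof (cases "i = M")
      case False
      then show ?thesis using that der[of i] by (intro DERIV_continuous_on) auto
    qed (use contM in simp)
    have bbound: "\<bar>b (M - i) t\<bar> \<le> 2 ^ i * B" if "i \<le> M" "t \<in> {0..2}" for i t
      using that
    proof (induction i arbitrary: t)
      case (Suc i)
      have 1: "Suc (M - Suc i) = M - i" using Suc.prems by simp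
      have "norm (b (M - Suc i) 2 - b (M - Suc i) t) \<le> (2 ^ i * B) * norm (2 - t)"
      proof (rule field_differentiable_bound[where S = "{0..2}"])
        show "(b (M - Suc i) has_field_derivative b (M - i) z) (at z within {0..2})" if "z \<in> {0..2}" for z
          using der[of "M - Suc i" z] that Suc.prems 1 by simp
        show "norm (b (M - i) z) \<le> 2 ^ i * B" if "z \<in> {0..2}" for z
          using Suc.IH[OF _ that] Suc.prems by simp
      qed (use Suc.prems in auto)
      also have "\<dots> \<le> (2 ^ i * B) * 2" using Suc.prems B0 by (intro mult_left_mono) auto
      finally show ?case using b2[of "M - Suc i"] by simp
    qed (use B in simp)
    define v where "v i = (if i = 0 then b 0 0 else 0)" for i :: nat
    define F where "F i = shifted_cutoff (b i) (v i) \<mu>" for i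
    have bv: "b i 0 = v i" if "i \<le> M" for i using b0[of i] that by (auto simp: v_def)
    have contF: "continuous_on {0..\<kappa>} (F i)" if "i \<le> M" for i
      unfolding F_def by (intro continuous_on_shifted_cutoff contb bv b2 that)
    have derF: "(F i has_real_derivative F (Suc i) t) (at t)"
      if iM: "i < M" and t: "t \<in> {0<..<\<kappa>} - {\<mu>, \<mu> + 2}" for i t
    proof -
      consider "t < \<mu>" | "\<mu> < t" "t < \<mu> + 2" | "t > \<mu> + 2" using t by fastforce
      then show ?thesis
      proof cases
        case 1
        have "((\<lambda>_. v i) has_real_derivative F (Suc i) t) (at t)"
          using 1 by (simp add: F_def shifted_cutoff_def v_def)
        moreover have "\<forall>\<^sub>F s in nhds t. F i s = v i"
          using eventually_nhds_in_open[of "{..<\<mu>}" t] 1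
          by (auto simp: F_def shifted_cutoff_def elim!: eventually_mono)
        ultimately show ?thesis by (subst DERIV_cong_ev[OF refl _ refl])
      next
        case 2
        have "(b i has_real_derivative b (Suc i) (t - \<mu>)) (at (t - \<mu>))"
          using der[of i "t - \<mu>"] iM 2 at_within_interior[of "t - \<mu>" "{0..2}"] by simp
        then have "((\<lambda>s. b i (s - \<mu>)) has_real_derivative F (Suc i) t) (at t)"
          using 2 DERIV_shift[of "b i" "b (Suc i) (t - \<mu>)" t "- \<mu>"]
          by (simp add: F_def shifted_cutoff_def)
        moreover have "\<forall>\<^sub>F s in nhds t. F i s = b i (s - \<mu>)"
          using eventually_nhds_in_open[of "{\<mu><..<\<mu>+2}" t] 2
          by (auto simp: F_def shifted_cutoff_def elim!: eventually_mono)
        ultimately show ?thesis by (subst DERIV_cong_ev[OF refl _ refl])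
      next
        case 3
        have "((\<lambda>_. 0) has_real_derivative F (Suc i) t) (at t)"
          using 3 by (simp add: F_def shifted_cutoff_def)
        moreover have "\<forall>\<^sub>F s in nhds t. F i s = 0"
          using eventually_nhds_in_open[of "{\<mu>+2<..}" t] 3
          by (auto simp: F_def shifted_cutoff_def elim!: eventually_mono)
        ultimately show ?thesis by (subst DERIV_cong_ev[OF refl _ refl])
      qed
    qed
    have F0: "F i 0 = v i" for i using \<mu> by (simp add: F_def shifted_cutoff_def)
    have F\<kappa>: "F i \<kappa> = 0" if "i \<le> M" for i
      using \<mu> b2[OF that] by (auto simp: F_def shifted_cutoff_def order_antisym)
    have Fbound: "\<bar>F i t\<bar> \<le> 2 ^ (M - i) * B" if "i \<le> M" for i t
    proof -
      have "\<bar>b i s\<bar> \<le> 2 ^ (M - i) * B" if "s \<in> {0..2}" for s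
        using bbound[of "M - i" s] that \<open>i \<le> M\<close> by simp
      moreover from this[of 0] have "\<bar>v i\<bar> \<le> 2 ^ (M - i) * B" using bv[OF that] by simp
      ultimately show ?thesis using B0 by (auto simp: F_def shifted_cutoff_def)
    qed
    define I where "I l = integral {0..\<kappa>} (\<lambda>t. F M t * cos (pi * real l / \<kappa> * t + real M * (pi / 2)))" for l
    define c where "c l = (if l = 0 then 1 else 2) / \<kappa> * integral {0..\<kappa>} (\<lambda>t. F 0 t * cos (pi * real l / \<kappa> * t))" for l
    have parts: "(w * real l) ^ i * integral {0..\<kappa>} (\<lambda>t. F 0 t * cos (w * real l * t)) =
        integral {0..\<kappa>} (\<lambda>t. F i t * cos (w * real l * t + real i * (pi / 2)))" if "i \<le> M" for i l
      using that
    proof (induction i)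
      case (Suc i)
      have phase: "real (Suc i) * (pi / 2) = real i * (pi / 2) + pi / 2" by (simp add: algebra_simps)
      have "w * real l * integral {0..\<kappa>} (\<lambda>t. F i t * cos (w * real l * t + real i * (pi / 2))) =
        integral {0..\<kappa>} (\<lambda>t. F (Suc i) t * cos (w * real l * t + real (Suc i) * (pi / 2)))"
        unfolding phase
      proof (rule integral_by_parts_cos)
        show "F i 0 * sin (real i * (pi / 2)) = 0" by (simp add: F0 v_def)
        show "F i \<kappa> = 0" using Suc.prems by (intro F\<kappa>) simp
        show "(F i has_real_derivative F (Suc i) t) (at t)" if "t \<in> {0<..<\<kappa>} - {\<mu>, \<mu> + 2}" for t
          using Suc.prems that by (intro derF) auto
      qed (use Suc.prems \<kappa> in \<open>auto intro!: contF\<close>)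
      moreover have "(w * real l) ^ i * integral {0..\<kappa>} (\<lambda>t. F 0 t * cos (w * real l * t)) =
        integral {0..\<kappa>} (\<lambda>t. F i t * cos (w * real l * t + real i * (pi / 2)))"
        using Suc by simp
      ultimately show ?case by (simp only: power_Suc mult.assoc[of "w * real l"])
    qed simp
    have cl: "\<bar>c l\<bar> = 2 / \<kappa> * ((w * real l) powr (- real M) * \<bar>I l\<bar>)" if "l \<ge> 1" for l
    proof -
      have wl: "w * real l > 0" using w that by simp
      have "(w * real l) ^ M * integral {0..\<kappa>} (\<lambda>t. F 0 t * cos (w * real l * t)) = I l"
        using parts[of M l] by (simp add: I_def w_def)
      moreover have "(w * real l) powr (- real M) * (w * real l) ^ M = 1"
        unfolding powr_realpow[OF wl, symmetric] powr_add[symmetric]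
        using w that by simp
      ultimately have "integral {0..\<kappa>} (\<lambda>t. F 0 t * cos (w * real l * t)) = (w * real l) powr (- real M) * I l"
        by (metis mult.assoc mult_1)
      then show ?thesis using that \<kappa> by (simp add: c_def w_def abs_mult)
    qed
    have bessel: "(\<Sum>l=1..P. (I l)\<^sup>2) \<le> (\<kappa> * B)\<^sup>2" for P
    proof -
      have "(\<Sum>l=1..P. (I l)\<^sup>2) \<le> \<kappa> / 2 * integral {0..\<kappa>} (\<lambda>t. (F M t)\<^sup>2)"
        unfolding I_def by (rule bessel_cos_phase[OF \<kappa> contF[OF order.refl]])
      also have "integral {0..\<kappa>} (\<lambda>t. (F M t)\<^sup>2) \<le> integral {0..\<kappa>} (\<lambda>t. B\<^sup>2)"
      proof (intro integral_le integrable_continuous_interval continuous_intros contF order.refl)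
        show "(F M t)\<^sup>2 \<le> B\<^sup>2" for t using Fbound[of M t] B0 by (simp add: abs_le_square_iff[symmetric])
      qed
      also have "\<kappa> / 2 * integral {0..\<kappa>} (\<lambda>t. B\<^sup>2) \<le> (\<kappa> * B)\<^sup>2"
        using \<kappa> B0 by (simp add: power2_eq_square)
      finally show ?thesis using \<kappa> by simp
    qed
    have bound: "(\<Sum>l\<le>P. \<bar>c l\<bar> * (1 + pi * real l / \<kappa>) powr g) \<le> K * B" for P
    proof -
      define Q where "Q = 2 / \<kappa> * ((1 + 1 / w) powr g * w powr (g - real M))"
      have Q0: "Q \<ge> 0" using \<kappa> by (simp add: Q_def)
      have "\<bar>c 0\<bar> \<le> 2 ^ M * B"
      proof -
        have "\<bar>integral {0..\<kappa>} (F 0)\<bar> \<le> (2 ^ M * B) * (\<kappa> - 0)"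
          using integral_bound[of 0 \<kappa> "F 0" "2 ^ M * B"] contF[of 0] Fbound[of 0] \<kappa> by simp
        then show ?thesis using \<kappa> by (simp add: c_def field_simps)
      qed
      have "\<bar>c l\<bar> * (1 + pi * real l / \<kappa>) powr g \<le> Q * (real l powr (-3/4) * \<bar>I l\<bar>)" if "l \<ge> 1" for l
      proof -
        have wl: "w * real l > 0" using w that by simp
        have "1 + w * real l \<le> (1 + 1 / w) * (w * real l)" using w that by (simp add: field_simps)
        then have "(1 + w * real l) powr g \<le> ((1 + 1 / w) * (w * real l)) powr g"
          using wl g by (intro powr_mono2) auto
        also have "\<dots> = (1 + 1 / w) powr g * (w * real l) powr g" using w by (simp add: powr_mult)
        finally have "(1 + w * real l) powr g * (w * real l) powr (- real M) \<le>
            (1 + 1 / w) powr g * (w * real l) powr g * (w * real l) powr (- real M)"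
          by (intro mult_right_mono) auto
        also have "\<dots> = (1 + 1 / w) powr g * (w * real l) powr (g - real M)"
          by (simp add: powr_add[symmetric] mult.assoc)
        also have "(w * real l) powr (g - real M) = w powr (g - real M) * real l powr (g - real M)"
          using w by (simp add: powr_mult)
        also have "(1 + 1 / w) powr g * (w powr (g - real M) * real l powr (g - real M)) \<le>
           (1 + 1 / w) powr g * (w powr (g - real M) * real l powr (-3/4))"
          using that g by (intro mult_left_mono powr_mono) auto
        finally have "(1 + w * real l) powr g * (w * real l) powr (- real M) * (2 / \<kappa> * \<bar>I l\<bar>) \<le>
           (1 + 1 / w) powr g * (w powr (g - real M) * real l powr (-3/4)) * (2 / \<kappa> * \<bar>I l\<bar>)"
          using \<kappa> by (intro mult_right_mono) auto
        then show ?thesis unfolding cl[OF that] Q_def by (simp add: w_def mult_ac)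
      qed
      then have "(\<Sum>l=1..P. \<bar>c l\<bar> * (1 + pi * real l / \<kappa>) powr g) \<le> Q * (\<Sum>l=1..P. real l powr (-3/4) * \<bar>I l\<bar>)"
        unfolding sum_distrib_left by (intro sum_mono) auto
      also have "(\<Sum>l=1..P. real l powr (-3/4) * \<bar>I l\<bar>) \<le> sqrt Z * (\<kappa> * B)"
      proof -
        have "(\<Sum>l=1..P. real l powr (-3/4) * \<bar>I l\<bar>)\<^sup>2 \<le> (\<Sum>l=1..P. (real l powr (-3/4))\<^sup>2) * (\<Sum>l=1..P. \<bar>I l\<bar>\<^sup>2)"
          by (rule Cauchy_Schwarz_ineq_sum)
        also have "\<dots> \<le> Z * (\<kappa> * B)\<^sup>2"
        proof (intro mult_mono)
          have "(\<Sum>l=1..P. (real l powr (-3/4))\<^sup>2) = (\<Sum>l=1..P. real l powr (-3/2))"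
            by (intro sum.cong refl) (simp add: power2_eq_square flip: powr_add)
          also have "\<dots> \<le> Z" unfolding Z_def by (intro sum_le_suminf Zsum) auto
          finally show "(\<Sum>l=1..P. (real l powr (-3/4))\<^sup>2) \<le> Z" .
        qed (use bessel Z0 in \<open>auto intro: sum_nonneg\<close>)
        also have "\<dots> = (sqrt Z * (\<kappa> * B))\<^sup>2" using Z0 by (simp add: power_mult_distrib)
        finally show ?thesis
          by (rule power2_le_imp_le) (use Z0 \<kappa> B0 in simp)
      qed
      finally have "(\<Sum>l=1..P. \<bar>c l\<bar> * (1 + pi * real l / \<kappa>) powr g) \<le> Q * (sqrt Z * (\<kappa> * B))"
        using Q0 by (simp add: mult_left_mono)
      moreover have "(\<Sum>l\<le>P. \<bar>c l\<bar> * (1 + pi * real l / \<kappa>) powr g) = \<bar>c 0\<bar> + (\<Sum>l=1..P. \<bar>c l\<bar> * (1 + pi * real l / \<kappa>) powr g)"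
        by (simp add: atMost_atLeast0 sum.atLeast_Suc_atMost)
      ultimately have "(\<Sum>l\<le>P. \<bar>c l\<bar> * (1 + pi * real l / \<kappa>) powr g) \<le> 2 ^ M * B + Q * (sqrt Z * (\<kappa> * B))"
        using \<open>\<bar>c 0\<bar> \<le> 2 ^ M * B\<close> by linarith
      also have "\<dots> = K * B" by (simp add: K_def Q_def algebra_simps)
      finally show ?thesis .
    qed
    have "summable (\<lambda>l. \<bar>c l\<bar>)"
    proof (rule summableI_nonneg_bounded)
      fix P
      have "(\<Sum>l<P. \<bar>c l\<bar>) \<le> (\<Sum>l\<le>P. \<bar>c l\<bar>)" by (intro sum_mono2) auto
      also have "\<dots> \<le> (\<Sum>l\<le>P. \<bar>c l\<bar> * (1 + pi * real l / \<kappa>) powr g)"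
      proof (intro sum_mono)
        fix l
        have "1 \<le> (1 + pi * real l / \<kappa>) powr g" using g \<kappa> by (intro ge_one_powr_ge_zero) auto
        then show "\<bar>c l\<bar> \<le> \<bar>c l\<bar> * (1 + pi * real l / \<kappa>) powr g"
          using mult_left_mono[of 1 "(1 + pi * real l / \<kappa>) powr g" "\<bar>c l\<bar>"] by simp
      qed
      also have "\<dots> \<le> K * B" by (rule bound)
      finally show "(\<Sum>l<P. \<bar>c l\<bar>) \<le> K * B" .
    qed simp
    then have "\<forall>t\<in>{0..\<kappa>}. (\<lambda>l. c l * cos (pi * real l / \<kappa> * t)) sums F 0 t"
      unfolding c_def by (intro ballI cosine_series_sums[OF \<kappa> contF[of 0]]) auto
    then show "\<exists>c. (\<forall>t\<in>{0..\<kappa>}. (\<lambda>l. c l * cos (pi * real l / \<kappa> * t)) sums shifted_cutoff (b 0) (b 0 0) \<mu> t) \<and>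
          (\<forall>P. (\<Sum>l\<le>P. \<bar>c l\<bar> * (1 + pi * real l / \<kappa>) powr g) \<le> K * B)"
      using bound by (intro exI[of _ c]) (simp add: F_def v_def)
  qed
qed

section \<open>Localization of the kernels\<close>

lemma (in jacobi_weight) integral_mu_Cauchy_Schwarz:
  fixes f g :: "real \<Rightarrow> real"
  assumes f: "continuous_on {-1..1} f" and g: "continuous_on {-1..1} g"
  shows "(LINT t|mu. f t * g t)\<^sup>2 \<le> (LINT t|mu. (f t)\<^sup>2) * (LINT t|mu. (g t)\<^sup>2)"
proof -
  define a where "a = (LINT t|mu. (f t)\<^sup>2)"
  define b where "b = (LINT t|mu. (g t)\<^sup>2)"
  define c where "c = (LINT t|mu. f t * g t)"
  have q: "0 \<le> z\<^sup>2 * a - 2 * z * c + b" for z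
  proof -
    have "0 \<le> (LINT t|mu. (z * f t - g t)\<^sup>2)" by simp
    also have "\<dots> = (LINT t|mu. z\<^sup>2 * (f t)\<^sup>2 - 2 * z * (f t * g t) + (g t)\<^sup>2)"
      by (intro Bochner_Integration.integral_cong refl) (simp add: power2_eq_square algebra_simps)
    also have "\<dots> = z\<^sup>2 * a - 2 * z * c + b"
      unfolding a_def b_def c_def
      by (subst Bochner_Integration.integral_add Bochner_Integration.integral_diff;
          (intro integrable_mu continuous_intros f g)?)+ simp
    finally show ?thesis .
  qed
  have a0: "a \<ge> 0" by (simp add: a_def)
  have "c\<^sup>2 \<le> a * b"
  proof (cases "a = 0")
    case True
    have "c = 0"
    proof (rule ccontr)
      assume "c \<noteq> 0"
      then show False using q[of "(b + 1) / (2 * c)"] True by simp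
    qed
    then show ?thesis using True by simp
  next
    case False
    have "(c / a)\<^sup>2 * a - 2 * (c / a) * c + b = b - c\<^sup>2 / a"
      using False by (simp add: power2_eq_square field_simps)
    then have "c\<^sup>2 / a \<le> b" using q[of "c / a"] by simp
    then show ?thesis using False a0 by (simp add: field_simps)
  qed
  then show ?thesis by (simp add: a_def b_def c_def)
qed

definition real_cutoff :: "nat \<Rightarrow> (nat \<Rightarrow> real \<Rightarrow> real) \<Rightarrow> real \<Rightarrow> bool" where
  "real_cutoff M b B \<longleftrightarrow>
     (\<forall>i<M. \<forall>t\<in>{0..2}. (b i has_real_derivative b (Suc i) t) (at t within {0..2})) \<and>
     continuous_on {0..2} (b M) \<and> (\<forall>i\<in>{1..M}. b i 0 = 0) \<and> (\<forall>i\<le>M. b i 2 = 0) \<and>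
     (\<forall>t\<in>{0..2}. \<bar>b M t\<bar> \<le> B)"

context jacobi_weight
begin

lemma localized_reproducing_polynomial:
  assumes "n \<ge> 1" "x \<in> {-1..1}"
  obtains T where "degree T \<le> 2 * n * k"
    "\<And>v. v \<in> {-1..1} \<Longrightarrow> \<bar>poly T v\<bar> * (1 + real n * arccos_dist x v) ^ k \<le> 24 ^ k"
    "\<And>q. degree q \<le> 2 * n \<Longrightarrow> ip (T * ker ((2 + 2 * k) * n) x) q = poly q x"
proof -
  obtain T where T: "degree T \<le> 2 * n * k" "poly T x = 1"
    "\<And>v. v \<in> {-1..1} \<Longrightarrow> \<bar>poly T v\<bar> * (1 + real n * arccos_dist x v) ^ k \<le> 24 ^ k"
    using localized_polynomial[OF assms, of k] by blast
  have "ip (T * ker ((2 + 2 * k) * n) x) q = poly q x" if q: "degree q \<le> 2 * n" for q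
  proof -
    have "degree (T * q) \<le> (2 + 2 * k) * n"
      using degree_mult_le[of T q] T(1) q by (simp add: algebra_simps)
    from ip_ker[OF this, of x] show ?thesis by (simp add: ip_def T(2) mult_ac)
  qed
  with T show thesis by (intro that[of T]) auto
qed

lemma kernel_weighted_L2_bound:
  assumes k: "k \<ge> 1"
  shows "\<exists>C>0. \<forall>b B n x. real_cutoff (3 * k - 1) b B \<longrightarrow> n \<ge> 1 \<longrightarrow> x \<in> {-1..1} \<longrightarrow>
     (LINT t|mu. (1 + (real n * (arccos t - arccos x))\<^sup>2) ^ k *
        (\<Sum>j\<le>2*n. b 0 (real j / real n) * poly (pn j) x * poly (pn j) t)\<^sup>2)
     \<le> C * B\<^sup>2 * (real n / jacobi_w \<alpha> \<beta> n x)"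
proof -
  define \<kappa> where "\<kappa> = 2 + 4 * real k + lam"
  define M where "M = 3 * k - 1"
  have rM: "real M = 3 * real k - 1" using k by (simp add: M_def of_nat_diff)
  have \<kappa>: "\<kappa> > 0" using lam_nonneg by (simp add: \<kappa>_def)
  have M1: "M \<ge> 1" using k unfolding M_def by linarith
  have g: "5/4 * real k \<ge> 0" "5/4 * real k \<le> real M - 3/4" using k rM by auto
  from cutoff_cosine_expansion[OF \<kappa> M1 g] obtain K where K: "K > 0"
    "\<And>(b :: nat \<Rightarrow> real \<Rightarrow> real) \<mu> B. \<lbrakk>\<mu> \<ge> 0; \<mu> + 2 \<le> \<kappa>;
      \<And>i t. i < M \<Longrightarrow> t \<in> {0..2} \<Longrightarrow> (b i has_real_derivative b (Suc i) t) (at t within {0..2});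
      continuous_on {0..2} (b M); \<And>i. 1 \<le> i \<Longrightarrow> i \<le> M \<Longrightarrow> b i 0 = 0; \<And>i. i \<le> M \<Longrightarrow> b i 2 = 0;
      \<And>t. t \<in> {0..2} \<Longrightarrow> \<bar>b M t\<bar> \<le> B\<rbrakk> \<Longrightarrow>
      \<exists>c. (\<forall>t\<in>{0..\<kappa>}. (\<lambda>l. c l * cos (pi * real l / \<kappa> * t)) sums shifted_cutoff (b 0) (b 0 0) \<mu> t) \<and>
          (\<forall>P. (\<Sum>l\<le>P. \<bar>c l\<bar> * (1 + pi * real l / \<kappa>) powr (5/4 * real k)) \<le> K * B)"
    by blast
  obtain C where C: "C > 0" "\<And>n x N. n \<ge> 1 \<Longrightarrow> x \<in> {-1..1} \<Longrightarrow> N \<le> (2 + 2 * k) * n \<Longrightarrow>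
      poly (ker N x) x \<le> C * real n / jacobi_w \<alpha> \<beta> n x"
    using ker_diag_le[of "2 + 2 * k"] by blast
  have "(LINT t|mu. (1 + (real n * (arccos t - arccos x))\<^sup>2) ^ k *
        (\<Sum>j\<le>2*n. b 0 (real j / real n) * poly (pn j) x * poly (pn j) t)\<^sup>2)
     \<le> (K\<^sup>2 * (24 ^ k)\<^sup>2 * C) * B\<^sup>2 * (real n / jacobi_w \<alpha> \<beta> n x)"
    if b: "real_cutoff M b B" and n: "n \<ge> 1" and x: "x \<in> {-1..1}" for b B n x
  proof -
    have n0: "real n > 0" and n1: "real n \<ge> 1" using n by auto
    define \<mu> where "\<mu> = lam / real n"
    have "\<mu> \<le> lam / 1" unfolding \<mu>_def using lam_nonneg n1 by (intro divide_left_mono) auto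
    then have \<mu>: "\<mu> \<ge> 0" "\<mu> + 2 \<le> \<kappa>" using lam_nonneg n1 by (auto simp: \<mu>_def \<kappa>_def)
    have "\<exists>c. (\<forall>t\<in>{0..\<kappa>}. (\<lambda>l. c l * cos (pi * real l / \<kappa> * t)) sums shifted_cutoff (b 0) (b 0 0) \<mu> t) \<and>
        (\<forall>P. (\<Sum>l\<le>P. \<bar>c l\<bar> * (1 + pi * real l / \<kappa>) powr (5/4 * real k)) \<le> K * B)"
      by (rule K(2)[OF \<mu>]) (use b in \<open>auto simp: real_cutoff_def\<close>)
    then obtain c where c: "\<And>t. t \<in> {0..\<kappa>} \<Longrightarrow> (\<lambda>l. c l * cos (pi * real l / \<kappa> * t)) sums shifted_cutoff (b 0) (b 0 0) \<mu> t"
      "\<And>P. (\<Sum>l\<le>P. \<bar>c l\<bar> * (1 + pi * real l / \<kappa>) powr (5/4 * real k)) \<le> K * B"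
      by blast
    obtain T where T: "degree T \<le> 2 * n * k"
      "\<And>v. v \<in> {-1..1} \<Longrightarrow> \<bar>poly T v\<bar> * (1 + real n * arccos_dist x v) ^ k \<le> 24 ^ k"
      "\<And>q. degree q \<le> 2 * n \<Longrightarrow> ip (T * ker ((2 + 2 * k) * n) x) q = poly q x"
      using localized_reproducing_polynomial[OF n x, of k] by blast
    define N where "N = (2 + 2 * k) * n"
    define Rx where "Rx = T * ker N x"
    define D where "D = (2 + 4 * k) * n"
    define f where "f j = (if j \<le> 2 * n then b 0 (real j / real n) else 0)" for j
    define \<Psi> where "\<Psi> t = (1 + (real n * (arccos t - arccos x))\<^sup>2) ^ k" for t
    have degR: "degree Rx \<le> D"
      unfolding Rx_def D_def N_def using degree_mult_le[of T "ker ((2 + 2 * k) * n) x"] T(1) degree_ker[of "(2 + 2 * k) * n" x]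
      by (simp add: algebra_simps)
    have lim: "(\<lambda>P. \<Sum>l\<le>P. c l * cos (pi * real l / (\<kappa> * real n) * freq j)) \<longlonglongrightarrow> f j" if j: "j \<le> D" for j
    proof -
      define t where "t = freq j / real n"
      have t: "t = real j / real n + \<mu>" by (simp add: t_def freq_def \<mu>_def add_divide_distrib)
      have "real j \<le> (2 + 4 * real k) * real n" using of_nat_mono[OF j, where 'a = real] by (simp add: D_def algebra_simps)
      then have "real j / real n \<le> 2 + 4 * real k" using n0 by (simp add: field_simps)
      then have "t \<in> {0..\<kappa>}" using \<mu> \<open>\<mu> \<le> lam / 1\<close> unfolding t by (auto simp: \<kappa>_def)
      from c(1)[OF this] have "(\<lambda>P. \<Sum>l\<le>P. c l * cos (pi * real l / \<kappa> * t)) \<longlonglongrightarrow> shifted_cutoff (b 0) (b 0 0) \<mu> t"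
        by (simp add: sums_def_le)
      moreover have "pi * real l / \<kappa> * t = pi * real l / (\<kappa> * real n) * freq j" for l
        by (simp add: t_def)
      moreover have "shifted_cutoff (b 0) (b 0 0) \<mu> t = f j"
      proof -
        have "t \<le> \<mu> \<longleftrightarrow> j = 0" using n0 unfolding t by (simp add: divide_le_0_iff)
        moreover have "t \<le> \<mu> + 2 \<longleftrightarrow> j \<le> 2 * n"
        proof -
          have "t \<le> \<mu> + 2 \<longleftrightarrow> real j \<le> real (2 * n)" using n0 unfolding t by (simp add: field_simps)
          then show ?thesis by (simp only: of_nat_le_iff)
        qed
        ultimately show ?thesis by (simp add: shifted_cutoff_def f_def t)
      qed
      ultimately show ?thesis by simp
    qed
    have "(LINT t|mu. \<Psi> t * (\<Sum>j\<le>D. f j * ip Rx (pn j) * poly (pn j) t)\<^sup>2) \<le>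
        (K * B)\<^sup>2 * (LINT t|mu. \<Psi> t * (\<Sum>j\<le>D. ip Rx (pn j) * poly (pn j) t)\<^sup>2)"
      unfolding \<Psi>_def
    proof (rule cos_multiplier_bound[OF n0 _ _ lim])
      show "pi * real l / (\<kappa> * real n) \<ge> 0" for l using \<kappa> by simp
      show "(\<Sum>l\<le>P. \<bar>c l\<bar> * (1 + real n * (pi * real l / (\<kappa> * real n))) powr (5/4 * real k)) \<le> K * B" for P
      proof -
        have "real n * (pi * real l / (\<kappa> * real n)) = pi * real l / \<kappa>" for l using n0 by simp
        then show ?thesis using c(2)[of P] by (simp only:)
      qed
    qed
    also have "(\<lambda>t. \<Sum>j\<le>D. ip Rx (pn j) * poly (pn j) t) = poly Rx"
      by (subst (2) pn_expansion[OF degR]) (simp add: poly_sum fun_eq_iff)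
    also have "(\<lambda>t. \<Psi> t * (\<Sum>j\<le>D. f j * ip Rx (pn j) * poly (pn j) t)\<^sup>2) =
       (\<lambda>t. \<Psi> t * (\<Sum>j\<le>2*n. b 0 (real j / real n) * poly (pn j) x * poly (pn j) t)\<^sup>2)"
    proof -
      have sub: "{..2 * n} \<subseteq> {..D}" by (auto simp: D_def)
      have "(\<Sum>j\<le>D. f j * ip Rx (pn j) * poly (pn j) t) = (\<Sum>j\<le>2*n. f j * ip Rx (pn j) * poly (pn j) t)" for t
        by (intro sum.mono_neutral_right sub) (auto simp: f_def)
      also have "(\<Sum>j\<le>2*n. f j * ip Rx (pn j) * poly (pn j) t) = (\<Sum>j\<le>2*n. b 0 (real j / real n) * poly (pn j) x * poly (pn j) t)" for t
        unfolding Rx_def N_def using T(3) degree_pn by (intro sum.cong refl) (auto simp: f_def intro: order.trans)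
      finally show ?thesis by (simp only:)
    qed
    finally have 1: "(LINT t|mu. \<Psi> t * (\<Sum>j\<le>2*n. b 0 (real j / real n) * poly (pn j) x * poly (pn j) t)\<^sup>2)
       \<le> (K * B)\<^sup>2 * (LINT t|mu. \<Psi> t * (poly Rx t)\<^sup>2)" .
    have "(LINT t|mu. \<Psi> t * (poly Rx t)\<^sup>2) \<le> (LINT t|mu. (24 ^ k)\<^sup>2 * (poly (ker N x) t * poly (ker N x) t))"
    proof (intro integral_mono integrable_mu continuous_intros)
      show "continuous_on {-1..1} \<Psi>" unfolding \<Psi>_def by (intro continuous_intros) auto
      fix t assume "t \<in> space mu"
      then have t: "t \<in> {-1..1}" by simp
      define r where "r = real n * arccos_dist x t"
      have r: "r \<ge> 0" by (simp add: r_def arccos_dist_nonneg)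
      have "(real n * (arccos t - arccos x))\<^sup>2 = r\<^sup>2"
        by (simp add: r_def arccos_dist_def power_mult_distrib power2_commute)
      then have "\<Psi> t = (1 + r\<^sup>2) ^ k" by (simp add: \<Psi>_def)
      also have "\<dots> \<le> ((1 + r)\<^sup>2) ^ k" using r by (intro power_mono) (auto simp: power2_eq_square algebra_simps)
      finally have "\<Psi> t \<le> ((1 + r) ^ k)\<^sup>2" by (simp add: power_mult[symmetric] mult.commute)
      then have "\<Psi> t * (poly T t)\<^sup>2 \<le> ((1 + r) ^ k)\<^sup>2 * (poly T t)\<^sup>2" by (intro mult_right_mono) auto
      also have "\<dots> = (\<bar>poly T t\<bar> * (1 + r) ^ k)\<^sup>2" by (simp add: power_mult_distrib)
      also have "\<dots> \<le> (24 ^ k)\<^sup>2" using T(2)[OF t] r by (intro power_mono) (auto simp: r_def)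
      finally have "\<Psi> t * (poly T t)\<^sup>2 * (poly (ker N x) t)\<^sup>2 \<le> (24 ^ k)\<^sup>2 * (poly (ker N x) t)\<^sup>2"
        by (intro mult_right_mono) auto
      then show "\<Psi> t * (poly Rx t)\<^sup>2 \<le> (24 ^ k)\<^sup>2 * (poly (ker N x) t * poly (ker N x) t)"
        by (simp add: Rx_def power_mult_distrib power2_eq_square mult_ac)
    qed
    also have "\<dots> = (24 ^ k)\<^sup>2 * poly (ker N x) x"
      using ip_ker[OF degree_ker, of N x x] by (simp add: ip_def)
    also have "\<dots> \<le> (24 ^ k)\<^sup>2 * (C * real n / jacobi_w \<alpha> \<beta> n x)"
      by (intro mult_left_mono C(2)[OF n x]) (simp_all add: N_def)
    finally have "(K * B)\<^sup>2 * (LINT t|mu. \<Psi> t * (poly Rx t)\<^sup>2) \<le> (K * B)\<^sup>2 * ((24 ^ k)\<^sup>2 * (C * real n / jacobi_w \<alpha> \<beta> n x))"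
      by (intro mult_left_mono) auto
    with 1 have "(LINT t|mu. \<Psi> t * (\<Sum>j\<le>2*n. b 0 (real j / real n) * poly (pn j) x * poly (pn j) t)\<^sup>2)
       \<le> (K * B)\<^sup>2 * ((24 ^ k)\<^sup>2 * (C * real n / jacobi_w \<alpha> \<beta> n x))" by linarith
    then show ?thesis unfolding \<Psi>_def by (simp add: power_mult_distrib mult_ac)
  qed
  then show ?thesis using K(1) C(1) unfolding M_def
    by (intro exI[of _ "K\<^sup>2 * (24 ^ k)\<^sup>2 * C"]) auto
qed

lemma real_kernel_bound:
  assumes k: "k \<ge> 1"
  shows "\<exists>C>0. \<forall>b B n x y. real_cutoff (3 * k - 1) b B \<longrightarrow> n \<ge> 1 \<longrightarrow> x \<in> {-1..1} \<longrightarrow> y \<in> {-1..1} \<longrightarrow>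
     \<bar>\<Sum>j\<le>2*n. b 0 (real j / real n) * (poly (pn j) x * poly (pn j) y)\<bar> * (1 + real n * arccos_dist x y) ^ k
     \<le> C * B * (real n / (sqrt (jacobi_w \<alpha> \<beta> n x) * sqrt (jacobi_w \<alpha> \<beta> n y)))"
proof -
  obtain C1 where C1: "C1 > 0" "\<And>b B n x. \<lbrakk>real_cutoff (3 * k - 1) b B; n \<ge> 1; x \<in> {-1..1}\<rbrakk> \<Longrightarrow>
     (LINT t|mu. (1 + (real n * (arccos t - arccos x))\<^sup>2) ^ k *
        (\<Sum>j\<le>2*n. b 0 (real j / real n) * poly (pn j) x * poly (pn j) t)\<^sup>2)
     \<le> C1 * B\<^sup>2 * (real n / jacobi_w \<alpha> \<beta> n x)"
    using kernel_weighted_L2_bound[OF k] by blast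
  obtain C where C: "C > 0" "\<And>n x N. n \<ge> 1 \<Longrightarrow> x \<in> {-1..1} \<Longrightarrow> N \<le> (2 + 2 * k) * n \<Longrightarrow>
      poly (ker N x) x \<le> C * real n / jacobi_w \<alpha> \<beta> n x"
    using ker_diag_le[of "2 + 2 * k"] by blast
  have "\<bar>\<Sum>j\<le>2*n. b 0 (real j / real n) * (poly (pn j) x * poly (pn j) y)\<bar> * (1 + real n * arccos_dist x y) ^ k
     \<le> (24 ^ k * sqrt (C * (2 ^ k * C1))) * B * (real n / (sqrt (jacobi_w \<alpha> \<beta> n x) * sqrt (jacobi_w \<alpha> \<beta> n y)))"
    if b: "real_cutoff (3 * k - 1) b B" and n: "n \<ge> 1" and x: "x \<in> {-1..1}" and y: "y \<in> {-1..1}" for b B n x y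
  proof -
    have B0: "B \<ge> 0" using b unfolding real_cutoff_def by (auto dest!: bspec[of _ _ 0])
    obtain T where T: "degree T \<le> 2 * n * k"
      "\<And>v. v \<in> {-1..1} \<Longrightarrow> \<bar>poly T v\<bar> * (1 + real n * arccos_dist y v) ^ k \<le> 24 ^ k"
      "\<And>q. degree q \<le> 2 * n \<Longrightarrow> ip (T * ker ((2 + 2 * k) * n) y) q = poly q y"
      using localized_reproducing_polynomial[OF n y, of k] by blast
    define N where "N = (2 + 2 * k) * n"
    define q where "q = (\<Sum>j\<le>2*n. smult (b 0 (real j / real n) * poly (pn j) x) (pn j))"
    define \<rho> where "\<rho> v = 1 + real n * arccos_dist x v" for v
    have \<rho>: "\<rho> v \<ge> 1" for v by (simp add: \<rho>_def arccos_dist_nonneg)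
    have contd: "continuous_on {-1..1} (\<lambda>v. arccos_dist x v)"
      unfolding arccos_dist_def by (intro continuous_intros) auto
    have cont\<rho>: "continuous_on {-1..1} \<rho>" unfolding \<rho>_def by (intro continuous_intros contd)
    have polyq: "poly q t = (\<Sum>j\<le>2*n. b 0 (real j / real n) * poly (pn j) x * poly (pn j) t)" for t
      by (simp add: q_def poly_sum)
    have degq: "degree q \<le> 2 * n" unfolding q_def
      by (intro degree_sum_le) (auto intro: order.trans[OF degree_smult_le] order.trans[OF degree_pn])
    define kr where "kr = poly (ker N y)"
    have contk: "continuous_on {-1..1} kr" unfolding kr_def by (intro continuous_intros)
    have q_y: "poly q y = (LINT v|mu. poly T v * kr v * poly q v)"
      using T(3)[OF degq] by (simp add: ip_def kr_def N_def)
    have "\<bar>poly q y\<bar> * (\<rho> y) ^ k \<le> (LINT v|mu. \<bar>poly T v * kr v * poly q v\<bar>) * (\<rho> y) ^ k"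
      unfolding q_y using \<rho>[of y] by (intro mult_right_mono integral_abs_bound) simp
    also have "\<dots> = (LINT v|mu. \<bar>poly T v * kr v * poly q v\<bar> * (\<rho> y) ^ k)" by simp
    also have "\<dots> \<le> (LINT v|mu. 24 ^ k * (\<bar>kr v\<bar> * (\<rho> v ^ k * \<bar>poly q v\<bar>)))"
    proof (intro integral_mono integrable_mu continuous_intros cont\<rho> contk)
      fix v assume "v \<in> space mu"
      then have v: "v \<in> {-1..1}" by simp
      define s where "s = 1 + real n * arccos_dist y v"
      have s: "s \<ge> 1" by (simp add: s_def arccos_dist_nonneg)
      have "arccos_dist x y \<le> arccos_dist x v + arccos_dist y v"
        unfolding arccos_dist_def by linarith
      then have "\<rho> y \<le> 1 + real n * (arccos_dist x v + arccos_dist y v)"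
        unfolding \<rho>_def by (simp add: mult_left_mono)
      also have "\<dots> \<le> s * \<rho> v"
        unfolding s_def \<rho>_def by (simp add: algebra_simps arccos_dist_nonneg)
      finally have "(\<rho> y) ^ k \<le> (s * \<rho> v) ^ k" using \<rho>[of y] by (intro power_mono) auto
      then have "\<bar>poly T v * kr v * poly q v\<bar> * (\<rho> y) ^ k \<le> \<bar>poly T v * kr v * poly q v\<bar> * (s * \<rho> v) ^ k"
        by (intro mult_left_mono) auto
      also have "\<dots> = (\<bar>poly T v\<bar> * s ^ k) * (\<bar>kr v\<bar> * (\<rho> v ^ k * \<bar>poly q v\<bar>))"
        by (simp add: abs_mult power_mult_distrib)
      also have "\<dots> \<le> 24 ^ k * (\<bar>kr v\<bar> * (\<rho> v ^ k * \<bar>poly q v\<bar>))"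
        using T(2)[OF v] \<rho>[of v] by (intro mult_right_mono) (auto simp: s_def)
      finally show "\<bar>poly T v * kr v * poly q v\<bar> * (\<rho> y) ^ k \<le> 24 ^ k * (\<bar>kr v\<bar> * (\<rho> v ^ k * \<bar>poly q v\<bar>))" .
    qed
    also have "\<dots> = 24 ^ k * (LINT v|mu. \<bar>kr v\<bar> * (\<rho> v ^ k * \<bar>poly q v\<bar>))" by simp
    finally have 1: "\<bar>poly q y\<bar> * (\<rho> y) ^ k \<le> 24 ^ k * (LINT v|mu. \<bar>kr v\<bar> * (\<rho> v ^ k * \<bar>poly q v\<bar>))" .
    define Wx where "Wx = jacobi_w \<alpha> \<beta> n x"
    define Wy where "Wy = jacobi_w \<alpha> \<beta> n y"
    have W: "Wx > 0" "Wy > 0" unfolding Wx_def Wy_def by (auto intro!: jacobi_w_pos n x y)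
    have "(LINT v|mu. \<bar>kr v\<bar> * (\<rho> v ^ k * \<bar>poly q v\<bar>))\<^sup>2 \<le> (LINT v|mu. \<bar>kr v\<bar>\<^sup>2) * (LINT v|mu. (\<rho> v ^ k * \<bar>poly q v\<bar>)\<^sup>2)"
      by (intro integral_mu_Cauchy_Schwarz continuous_intros contk cont\<rho>)
    also have "\<dots> \<le> (C * real n / Wy) * (2 ^ k * (C1 * B\<^sup>2 * (real n / Wx)))"
    proof (intro mult_mono)
      have "(LINT v|mu. \<bar>kr v\<bar>\<^sup>2) = poly (ker N y) y"
        using ip_ker[OF degree_ker, of N y y] by (simp add: ip_def kr_def power2_eq_square)
      also have "\<dots> \<le> C * real n / Wy" unfolding Wy_def by (rule C(2)[OF n y]) (simp add: N_def)
      finally show "(LINT v|mu. \<bar>kr v\<bar>\<^sup>2) \<le> C * real n / Wy" .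
      have "(LINT v|mu. (\<rho> v ^ k * \<bar>poly q v\<bar>)\<^sup>2) \<le>
         (LINT v|mu. 2 ^ k * ((1 + (real n * (arccos v - arccos x))\<^sup>2) ^ k * (poly q v)\<^sup>2))"
      proof (intro integral_mono integrable_mu continuous_intros cont\<rho>)
        fix v
        define r where "r = real n * arccos_dist x v"
        have "(real n * (arccos v - arccos x))\<^sup>2 = r\<^sup>2"
          by (simp add: r_def arccos_dist_def power_mult_distrib power2_commute)
        moreover have "(\<rho> v ^ k)\<^sup>2 \<le> 2 ^ k * (1 + r\<^sup>2) ^ k"
        proof -
          have "(1 + r)\<^sup>2 \<le> 2 * (1 + r\<^sup>2)"
            using zero_le_power2[of "1 - r"] by (simp add: power2_eq_square algebra_simps)
          then have "((1 + r)\<^sup>2) ^ k \<le> (2 * (1 + r\<^sup>2)) ^ k" by (intro power_mono) auto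
          moreover have "(\<rho> v ^ k)\<^sup>2 = ((1 + r)\<^sup>2) ^ k"
            by (simp add: \<rho>_def r_def power_mult[symmetric] mult.commute)
          ultimately show ?thesis unfolding power_mult_distrib[symmetric] by simp
        qed
        ultimately show "(\<rho> v ^ k * \<bar>poly q v\<bar>)\<^sup>2 \<le> 2 ^ k * ((1 + (real n * (arccos v - arccos x))\<^sup>2) ^ k * (poly q v)\<^sup>2)"
          unfolding power_mult_distrib[of "\<rho> v ^ k"] power2_abs
          by (simp add: mult_right_mono flip: mult.assoc)
      qed auto
      also have "\<dots> = 2 ^ k * (LINT v|mu. (1 + (real n * (arccos v - arccos x))\<^sup>2) ^ k * (poly q v)\<^sup>2)" by simp
      also have "\<dots> \<le> 2 ^ k * (C1 * B\<^sup>2 * (real n / Wx))"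
        unfolding polyq Wx_def by (intro mult_left_mono C1(2)[OF b n x]) simp
      finally show "(LINT v|mu. (\<rho> v ^ k * \<bar>poly q v\<bar>)\<^sup>2) \<le> 2 ^ k * (C1 * B\<^sup>2 * (real n / Wx))" .
    qed (use C(1) W in auto)
    also have "\<dots> = (sqrt (C * (2 ^ k * C1)) * B * (real n / (sqrt Wx * sqrt Wy)))\<^sup>2"
      using C(1) C1(1) W by (simp add: power_mult_distrib power_divide) (simp add: power2_eq_square field_simps)
    finally have "(LINT v|mu. \<bar>kr v\<bar> * (\<rho> v ^ k * \<bar>poly q v\<bar>)) \<le> sqrt (C * (2 ^ k * C1)) * B * (real n / (sqrt Wx * sqrt Wy))"
      by (rule power2_le_imp_le) (use C(1) C1(1) W B0 in simp)
    then have "24 ^ k * (LINT v|mu. \<bar>kr v\<bar> * (\<rho> v ^ k * \<bar>poly q v\<bar>)) \<le> 24 ^ k * (sqrt (C * (2 ^ k * C1)) * B * (real n / (sqrt Wx * sqrt Wy)))"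
      by (intro mult_left_mono) auto
    with 1 have "\<bar>poly q y\<bar> * (\<rho> y) ^ k \<le> 24 ^ k * (sqrt (C * (2 ^ k * C1)) * B * (real n / (sqrt Wx * sqrt Wy)))" by linarith
    then show ?thesis by (simp add: polyq \<rho>_def Wx_def Wy_def mult.assoc)
  qed
  then show ?thesis using C(1) C1(1)
    by (intro exI[of _ "24 ^ k * sqrt (C * (2 ^ k * C1))"]) auto
qed

end

lemma cutoff_derivative:
  assumes "cutoff_of_order M a" "i < M" "t \<ge> 0"
  shows "(deriv_halfline i a has_vector_derivative deriv_halfline (Suc i) a t) (at t within {0..})"
  using assms unfolding cutoff_of_order_def C_halfline_def differentiable_on_def
  by (auto simp: vector_derivative_works)

lemma cutoff_continuous:
  assumes "cutoff_of_order M a" "i \<le> M"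
  shows "continuous_on {0..} (deriv_halfline i a)"
  using assms unfolding cutoff_of_order_def C_halfline_def
  by (cases "i = M") (auto intro: differentiable_imp_continuous_on)

lemma cutoff_eq_0:
  assumes a: "cutoff_of_order M a" and i: "i \<le> M" and t: "t \<ge> 2"
  shows "deriv_halfline i a t = 0"
proof -
  have gt: "deriv_halfline i a t = 0" if "t > 2" for t
    using i that
  proof (induction i arbitrary: t)
    case 0
    have "support_on {0..} a \<subseteq> {0..2}"
      using a closure_subset unfolding cutoff_of_order_def supp_halfline_def by blast
    then have "t \<notin> support_on {0..} a" using 0 by auto
    then show ?case using 0 by (simp add: support_on_def)
  next
    case (Suc i)
    have "(deriv_halfline i a has_vector_derivative deriv_halfline (Suc i) a t) (at t within {0..})"
      using Suc.prems by (intro cutoff_derivative[OF a]) auto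
    moreover have "at t within {0..} = at t" using Suc.prems by (intro at_within_interior) auto
    ultimately have "(deriv_halfline i a has_vector_derivative deriv_halfline (Suc i) a t) (at t)" by simp
    moreover have "(deriv_halfline i a has_vector_derivative 0) (at t)"
      by (rule has_vector_derivative_transform_within_open[of "\<lambda>_. 0" _ _ "{2<..}"])
         (use Suc in auto)
    ultimately show ?case by (rule vector_derivative_unique_at)
  qed
  show ?thesis
  proof (cases "t = 2")
    case True
    have "continuous_on {2..} (deriv_halfline i a)"
      by (rule continuous_on_subset[OF cutoff_continuous[OF a i]]) auto
    moreover have "closure {2<..} = {2::real..}" by (rule closure_greaterThan)
    ultimately have "\<forall>s\<in>closure {2<..}. deriv_halfline i a s = 0"
      using continuous_constant_on_closure[of "{2<..}" "deriv_halfline i a" 0] gt by auto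
    then show ?thesis using True by simp
  qed (use t gt in simp)
qed

lemma cutoff_sup_norm:
  assumes a: "cutoff_of_order M a" and t: "t \<ge> 0"
  shows "cmod (deriv_halfline M a t) \<le> sup_norm_halfline (deriv_halfline M a)"
  unfolding sup_norm_halfline_def
proof (rule cSUP_upper)
  have "bounded (deriv_halfline M a ` {0..2})"
    by (intro compact_imp_bounded compact_continuous_image
        continuous_on_subset[OF cutoff_continuous[OF a order.refl]]) auto
  then obtain B where B: "\<And>t. t \<in> {0..2} \<Longrightarrow> cmod (deriv_halfline M a t) \<le> B"
    unfolding bounded_iff by blast
  have "cmod (deriv_halfline M a t) \<le> max B 0" if "t \<ge> 0" for t
    using B[of t] cutoff_eq_0[OF a order.refl, of t] that by (cases "t \<le> 2") auto
  then show "bdd_above ((\<lambda>t. cmod (deriv_halfline M a t)) ` {0..})"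
    by (intro bdd_aboveI[of _ "max B 0"]) auto
qed (use t in auto)

lemma cutoff_sup_norm_pos:
  assumes a: "cutoff_of_order M a" and t: "t \<ge> 0" "a t \<noteq> 0"
  shows "sup_norm_halfline (deriv_halfline M a) > 0"
proof (rule ccontr)
  assume "\<not> ?thesis"
  then have 0: "deriv_halfline M a s = 0" if "s \<ge> 0" for s
    using order.trans[OF cutoff_sup_norm[OF a that], of 0] \<open>\<not> sup_norm_halfline (deriv_halfline M a) > 0\<close> by simp
  have "\<forall>s\<ge>0. deriv_halfline (M - i) a s = 0" if "i \<le> M" for i
    using that
  proof (induction i)
    case (Suc i)
    have S: "Suc (M - Suc i) = M - i" using Suc.prems by simp
    have d: "(deriv_halfline (M - Suc i) a has_vector_derivative 0) (at s within {0..})" if "s \<in> {0..}" for s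
      using cutoff_derivative[OF a, of "M - Suc i" s] Suc S that by (simp del: deriv_halfline.simps)
    obtain c where c: "\<And>s. s \<in> {0..} \<Longrightarrow> deriv_halfline (M - Suc i) a s = c"
      by (rule has_vector_derivative_zero_constant[OF _ d]) auto
    then have "c = 0" using cutoff_eq_0[OF a, of "M - Suc i" 2] c[of 2] by simp
    with c show ?case by simp
  qed (use 0 in simp)
  from this[of M] t show False by simp
qed

lemma real_cutoff_bounded_linear:
  assumes a: "cutoff_of_order M a" and h: "bounded_linear h" and le: "\<And>z. \<bar>h z\<bar> \<le> cmod z"
  shows "real_cutoff M (\<lambda>i t. h (deriv_halfline i a t)) (sup_norm_halfline (deriv_halfline M a))"
  unfolding real_cutoff_def
proof (intro conjI allI impI ballI)
  note h0 = linear_0[OF bounded_linear.linear[OF h]]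
  show "((\<lambda>t. h (deriv_halfline i a t)) has_real_derivative h (deriv_halfline (Suc i) a t)) (at t within {0..2})"
    if "i < M" "t \<in> {0..2}" for i t
  proof -
    have "(deriv_halfline i a has_vector_derivative deriv_halfline (Suc i) a t) (at t within {0..2})"
      by (rule has_vector_derivative_within_subset[OF cutoff_derivative[OF a that(1)]]) (use that in auto)
    from bounded_linear.has_vector_derivative[OF h this]
    show ?thesis by (simp add: has_real_derivative_iff_has_vector_derivative)
  qed
  show "continuous_on {0..2} (\<lambda>t. h (deriv_halfline M a t))"
    by (intro bounded_linear.continuous_on[OF h] continuous_on_subset[OF cutoff_continuous[OF a order.refl]]) auto
  show "h (deriv_halfline i a 0) = 0" if "i \<in> {1..M}" for i
    using a that by (simp add: cutoff_of_order_def h0)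
  show "h (deriv_halfline i a 2) = 0" if "i \<le> M" for i
    using cutoff_eq_0[OF a that, of 2] by (simp add: h0)
  show "\<bar>h (deriv_halfline M a t)\<bar> \<le> sup_norm_halfline (deriv_halfline M a)" if "t \<in> {0..2}" for t
    using le[of "deriv_halfline M a t"] cutoff_sup_norm[OF a, of t] that by simp
qed

lemma (in jacobi_weight) kernel_localized_cutoff:
  assumes k: "k \<ge> 1"
  shows "\<exists>C>0. \<forall>a. cutoff_of_order (3 * k - 1) a \<longrightarrow>
     kernel_localized \<alpha> \<beta> a k (C * sup_norm_halfline (deriv_halfline (3 * k - 1) a))"
proof -
  define M where "M = 3 * k - 1"
  obtain C where C: "C > 0" "\<And>b B n x y. \<lbrakk>real_cutoff M b B; n \<ge> 1; x \<in> {-1..1}; y \<in> {-1..1}\<rbrakk> \<Longrightarrow>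
     \<bar>\<Sum>j\<le>2*n. b 0 (real j / real n) * (poly (pn j) x * poly (pn j) y)\<bar> * (1 + real n * arccos_dist x y) ^ k
     \<le> C * B * (real n / (sqrt (jacobi_w \<alpha> \<beta> n x) * sqrt (jacobi_w \<alpha> \<beta> n y)))"
    using real_kernel_bound[OF k] unfolding M_def by blast
  have "kernel_localized \<alpha> \<beta> a k (2 * C * sup_norm_halfline (deriv_halfline M a))"
    if a: "cutoff_of_order M a" for a
    unfolding kernel_localized_def
  proof (intro allI impI ballI)
    fix n :: nat and x y :: real
    assume n: "n \<ge> 1" and x: "x \<in> {-1..1}" and y: "y \<in> {-1..1}"
    define B where "B = sup_norm_halfline (deriv_halfline M a)"
    define r where "r = 1 + real n * arccos_dist x y"
    define W where "W = real n / (sqrt (jacobi_w \<alpha> \<beta> n x) * sqrt (jacobi_w \<alpha> \<beta> n y))"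
    define p where "p j = poly (pn j) x * poly (pn j) y" for j
    have r: "r > 0" unfolding r_def by (intro add_pos_nonneg) (auto simp: arccos_dist_nonneg)
    have "a (real j / real n) = 0" if "j \<notin> {..2*n}" for j
    proof -
      have "real j > real (2 * n)" using that by (simp only: of_nat_less_iff) simp
      then have "real j / real n \<ge> 2" using n by (simp add: field_simps)
      then show ?thesis using cutoff_eq_0[OF a, of 0] by simp
    qed
    then have K: "jacobi_kernel \<alpha> \<beta> a n x y = (\<Sum>j\<le>2*n. a (real j / real n) * complex_of_real (p j))"
      unfolding jacobi_kernel_def p_def poly_pn by (intro suminf_finite) auto
    have Re: "\<bar>Re (jacobi_kernel \<alpha> \<beta> a n x y)\<bar> * r ^ k \<le> C * B * W"
      using C(2)[OF real_cutoff_bounded_linear[OF a bounded_linear_Re abs_Re_le_cmod] n x y]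
      by (simp add: K r_def B_def W_def p_def)
    have Im: "\<bar>Im (jacobi_kernel \<alpha> \<beta> a n x y)\<bar> * r ^ k \<le> C * B * W"
      using C(2)[OF real_cutoff_bounded_linear[OF a bounded_linear_Im abs_Im_le_cmod] n x y]
      by (simp add: K r_def B_def W_def p_def)
    have "cmod (jacobi_kernel \<alpha> \<beta> a n x y) * r ^ k \<le>
       (\<bar>Re (jacobi_kernel \<alpha> \<beta> a n x y)\<bar> + \<bar>Im (jacobi_kernel \<alpha> \<beta> a n x y)\<bar>) * r ^ k"
      using r by (intro mult_right_mono cmod_le) simp
    also have "\<dots> \<le> 2 * C * B * W" using Re Im by (simp add: algebra_simps)
    finally show "cmod (jacobi_kernel \<alpha> \<beta> a n x y) \<le> 2 * C * B * W * r powi (- int k)"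
      using r by (simp add: power_int_minus field_simps)
  qed
  then show ?thesis using C(1) unfolding M_def by (intro exI[of _ "2 * C"]) auto
qed

theorem theorem2p5:
  fixes \<alpha> \<beta> :: real and k :: nat
  assumes "\<alpha> \<ge> -1/2" and "\<beta> \<ge> -1/2" and "k \<ge> 1"
  shows "\<exists>C>0.
    (\<forall>a. cutoff_of_order (3 * k - 1) a \<longrightarrow>
       ((\<exists>t\<ge>0. a t \<noteq> 0) \<longrightarrow> C * sup_norm_halfline (deriv_halfline (3 * k - 1) a) > 0) \<and>
       kernel_localized \<alpha> \<beta> a k (C * sup_norm_halfline (deriv_halfline (3 * k - 1) a))) \<and>
    (\<forall>a. admissible_cutoff a \<longrightarrow>
       kernel_localized \<alpha> \<beta> a k (C * sup_norm_halfline (deriv_halfline (3 * k - 1) a)))"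
proof -
  interpret jacobi_weight \<alpha> \<beta> using assms by unfold_locales auto
  obtain C where C: "C > 0" "\<And>a. cutoff_of_order (3 * k - 1) a \<Longrightarrow>
      kernel_localized \<alpha> \<beta> a k (C * sup_norm_halfline (deriv_halfline (3 * k - 1) a))"
    using kernel_localized_cutoff[OF assms(3)] by blast
  have "cutoff_of_order (3 * k - 1) a" if "admissible_cutoff a" for a
    using that by (auto simp: admissible_cutoff_def cutoff_of_order_def)
  then show ?thesis
    using C cutoff_sup_norm_pos by (intro exI[of _ C]) (auto intro!: mult_pos_pos)
qed

end
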